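(* Let $l$ be any complex number and let $W$ be any restricted $\mathbb{Z}$-graded $\widehat{\mathfrak{h}[t]}$-module of level $l$. Then there exists a unique $M(l)$-module structure $Y_W$ on $W$ such that for $a\in\mathfrak{h}[t]$, $$Y_W(a,z)=a_W(z)=\sum_{n\in\mathbb{Z}}a(n)z^{-n-1}\in(\mathrm{End}\,W)[[z,z^{-1}]].$$ The vertex operator map for this module structure is given by $$Y_W(a_1(-n_1)\cdots a_k(-n_k)\mathbf{1},z)=\ :\tfrac{1}{(n_1-1)!}\big(\tfrac{d}{dz}\big)^{n_1-1}(a_1)_W(z)\cdots\tfrac{1}{(n_k-1)!}\big(\tfrac{d}{dz}\big)^{n_k-1}(a_k)_W(z):\,1_W$$ for $k\geq 0$, $a_i\in\mathfrak{h}[t]$, $n_i\in\mathbb{Z}_+$. In particular, if $l\neq 0$, then for $\lambda\in\mathfrak{h}^*$ and $|c|<1$ the modules $W=W(\lambda,c,l)$ are irreducible modules for the quasi-conformal vertex algebra $M(l)$, and the operators $$L(n)_W=\frac{1}{2l}\sum_{i=1}^d\sum_{j\in\mathbb{N}}\sum_{m\in\mathbb{Z}}:(u^{(i)}t^j)(n-m)\,(u^{(i)}t^j)(m):,\qquad n\geq -1,$$ on $W(\lambda,c,l)$ are well-defined and satisfy, for $A\in M(l)$ and $m,n\geq -1$, $$[L(m)_W,L(n)_W]=(m-n)L(m+n)_W,$$ $$[L(n)_W,Y_W(A,w)]=\sum_{i=-1}^n\binom{n+1}{i+1}w^{n-i}Y_W(L(i)A,w).$$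
   Context: $\mathbb{N}=\{0,1,2,\dots\}$, $\mathbb{Z}_+=\{1,2,\dots\}$. $\mathfrak{h}$ is a finite-dimensional abelian Lie algebra over $\mathbb{C}$ with a nondegenerate symmetric bilinear form $\langle\cdot,\cdot\rangle$, by which $\mathfrak{h}\cong\mathfrak{h}^*$, and an orthonormal basis $u^{(1)},\dots,u^{(d)}$. $\mathfrak{h}[t]=\mathfrak{h}\otimes\mathbb{C}[t]$ is the (abelian) current algebra; $xf$ means $x\otimes f$. The affinization is $\widehat{\mathfrak{h}[t]}=\mathfrak{h}[t]\otimes\mathbb{C}[s,s^{-1}]\oplus\mathbb{C}\mathbf{k}$ with $\mathbf{k}$ central and $[xt^i\otimes s^m,yt^j\otimes s^n]=m\langle x,y\rangle\delta_{m+n,0}\delta_{i,j}\mathbf{k}$. $a(n)$ denotes the action of $a\otimes s^n$. $M(l)=U(\widehat{\mathfrak{h}[t]})\otimes_{U(\mathfrak{h}[t]\otimes\mathbb{C}[s]\oplus\mathbb{C}\mathbf{k})}\mathbb{C}\mathbf{1}$ is the induced module where $\mathfrak{h}[t]\otimes\mathbb{C}[s]$ annihilates $\mathbf{1}$ and $\mathbf{k}$ acts as $l$; $a\in\mathfrak{h}[t]$ is identified with $a(-1)\mathbf{1}$. Normal ordering $:\ :$ places operators $a(n)$ with $n\geq 0$ to the right of those with $n<0$. $M(l)$ is a vertex algebra with vacuum $\mathbf{1}$ and, with $a(z)=\sum_n a(n)z^{-n-1}$, $Y(a_1(-n_1)\cdots a_k(-n_k)\mathbf{1},z)=\ :\frac{1}{(n_1-1)!}(\frac{d}{dz})^{n_1-1}a_1(z)\cdots\frac{1}{(n_k-1)!}(\frac{d}{dz})^{n_k-1}a_k(z):$.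 For $l\ne0$ it is quasi-conformal with the operators $L(n)$ ($n\geq -1$) given on $M(l)$ by the same formula as $L(n)_W$ in the claim. A $\widehat{\mathfrak{h}[t]}$-module $W$ is restricted $\mathbb{Z}$-graded of level $l$ if: (i) $W=\coprod_{n\in\mathbb{Z}}W_n$ with $a(n)W_m\subset W_{m-n}$ for all $m,n\in\mathbb{Z}$, $a\in\mathfrak{h}[t]$; (ii) $\mathbf{k}$ acts as $l$; (iii) for every $w\in W$ and $n\in\mathbb{Z}_+$, $(xt^i)(n)w=0$ for all but finitely many $i\in\mathbb{N}$; (iv) there exists $N\in\mathbb{N}$ such that $W_n=0$ for $n<N$. For $\lambda\in\mathfrak{h}^*$, $c\in\mathbb{C}$, $V(\lambda,c)$ is the one-dimensional $\mathfrak{h}[t]$-module with $(hf)\cdot v=f(c)\lambda(h)v$ for $h\in\mathfrak{h}$, $f\in\mathbb{C}[t]$. $W(\lambda,c,l)=M(l)\otimes V(\lambda,c)$ is the $\widehat{\mathfrak{h}[t]}$-module induced from $V(\lambda,c)$: $a(n)$ for $n\neq 0$ acts on the factor $M(l)$, $a(0)$ acts through $V(\lambda,c)$, and $\mathbf{k}$ acts as $l$. Infinite sums over $j$ of scalars (arising from products of zero modes) are understood as convergent series in $\mathbb{C}$.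
   Formalization: For λ, c ≠ 0, L(−1)_W applied to the generating vector is an infinite sum of independent vectors, so L(n)_W takes values in formal infinite combinations of PBW monomials and products are taken coefficientwise; values lie in W when n ≥ 0, c = 0 or λ = 0. *)

theory Defs
  imports
    "HOL-Analysis.Analysis"
    "HOL-Library.Poly_Mapping"
    "HOL-Computational_Algebra.Polynomial"
begin

section \<open>The Lie algebra and its affinization\<close>

locale form_with_orthonormal_basis = vector_space scale
  for scale :: "complex \<Rightarrow> 'h::ab_group_add \<Rightarrow> 'h" +
  fixes form :: "'h \<Rightarrow> 'h \<Rightarrow> complex" and d :: nat and u :: "nat \<Rightarrow> 'h"
  assumes form_linear: "Vector_Spaces.linear scale (*) (\<lambda>x. form x y)"
    and form_sym: "form x y = form y x"
    and form_nondegenerate: "(\<And>y. form x y = 0) \<Longrightarrow> x = 0"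
    and u_inj: "inj_on u {1..d}"
    and u_independent: "independent (u ` {1..d})"
    and u_span: "span (u ` {1..d}) = UNIV"
    and u_orthonormal: "i \<in> {1..d} \<Longrightarrow> j \<in> {1..d} \<Longrightarrow> form (u i) (u j) = (if i = j then 1 else 0)"

text \<open>
  The current algebra \<open>\<hh>[t]\<close> is the type \<open>'h poly\<close>, with \<open>x t\<^sup>i = monom x i\<close>. Its
  affinization is \<open>\<hh>[t][s, s\<inverse>] \<oplus> \<complex>k\<close>: the first component of a pair is a Laurent polynomial
  in \<open>s\<close> (as a finitely supported function of the exponent), the second is the coefficient of \<open>k\<close>.
\<close>

type_synonym 'h affine = "(int \<Rightarrow>\<^sub>0 'h poly) \<times> complex"

definition affine_scale ::
    "(complex \<Rightarrow> 'h::ab_group_add \<Rightarrow> 'h) \<Rightarrow> complex \<Rightarrow> 'h affine \<Rightarrow> 'h affine" where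
  "affine_scale scaleH c x = (Poly_Mapping.map (map_poly (scaleH c)) (fst x), c * snd x)"

definition current_form :: "('h::zero \<Rightarrow> 'h \<Rightarrow> complex) \<Rightarrow> 'h poly \<Rightarrow> 'h poly \<Rightarrow> complex" where
  "current_form form a b = (\<Sum>i\<le>degree a. form (coeff a i) (coeff b i))"

definition affine_bracket ::
    "('h::ab_group_add \<Rightarrow> 'h \<Rightarrow> complex) \<Rightarrow> 'h affine \<Rightarrow> 'h affine \<Rightarrow> 'h affine" where
  "affine_bracket form x y =
     (0, \<Sum>m\<in>Poly_Mapping.keys (fst x).
           of_int m * current_form form (Poly_Mapping.lookup (fst x) m) (Poly_Mapping.lookup (fst y) (- m)))"

definition lie_module ::
    "(complex \<Rightarrow> 'g::ab_group_add \<Rightarrow> 'g) \<Rightarrow> ('g \<Rightarrow> 'g \<Rightarrow> 'g) \<Rightarrow>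
     (complex \<Rightarrow> 'w::ab_group_add \<Rightarrow> 'w) \<Rightarrow> ('g \<Rightarrow> 'w \<Rightarrow> 'w) \<Rightarrow> bool" where
  "lie_module scaleG br scaleW rho \<longleftrightarrow>
     (\<forall>x. Vector_Spaces.linear scaleW scaleW (rho x)) \<and>
     (\<forall>w. Vector_Spaces.linear scaleG scaleW (\<lambda>x. rho x w)) \<and>
     (\<forall>x y w. rho (br x y) w = rho x (rho y w) - rho y (rho x w))"

definition mode :: "('h::ab_group_add affine \<Rightarrow> 'w \<Rightarrow> 'w) \<Rightarrow> 'h poly \<Rightarrow> int \<Rightarrow> 'w \<Rightarrow> 'w" where
  "mode rho a n = rho (Poly_Mapping.single n a, 0)"


section \<open>Induced modules\<close>

text \<open>
  Let \<open>P\<close> be a Lie subalgebra of \<open>\<gg>\<close> and \<open>\<chi>\<close> a character of \<open>P\<close>. Formal linear combinations of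
  words over \<open>\<gg>\<close> form the free associative algebra on the set \<open>\<gg>\<close>. Dividing it by the two-sided
  ideal spanned by \<open>enveloping_relations\<close> gives \<open>U(\<gg>)\<close>; dividing further by the left ideal
  generated by the \<open>p - \<chi>(p)\<close> gives \<open>U(\<gg>) \<otimes>\<^bsub>U(P)\<^esub> \<complex>\<^sub>\<chi>\<close>. The relation \<open>induced_module\<close>
  says that \<open>X \<otimes> 1 \<mapsto> X v\<close> is an isomorphism from this space onto the \<open>\<gg>\<close>-module \<open>M\<close>.
\<close>

definition enveloping_relations ::
    "(complex \<Rightarrow> 'g::ab_group_add \<Rightarrow> 'g) \<Rightarrow> ('g \<Rightarrow> 'g \<Rightarrow> 'g) \<Rightarrow> ('g list \<Rightarrow>\<^sub>0 complex) set" where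
  "enveloping_relations scaleG br =
     {Poly_Mapping.single (p @ [x + y] @ q) 1 - Poly_Mapping.single (p @ [x] @ q) 1
        - Poly_Mapping.single (p @ [y] @ q) 1 | p q x y. True} \<union>
     {Poly_Mapping.single (p @ [scaleG c x] @ q) 1 - Poly_Mapping.single (p @ [x] @ q) c
        | p q c x. True} \<union>
     {Poly_Mapping.single (p @ [x, y] @ q) 1 - Poly_Mapping.single (p @ [y, x] @ q) 1
        - Poly_Mapping.single (p @ [br x y] @ q) 1 | p q x y. True}"

definition character_relations ::
    "'g set \<Rightarrow> ('g \<Rightarrow> complex) \<Rightarrow> ('g list \<Rightarrow>\<^sub>0 complex) set" where
  "character_relations P chi =
     {Poly_Mapping.single (p @ [x]) 1 - Poly_Mapping.single p (chi x) | p x. x \<in> P}"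

definition word_action ::
    "(complex \<Rightarrow> 'm \<Rightarrow> 'm) \<Rightarrow> ('g \<Rightarrow> 'm \<Rightarrow> 'm) \<Rightarrow> ('g list \<Rightarrow>\<^sub>0 complex) \<Rightarrow> 'm \<Rightarrow> 'm::ab_group_add" where
  "word_action scaleM rho X v = (\<Sum>p\<in>Poly_Mapping.keys X. scaleM (Poly_Mapping.lookup X p) (foldr rho p v))"

definition induced_module ::
    "(complex \<Rightarrow> 'g::ab_group_add \<Rightarrow> 'g) \<Rightarrow> ('g \<Rightarrow> 'g \<Rightarrow> 'g) \<Rightarrow> 'g set \<Rightarrow> ('g \<Rightarrow> complex) \<Rightarrow>
     (complex \<Rightarrow> 'm::ab_group_add \<Rightarrow> 'm) \<Rightarrow> ('g \<Rightarrow> 'm \<Rightarrow> 'm) \<Rightarrow> 'm \<Rightarrow> bool" where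
  "induced_module scaleG br P chi scaleM rho v \<longleftrightarrow>
     lie_module scaleG br scaleM rho \<and>
     (\<forall>m. \<exists>X. m = word_action scaleM rho X v) \<and>
     (\<forall>X. word_action scaleM rho X v = 0 \<longleftrightarrow>
        X \<in> module.span (\<lambda>c. Poly_Mapping.map ((*) c))
              (enveloping_relations scaleG br \<union> character_relations P chi))"

text \<open>\<open>M(l)\<close> with its generating vector \<open>vac\<close>; the module is determined up to unique isomorphism.\<close>

definition vacuum_module ::
    "(complex \<Rightarrow> 'h::ab_group_add \<Rightarrow> 'h) \<Rightarrow> ('h \<Rightarrow> 'h \<Rightarrow> complex) \<Rightarrow> complex \<Rightarrow>
     (complex \<Rightarrow> 'm::ab_group_add \<Rightarrow> 'm) \<Rightarrow> ('h affine \<Rightarrow> 'm \<Rightarrow> 'm) \<Rightarrow> 'm \<Rightarrow> bool" where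
  "vacuum_module scaleH form l =
     induced_module (affine_scale scaleH) (affine_bracket form)
       {x. \<forall>m<0. Poly_Mapping.lookup (fst x) m = 0} (\<lambda>x. l * snd x)"

definition restricted_graded_module ::
    "(complex \<Rightarrow> 'h::ab_group_add \<Rightarrow> 'h) \<Rightarrow> ('h \<Rightarrow> 'h \<Rightarrow> complex) \<Rightarrow> complex \<Rightarrow>
     (complex \<Rightarrow> 'w::ab_group_add \<Rightarrow> 'w) \<Rightarrow> ('h affine \<Rightarrow> 'w \<Rightarrow> 'w) \<Rightarrow> (int \<Rightarrow> 'w set) \<Rightarrow> bool" where
  "restricted_graded_module scaleH form l scaleW rho W \<longleftrightarrow>
     lie_module (affine_scale scaleH) (affine_bracket form) scaleW rho \<and>
     (\<forall>n. module.subspace scaleW (W n)) \<and>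
     (\<forall>w. \<exists>!f. (\<forall>n. f n \<in> W n) \<and> finite {n. f n \<noteq> 0} \<and> w = Sum_any f) \<and>
     (\<forall>a m n. \<forall>w\<in>W m. mode rho a n w \<in> W (m - n)) \<and>
     (\<forall>w. rho (0, 1) w = scaleW l w) \<and>
     (\<forall>w. \<forall>n\<ge>1. \<forall>x. finite {i. mode rho (monom x i) n w \<noteq> 0}) \<and>
     (\<exists>N::nat. \<forall>n<int N. W n = {0})"


section \<open>Vertex algebras and their modules\<close>

text \<open>
  \<open>Y v n\<close> is the coefficient of \<open>z\<^bsup>-n-1\<^esup>\<close> in \<open>Y(v, z)\<close>. The Jacobi identity is stated through its
  coefficients. All its sums are finite by the truncation condition.
\<close>

definition jacobi_identity ::
    "(complex \<Rightarrow> 'w::ab_group_add \<Rightarrow> 'w) \<Rightarrow> ('v \<Rightarrow> int \<Rightarrow> 'v \<Rightarrow> 'v) \<Rightarrow> ('v \<Rightarrow> int \<Rightarrow> 'w \<Rightarrow> 'w) \<Rightarrow> bool" where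
  "jacobi_identity scaleW Y YW \<longleftrightarrow>
     (\<forall>a b w p q r.
        Sum_any (\<lambda>i::nat. scaleW ((- 1) ^ i * (of_int r gchoose i))
          (YW a (p + r - int i) (YW b (q + int i) w)
            - scaleW ((- 1) powi r) (YW b (q + r - int i) (YW a (p + int i) w))))
      = Sum_any (\<lambda>i::nat. scaleW (of_int p gchoose i) (YW (Y a (r + int i) b) (p + q - int i) w)))"

locale vertex_algebra = vector_space scaleV
  for scaleV :: "complex \<Rightarrow> 'v::ab_group_add \<Rightarrow> 'v" +
  fixes Y :: "'v \<Rightarrow> int \<Rightarrow> 'v \<Rightarrow> 'v" and vac :: 'v
  assumes Y_linear_left: "Vector_Spaces.linear scaleV scaleV (\<lambda>a. Y a n b)"
    and Y_linear_right: "Vector_Spaces.linear scaleV scaleV (Y a n)"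
    and truncation: "\<exists>N. \<forall>n\<ge>N. Y a n b = 0"
    and vacuum: "Y vac n b = (if n = - 1 then b else 0)"
    and creation: "n \<ge> 0 \<Longrightarrow> Y a n vac = 0" "Y a (- 1) vac = a"
    and jacobi: "jacobi_identity scaleV Y Y"

locale vertex_algebra_module = vertex_algebra scaleV Y vac + W: vector_space scaleW
  for scaleV :: "complex \<Rightarrow> 'v::ab_group_add \<Rightarrow> 'v" and Y vac
    and scaleW :: "complex \<Rightarrow> 'w::ab_group_add \<Rightarrow> 'w" +
  fixes YW :: "'v \<Rightarrow> int \<Rightarrow> 'w \<Rightarrow> 'w"
  assumes YW_linear_left: "Vector_Spaces.linear scaleV scaleW (\<lambda>a. YW a n w)"
    and YW_linear_right: "Vector_Spaces.linear scaleW scaleW (YW a n)"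
    and YW_truncation: "\<exists>N. \<forall>n\<ge>N. YW a n w = 0"
    and YW_vacuum: "YW vac n w = (if n = - 1 then w else 0)"
    and YW_jacobi: "jacobi_identity scaleW Y YW"

definition irreducible_module ::
    "(complex \<Rightarrow> 'w::ab_group_add \<Rightarrow> 'w) \<Rightarrow> ('v \<Rightarrow> int \<Rightarrow> 'w \<Rightarrow> 'w) \<Rightarrow> bool" where
  "irreducible_module scaleW YW \<longleftrightarrow>
     (UNIV :: 'w set) \<noteq> {0} \<and>
     (\<forall>S. module.subspace scaleW S \<and> (\<forall>a n. \<forall>w\<in>S. YW a n w \<in> S) \<longrightarrow> S = {0} \<or> S = UNIV)"


section \<open>Normally ordered products of fields\<close>

definition normal_ordered :: "('a \<Rightarrow> int \<Rightarrow> 'w \<Rightarrow> 'w) \<Rightarrow> ('a \<times> int) list \<Rightarrow> 'w \<Rightarrow> 'w" where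
  "normal_ordered act xs =
     foldr (\<lambda>(a, m). act a m) (filter (\<lambda>(a, m). m < 0) xs @ filter (\<lambda>(a, m). m \<ge> 0) xs)"

text \<open>
  For \<open>xs = [(a\<^sub>1, n\<^sub>1), \<dots>, (a\<^sub>k, n\<^sub>k)]\<close>, the coefficient of \<open>z\<^bsup>-n-1\<^esup>\<close> in the normally ordered
  product of the fields \<open>1/(n\<^sub>i - 1)! (d/dz)\<^bsup>n\<^sub>i - 1\<^esup> a\<^sub>i(z) = \<Sum>\<^sub>m (-m-1 choose n\<^sub>i - 1) a\<^sub>i(m) z\<^bsup>-m-n\<^sub>i\<^esup>\<close>,
  applied to \<open>w\<close>. The list \<open>ms\<close> runs through the modes chosen from the \<open>k\<close> factors; on a vector of a
  restricted graded module only finitely many of the summands are nonzero.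
\<close>

definition field_product ::
    "(complex \<Rightarrow> 'w::ab_group_add \<Rightarrow> 'w) \<Rightarrow> ('a \<Rightarrow> int \<Rightarrow> 'w \<Rightarrow> 'w) \<Rightarrow> ('a \<times> nat) list \<Rightarrow> int \<Rightarrow> 'w \<Rightarrow> 'w" where
  "field_product scaleW act xs n w =
     Sum_any (\<lambda>ms::int list.
       if length ms = length xs \<and> sum_list ms + int (sum_list (map snd xs)) = n + 1
       then scaleW (prod_list (map2 (\<lambda>(a, r) m. of_int (- m - 1) gchoose (r - 1)) xs ms))
              (normal_ordered act (zip (map fst xs) ms) w)
       else 0)"

definition has_field_product_formula ::
    "('h::ab_group_add affine \<Rightarrow> 'm \<Rightarrow> 'm) \<Rightarrow> 'm \<Rightarrow>
     (complex \<Rightarrow> 'w::ab_group_add \<Rightarrow> 'w) \<Rightarrow> ('h affine \<Rightarrow> 'w \<Rightarrow> 'w) \<Rightarrow> ('m \<Rightarrow> int \<Rightarrow> 'w \<Rightarrow> 'w) \<Rightarrow> bool" where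
  "has_field_product_formula rhoM vac scaleW rhoW YW \<longleftrightarrow>
     (\<forall>xs n w. (\<forall>(a, r)\<in>set xs. r \<ge> 1) \<longrightarrow>
        YW (foldr (\<lambda>(a, r). mode rhoM a (- int r)) xs vac) n w =
        field_product scaleW (mode rhoW) xs n w)"

text \<open>The vectors \<open>a\<^sub>1(-n\<^sub>1)\<cdots>a\<^sub>k(-n\<^sub>k)1\<close> span \<open>M(l)\<close>, so the following map is unique.\<close>

definition vacuum_module_Y ::
    "(complex \<Rightarrow> 'm::ab_group_add \<Rightarrow> 'm) \<Rightarrow> ('h::ab_group_add affine \<Rightarrow> 'm \<Rightarrow> 'm) \<Rightarrow> 'm \<Rightarrow>
     'm \<Rightarrow> int \<Rightarrow> 'm \<Rightarrow> 'm" where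
  "vacuum_module_Y scaleM rhoM vac =
     (THE Y. (\<forall>n b. Vector_Spaces.linear scaleM scaleM (\<lambda>a. Y a n b)) \<and>
        has_field_product_formula rhoM vac scaleM rhoM Y)"

text \<open>The \<open>M(l)\<close>-module structures \<open>Y\<^sub>W\<close> with \<open>Y\<^sub>W(a, z) = a\<^sub>W(z)\<close> for \<open>a = a(-1)1\<close> in \<open>\<hh>[t]\<close>.\<close>

definition vacuum_module_structure ::
    "(complex \<Rightarrow> 'm::ab_group_add \<Rightarrow> 'm) \<Rightarrow> ('h::ab_group_add affine \<Rightarrow> 'm \<Rightarrow> 'm) \<Rightarrow> 'm \<Rightarrow>
     (complex \<Rightarrow> 'w::ab_group_add \<Rightarrow> 'w) \<Rightarrow> ('h affine \<Rightarrow> 'w \<Rightarrow> 'w) \<Rightarrow> ('m \<Rightarrow> int \<Rightarrow> 'w \<Rightarrow> 'w) \<Rightarrow> bool" where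
  "vacuum_module_structure scaleM rhoM vac scaleW rhoW YW \<longleftrightarrow>
     vertex_algebra_module scaleM (vacuum_module_Y scaleM rhoM vac) vac scaleW YW \<and>
     (\<forall>a n. YW (mode rhoM a (- 1) vac) n = mode rhoW a n)"


section \<open>The modules \<open>W(\<lambda>, c, l)\<close> and the operators \<open>L(n)\<close>\<close>

text \<open>
  As \<open>V(\<lambda>, c)\<close> is one-dimensional, \<open>M(l) \<otimes> V(\<lambda>, c)\<close> is identified with \<open>M(l)\<close> as a vector space.
  An element \<open>a = \<Sum>\<^sub>j x\<^sub>j t\<^sup>j\<close> of \<open>\<hh>[t]\<close> acts on \<open>V(\<lambda>, c)\<close> by \<open>\<Sum>\<^sub>j \<lambda>(x\<^sub>j) c\<^sup>j\<close>.
\<close>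

definition evaluation_character ::
    "('h::zero \<Rightarrow> complex) \<Rightarrow> complex \<Rightarrow> 'h poly \<Rightarrow> complex" where
  "evaluation_character lam c a = poly (map_poly lam a) c"

definition twisted_action ::
    "(complex \<Rightarrow> 'm::ab_group_add \<Rightarrow> 'm) \<Rightarrow> ('h::ab_group_add affine \<Rightarrow> 'm \<Rightarrow> 'm) \<Rightarrow>
     ('h \<Rightarrow> complex) \<Rightarrow> complex \<Rightarrow> 'h affine \<Rightarrow> 'm \<Rightarrow> 'm" where
  "twisted_action scaleM rhoM lam c x w =
     rhoM (fst x - Poly_Mapping.single 0 (Poly_Mapping.lookup (fst x) 0), snd x) w
     + scaleM (evaluation_character lam c (Poly_Mapping.lookup (fst x) 0)) w"

text \<open>
  For \<open>c \<noteq> 0\<close> and \<open>\<lambda> \<noteq> 0\<close> the sum over \<open>j\<close> in \<open>L(-1)\<^sub>W w\<close> contains the terms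
  \<open>1/l \<lambda>(u\<^sup>(\<^sup>i\<^sup>)) c\<^sup>j (u\<^sup>(\<^sup>i\<^sup>)t\<^sup>j)(-1) w\<close> for all \<open>j\<close>: these are linearly independent when \<open>w = 1\<close>, and only
  the coefficients of the sum make sense. So sums over \<open>j\<close> are taken coefficientwise with respect to
  the PBW basis of \<open>M(l)\<close> given by the monomials in the \<open>(u\<^sup>(\<^sup>i\<^sup>)t\<^sup>j)(-n)\<close>, \<open>n \<ge> 1\<close>, and \<open>L(n)\<^sub>W\<close> takes
  its values in the completion consisting of all infinite formal combinations of basis vectors. Such a
  combination is a function on basis vectors; a vector \<open>w\<close> is identified with \<open>pbw_coord \<dots> w\<close>.
\<close>

definition pbw_basis ::
    "nat \<Rightarrow> (nat \<Rightarrow> 'h::ab_group_add) \<Rightarrow> ('h affine \<Rightarrow> 'm \<Rightarrow> 'm) \<Rightarrow> 'm \<Rightarrow> 'm set" where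
  "pbw_basis d u rhoM vac =
     {foldr (\<lambda>(i, j, n). mode rhoM (monom (u i) j) (- int n)) xs vac
        | xs. \<forall>(i, j, n)\<in>set xs. i \<in> {1..d} \<and> n \<ge> 1}"

definition pbw_coord ::
    "nat \<Rightarrow> (nat \<Rightarrow> 'h::ab_group_add) \<Rightarrow> (complex \<Rightarrow> 'm::ab_group_add \<Rightarrow> 'm) \<Rightarrow> ('h affine \<Rightarrow> 'm \<Rightarrow> 'm) \<Rightarrow>
     'm \<Rightarrow> 'm \<Rightarrow> 'm \<Rightarrow> complex" where
  "pbw_coord d u scaleM rhoM vac = module.representation scaleM (pbw_basis d u rhoM vac)"

text \<open>\<open>\<Sum>\<^sub>m :a(n - m) a(m):\<close>, a finite sum on every vector\<close>

definition quadratic_mode :: "('a \<Rightarrow> int \<Rightarrow> 'w \<Rightarrow> 'w) \<Rightarrow> 'a \<Rightarrow> int \<Rightarrow> 'w \<Rightarrow> 'w::ab_group_add" where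
  "quadratic_mode act a n w = Sum_any (\<lambda>m::int. normal_ordered act [(a, n - m), (a, m)] w)"

definition L_formal ::
    "nat \<Rightarrow> (nat \<Rightarrow> 'h::ab_group_add) \<Rightarrow> complex \<Rightarrow> ('m::ab_group_add \<Rightarrow> 'm \<Rightarrow> complex) \<Rightarrow>
     ('h affine \<Rightarrow> 'm \<Rightarrow> 'm) \<Rightarrow> int \<Rightarrow> 'm \<Rightarrow> 'm \<Rightarrow> complex" where
  "L_formal d u l coord rho n w b =
     1 / (2 * l) * (\<Sum>i=1..d. suminf (\<lambda>j. coord (quadratic_mode (mode rho) (monom (u i) j) n w) b))"

definition L_vector ::
    "nat \<Rightarrow> (nat \<Rightarrow> 'h::ab_group_add) \<Rightarrow> complex \<Rightarrow> ('m::ab_group_add \<Rightarrow> 'm \<Rightarrow> complex) \<Rightarrow>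
     ('h affine \<Rightarrow> 'm \<Rightarrow> 'm) \<Rightarrow> int \<Rightarrow> 'm \<Rightarrow> 'm" where
  "L_vector d u l coord rho n w = (THE v. coord v = L_formal d u l coord rho n w)"

definition L_converges ::
    "nat \<Rightarrow> (nat \<Rightarrow> 'h::ab_group_add) \<Rightarrow> 'm set \<Rightarrow> ('m::ab_group_add \<Rightarrow> 'm \<Rightarrow> complex) \<Rightarrow>
     ('h affine \<Rightarrow> 'm \<Rightarrow> 'm) \<Rightarrow> int \<Rightarrow> 'm \<Rightarrow> bool" where
  "L_converges d u B coord rho n w \<longleftrightarrow>
     (\<forall>i\<in>{1..d}.
        (\<forall>j. finite {m. normal_ordered (mode rho) [(monom (u i) j, n - m), (monom (u i) j, m)] w \<noteq> 0}) \<and>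
        (\<forall>b\<in>B. summable (\<lambda>j. coord (quadratic_mode (mode rho) (monom (u i) j) n w) b)))"

text \<open>
  The extension of an operator \<open>T\<close> to formal combinations \<open>x = \<Sum>\<^sub>b x\<^sub>b b\<close> by \<open>T x = \<Sum>\<^sub>b x\<^sub>b T(b)\<close>,
  defined where the coefficients of the right-hand side converge absolutely.
\<close>

definition extension_defined :: "'m set \<Rightarrow> ('m \<Rightarrow> 'm \<Rightarrow> complex) \<Rightarrow> ('m \<Rightarrow> complex) \<Rightarrow> bool" where
  "extension_defined B T x \<longleftrightarrow> (\<forall>b\<in>B. (\<lambda>b'. x b' * T b' b) summable_on B)"

definition extend_operator ::
    "'m set \<Rightarrow> ('m \<Rightarrow> 'm \<Rightarrow> complex) \<Rightarrow> ('m \<Rightarrow> complex) \<Rightarrow> 'm \<Rightarrow> complex" where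
  "extend_operator B T x b = infsum (\<lambda>b'. x b' * T b' b) B"

end

(* Let the fields on a smooth module W of level l be acted on by h t^j s^n through the n-th product with
   the field h(z). These operators satisfy the relations of the affinization, uniformly in all integer
   modes, and kill the identity field when n >= 0. So the presentation of the induced module M(l) gives
   a linear map Y_W from M(l) to fields. The Jacobi identity for (a, b) follows by induction on a: both
   sides for (h(n)a, b) are the same combination of the corresponding sides for (a, b) and (a, h(e)b).

   The Fock space of formal power series in the creation operators is another target for the universal
   property, whence the PBW basis. For the Virasoro operators, let omega_J be the conformal vector
   truncated to powers of t below J. This is an element of M(l), so the Jacobi identity yields all
   commutators of its modes, and the central term does not occur among L(n) with n >= -1. Every
   coefficient with respect to the PBW basis then converges as J tends to infinity: only the zero
   modes contribute infinitely many terms, and these are geometric series in c. *)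

theory Submission
  imports Defs "HOL-Library.Function_Algebras"
begin

section \<open>Binomial identities\<close>

text \<open>The n-th product by a current needs only the truncation of its second factor, so all
  fields on \<open>W\<close>, local or not, satisfy the relations of the affinization. Hence
  \<open>Y_W\<close> exists before any locality is known; the commutator formula is derived for its
  values afterwards and enters the Jacobi identity only where \<open>h\<close> is moved past
  \<open>b\<close>.

  In the Virasoro part the obstacle is that \<open>L(-1)_W w\<close> is in general an infinite
  combination of PBW vectors, so that products such as \<open>L(m)_W L(n)_W\<close> exist only
  through \<open>extend_operator\<close>. The truncated operators obey the wanted relations exactly.
  What has to be proved is that a coefficient of the extended product is the limit along the
  diagonal, where both factors carry the same \<open>J\<close>: absolute summability over the PBW
  basis gives the limit in the inner factor, and the error of truncating the outer factor tends to 0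
  in each coefficient. The central charge of the truncation is \<open>d J\<close>, which grows with
  \<open>J\<close>; only among modes where it cannot be seen is there a limit of the
  relations.\<close>

lemma gbinomial_signed_upper:
  fixes x :: complex
  shows "(- 1) ^ k * (x gchoose k) = (of_nat k - x - 1) gchoose k"
  by (subst gbinomial_negated_upper) (simp flip: mult.assoc power_add)

text \<open>With \<open>P = p + 1\<close> and \<open>Q = q + 1\<close> both sides are the binomial
  coefficient of \<open>p + q\<close> over \<open>p\<close>. This is the case of
  \<open>gbinomial_delta\<close> in which both exponents are negative.\<close>

lemma gbinomial_signed_symmetric:
  assumes "P \<ge> 1" "Q \<ge> 1"
  shows "(- 1) ^ (P - 1) * ((- of_nat Q :: complex) gchoose (P - 1))
       = (- 1) ^ (Q - 1) * ((- of_nat P) gchoose (Q - 1))"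
proof -
  obtain p q where [simp]: "P = Suc p" "Q = Suc q"
    using assms by (metis Suc_le_D One_nat_def)
  have "(of_nat (p + q) :: complex) gchoose p = of_nat (p + q) gchoose q"
    using gbinomial_of_nat_symmetric[of p "p + q"] by simp
  then show ?thesis
    by (simp add: gbinomial_signed_upper algebra_simps)
qed

text \<open>The expansions of \<open>(x - y)\<^sup>n\<close> for \<open>|x| > |y|\<close> and \<open>|y| > |x|\<close> differ by a derivative of the
  delta function.\<close>

lemma gbinomial_delta:
  fixes p r :: int
  shows "(if p + r + 1 \<ge> 0 then (- 1) ^ nat (p + r + 1) * (of_int r gchoose nat (p + r + 1)) else 0)
       - (if p \<le> - 1 then (- 1) powi r * (- 1) ^ nat (- 1 - p) * (of_int r gchoose nat (- 1 - p)) else 0)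
       = (if r \<le> - 1 then (of_int p gchoose nat (- 1 - r) :: complex) else 0)"
proof (cases "r \<ge> 0")
  case True
  \<comment> \<open>For \<open>r >= 0\<close> both expansions are the binomial formula for the same
    polynomial, so the difference must be 0: the two terms vanish separately or agree by the
    symmetry of binomial coefficients.\<close>
  then obtain R where R: "r = int R" using nonneg_int_cases by blast
  show ?thesis
  proof (cases "p \<ge> 0")
    case True
    then have "R < nat (p + r + 1)" using R by linarith
    then have "(of_int r gchoose nat (p + r + 1) :: complex) = 0"
      by (simp add: R flip: binomial_gbinomial)
    then show ?thesis using True R by simp
  next
    case False
    define P where "P = nat (- p)"
    have P: "p = - int P" "P \<ge> 1" using False by (auto simp: P_def)
    show ?thesis
    proof (cases "R + 1 \<ge> P")
      case True
      have e: "nat (p + r + 1) = R + 1 - P" "nat (- 1 - p) = P - 1" using P R True by auto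
      have "(of_nat R gchoose (R + 1 - P) :: complex) = of_nat R gchoose (P - 1)"
        using gbinomial_of_nat_symmetric[of "R + 1 - P" R, where 'a = complex] True P by simp
      moreover have "(- 1 :: complex) ^ (R + 1 - P) = (- 1) ^ R * (- 1) ^ (P - 1)"
      proof -
        have "(- 1 :: complex) ^ R * (- 1) ^ (P - 1) = (- 1) ^ (R + 1 - P + (P - 1) + (P - 1))"
          using True P by (simp flip: power_add)
        then show ?thesis by (simp add: power_add flip: mult_2 power_mult_distrib)
      qed
      ultimately show ?thesis using e True P R by (simp add: power_int_def)
    next
      case F: False
      then have "R < nat (- 1 - p)" using P by linarith
      then have "(of_int r gchoose nat (- 1 - p) :: complex) = 0"
        by (simp add: R flip: binomial_gbinomial)
      then show ?thesis using F P R by simp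
    qed
  qed
next
  case False
  \<comment> \<open>For \<open>r < 0\<close> at most one of the two expansions contributes,
    according to the sign of \<open>p\<close>, and it alone is matched with the right-hand
    side.\<close>
  define R where "R = nat (- r)"
  have R: "r = - int R" "R \<ge> 1" using False by (auto simp: R_def)
  show ?thesis
  proof (cases "p \<ge> 0")
    case True
    then obtain P where P: "p = int P" using nonneg_int_cases by blast
    show ?thesis
    proof (cases "P + 1 \<ge> R")
      case True
      have e: "nat (p + r + 1) = P + 1 - R" "nat (- 1 - r) = R - 1" using P R True by auto
      have "(- 1) ^ (P + 1 - R) * ((- of_nat R :: complex) gchoose (P + 1 - R)) = of_nat P gchoose (P + 1 - R)"
        using True by (simp add: gbinomial_signed_upper algebra_simps of_nat_diff)
      also have "\<dots> = of_nat P gchoose (R - 1)"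
        using gbinomial_of_nat_symmetric[of "P + 1 - R" P, where 'a = complex] True R by simp
      finally show ?thesis using e True P R by simp
    next
      case F: False
      then have "P < nat (- 1 - r)" using R by linarith
      then have "(of_int p gchoose nat (- 1 - r) :: complex) = 0"
        by (simp add: P flip: binomial_gbinomial)
      then show ?thesis using F P R by simp
    qed
  next
    case False
    define P where "P = nat (- p)"
    have P: "p = - int P" "P \<ge> 1" using False by (auto simp: P_def)
    have e: "nat (- 1 - p) = P - 1" "nat (- 1 - r) = R - 1" using P R by auto
    have s: "(- 1 :: complex) powi r = (- 1) ^ R"
      using R by (simp add: power_int_minus flip: power_inverse)
    have "- ((- 1) ^ R * ((- 1) ^ (P - 1) * ((- of_nat R :: complex) gchoose (P - 1))))
      = - ((- 1) ^ R * ((- 1) ^ (R - 1) * ((- of_nat P) gchoose (R - 1))))"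
      using gbinomial_signed_symmetric[OF P(2) R(2)] by simp
    also have "\<dots> = (- of_nat P) gchoose (R - 1)"
      using R(2) by (cases R) (simp_all flip: mult.assoc power_add)
    finally show ?thesis using e P R s by (simp add: mult.assoc)
  qed
qed

text \<open>The coefficient of \<open>x^(n-i) y^i\<close> in \<open>(x - y)^n\<close>, expanded in
  powers of \<open>y\<close>. In the expansion in powers of \<open>x\<close>, the coefficient of
  \<open>x^i y^(n-i)\<close> is \<open>sign_power n * signed_choose n i\<close>.\<close>

definition signed_choose :: "int \<Rightarrow> nat \<Rightarrow> complex" where
  "signed_choose n i = (- 1) ^ i * (of_int n gchoose i)"

definition sign_power :: "int \<Rightarrow> complex" where
  "sign_power n = (- 1) powi n"

lemma signed_choose_0 [simp]: "signed_choose n 0 = 1"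
  by (simp add: signed_choose_def)

lemma sign_power_add: "sign_power (m + n) = sign_power m * sign_power n"
  by (simp add: sign_power_def power_int_add)

lemma sign_power_nat: "sign_power (int k) = (- 1) ^ k"
  by (simp add: sign_power_def)

lemma sign_power_diff_nat: "sign_power (n - int k) = sign_power n * (- 1) ^ k"
proof -
  have "sign_power n = sign_power (n - int k) * (- 1) ^ k"
    using sign_power_add[of "n - int k" "int k"] by (simp add: sign_power_nat)
  then show ?thesis by (simp flip: power_add mult_2)
qed

lemma sign_power_square [simp]: "sign_power n * sign_power n = 1"
  by (simp add: sign_power_def flip: power_int_mult_distrib)

lemma signed_choose_mult: "signed_choose n e * signed_choose r s = (- 1) ^ (e + s) * ((of_int n gchoose e) * (of_int r gchoose s))"
  by (simp add: signed_choose_def power_add)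

text \<open>Choosing \<open>e\<close> and then \<open>t\<close> amounts to choosing
  \<open>e + t\<close> and marking \<open>t\<close> of them. The identity trades a shifted upper
  index for a binomial coefficient with a natural upper index.\<close>

lemma gbinomial_multinomial:
  fixes x :: complex
  shows "(x gchoose e) * ((x - of_nat e) gchoose t) = (x gchoose (e + t)) * (of_nat (e + t) gchoose t)"
proof -
  have "(x gchoose (e + t)) * (of_nat (e + t) gchoose e) = (x gchoose e) * (x - of_nat e gchoose t)"
    using gbinomial_trinomial_revision[of e "e + t" x] by simp
  moreover have "(of_nat (e + t) gchoose e :: complex) = of_nat (e + t) gchoose t"
    using gbinomial_of_nat_symmetric[of e "e + t"] by simp
  ultimately show ?thesis by simp
qed

lemma gbinomial_multinomial_swap:
  fixes x :: complex
  shows "(x gchoose e) * ((x - of_nat e) gchoose t) = (x gchoose t) * ((x - of_nat t) gchoose e)"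
proof -
  have "(of_nat (e + t) gchoose e :: complex) = of_nat (e + t) gchoose t"
    using gbinomial_of_nat_symmetric[of e "e + t"] by simp
  then show ?thesis
    using gbinomial_multinomial[of x e t] gbinomial_multinomial[of x t e] by (simp add: add.commute)
qed

lemma gbinomial_nat_eq_0: "e < t \<Longrightarrow> (of_nat e gchoose t :: complex) = 0"
  by (simp flip: binomial_gbinomial)

section \<open>Finite truncations of sums\<close>

text \<open>The sums in the Jacobi identity have finite support. Cutting all of them at one common
  \<open>K\<close> gives sums over initial segments, which can be exchanged and reindexed without
  conditions on supports.\<close>

lemma Sum_any_lessThan:
  fixes f :: "nat \<Rightarrow> 'w::comm_monoid_add"
  assumes "\<And>i. i \<ge> K \<Longrightarrow> f i = 0"
  shows "Sum_any f = (\<Sum>i<K. f i)"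
  by (rule Sum_any.expand_superset) (use assms not_le in auto)

text \<open>The square and the triangle \<open>i + j < K\<close> carry the same sum, so one cutoff
  serves the two original indices as well as the diagonal index.\<close>

lemma sum_square_diagonal:
  fixes f :: "nat \<Rightarrow> nat \<Rightarrow> 'w::comm_monoid_add"
  assumes "\<And>i j. i + j \<ge> K \<Longrightarrow> f i j = 0"
  shows "(\<Sum>i<K. \<Sum>j<K. f i j) = (\<Sum>A<K. \<Sum>i\<le>A. f i (A - i))"
proof -
  have "(\<Sum>i<K. \<Sum>j<K. f i j) = (\<Sum>(i,j)\<in>{..<K} \<times> {..<K}. f i j)"
    by (simp add: sum.cartesian_product)
  also have "\<dots> = (\<Sum>(i,j)\<in>{(i,j). i + j < K}. f i j)"
    using assms by (intro sum.mono_neutral_right) (auto simp flip: not_le)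
  also have "\<dots> = (\<Sum>A<K. \<Sum>i\<le>A. f i (A - i))"
    by (rule sum.triangle_reindex)
  finally show ?thesis .
qed

text \<open>The length \<open>K\<close> survives the shift by \<open>t\<close> because
  \<open>f\<close> vanishes from \<open>K\<close> on.\<close>

lemma sum_shift_truncated:
  fixes f :: "nat \<Rightarrow> 'w::comm_monoid_add"
  assumes "\<And>A. A < t \<Longrightarrow> f A = 0" "\<And>A. A \<ge> K \<Longrightarrow> f A = 0"
  shows "(\<Sum>A<K. f A) = (\<Sum>s<K. f (s + t))"
proof -
  have "(\<Sum>A<K. f A) = (\<Sum>A<K + t. f A)"
    using assms by (intro sum.mono_neutral_left) auto
  also have "\<dots> = (\<Sum>A\<in>{0..<t}. f A) + (\<Sum>A\<in>{t..<K+t}. f A)"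
    by (subst sum.atLeastLessThan_concat) (auto simp: lessThan_atLeast0)
  also have "(\<Sum>A\<in>{0..<t}. f A) = 0" using assms by simp
  also have "(\<Sum>A\<in>{t..<K+t}. f A) = (\<Sum>s<K. f (s + t))"
    using sum.shift_bounds_nat_ivl[of f 0 t K] by (simp add: lessThan_atLeast0)
  finally show ?thesis by simp
qed

section \<open>Vandermonde convolution for vector-valued sums, and fields\<close>

locale complex_vector_space = vector_space sc
  for sc :: "complex \<Rightarrow> 'w::ab_group_add \<Rightarrow> 'w"
begin

lemma vandermonde_sum:
  assumes "\<And>A. A \<ge> K \<Longrightarrow> G A = 0"
  shows "(\<Sum>i<K. \<Sum>j<K. sc ((x gchoose i) * (y gchoose j)) (G (i + j))) = (\<Sum>A<K. sc ((x + y) gchoose A) (G A))"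
proof -
  have "(\<Sum>i<K. \<Sum>j<K. sc ((x gchoose i) * (y gchoose j)) (G (i + j)))
      = (\<Sum>A<K. \<Sum>i\<le>A. sc ((x gchoose i) * (y gchoose (A - i))) (G (i + (A - i))))"
    by (rule sum_square_diagonal) (simp add: assms)
  also have "\<dots> = (\<Sum>A<K. \<Sum>i\<le>A. sc ((x gchoose i) * (y gchoose (A - i))) (G A))"
    by (intro sum.cong refl) auto
  also have "\<dots> = (\<Sum>A<K. sc ((x + y) gchoose A) (G A))"
    using gbinomial_Vandermonde[of x y] by (simp add: atLeast0AtMost flip: scale_sum_left)
  finally show ?thesis .
qed

lemma vandermonde_sum_signed:
  assumes "\<And>A. A \<ge> K \<Longrightarrow> G A = 0"
  shows "(\<Sum>i<K. \<Sum>j<K. sc (signed_choose m i * signed_choose n j) (G (i + j))) = (\<Sum>A<K. sc (signed_choose (m + n) A) (G A))"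
proof -
  have "(\<Sum>i<K. \<Sum>j<K. sc ((of_int m gchoose i) * (of_int n gchoose j)) (sc ((- 1) ^ (i + j)) (G (i + j))))
     = (\<Sum>A<K. sc ((of_int m + of_int n) gchoose A) (sc ((- 1) ^ A) (G A)))"
    by (rule vandermonde_sum) (simp add: assms)
  then show ?thesis
    by (simp add: signed_choose_mult) (simp add: signed_choose_def mult.commute)
qed

text \<open>By \<open>gbinomial_multinomial\<close> the factor \<open>e choose t\<close> becomes a
  shift of \<open>e\<close> by \<open>t\<close> and lowers \<open>n\<close> to \<open>n - t\<close>;
  then Vandermonde applies to \<open>n - t\<close> and \<open>r\<close>. The factor
  \<open>e choose t\<close> arises from commuting a mode \<open>h(e)\<close> past a field.\<close>

lemma vandermonde_sum_mixed:
  assumes "\<And>A. A \<ge> K \<Longrightarrow> G A = 0"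
  shows "(\<Sum>e<K. \<Sum>s<K. sc ((of_nat e gchoose t) * (signed_choose n e * signed_choose r s)) (G (e + s)))
       = (\<Sum>s<K. sc (signed_choose n t * signed_choose (n + r - int t) s) (G (s + t)))"
proof -
  let ?f = "\<lambda>e. \<Sum>s<K. sc ((of_nat e gchoose t) * (signed_choose n e * signed_choose r s)) (G (e + s))"
  have c: "(of_nat (e + t) gchoose t) * (signed_choose n (e + t) * z) = signed_choose n t * (signed_choose (n - int t) e * z)" for e z
  proof -
    have "(of_nat (e + t) gchoose t) * (of_int n gchoose (e + t)) =
        (of_int n gchoose t) * ((of_int n - of_nat t) gchoose e :: complex)"
      using gbinomial_multinomial[of "of_int n" e t] gbinomial_multinomial_swap[of "of_int n" e t]
      by (simp only: mult.commute)
    then have "(- 1) ^ (e + t) * ((of_nat (e + t) gchoose t) * (of_int n gchoose (e + t))) * z =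
        (- 1) ^ (e + t) * ((of_int n gchoose t) * (of_int (n - int t) gchoose e)) * z"
      by simp
    then show ?thesis unfolding signed_choose_def power_add by (simp only: mult_ac)
  qed
  have "(\<Sum>e<K. ?f e) = (\<Sum>e<K. ?f (e + t))"
    by (rule sum_shift_truncated) (simp_all add: gbinomial_nat_eq_0 assms)
  also have "\<dots> = (\<Sum>e<K. \<Sum>s<K. sc (signed_choose n t) (sc (signed_choose (n - int t) e * signed_choose r s) (G (e + s + t))))"
    by (intro sum.cong refl) (simp add: c add_ac del: of_nat_add)
  also have "\<dots> = sc (signed_choose n t) (\<Sum>e<K. \<Sum>s<K. sc (signed_choose (n - int t) e * signed_choose r s) (G (e + s + t)))"
    by (simp only: scale_sum_right)
  also have "\<dots> = sc (signed_choose n t) (\<Sum>s<K. sc (signed_choose (n - int t + r) s) (G (s + t)))"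
    by (subst vandermonde_sum_signed[where G = "\<lambda>A. G (A + t)"]) (simp_all add: assms)
  also have "n - int t + r = n + r - int t" by simp
  finally show ?thesis
    by (simp add: scale_sum_right)
qed

text \<open>An operator-valued series \<open>F(z)\<close> such that \<open>F(z) w\<close> is a
  Laurent series in \<open>z\<close> for every \<open>w\<close>; \<open>F n\<close> is the
  coefficient of \<open>z^(-n-1)\<close>.\<close>

definition is_field :: "(int \<Rightarrow> 'w \<Rightarrow> 'w) \<Rightarrow> bool" where
  "is_field F \<longleftrightarrow> (\<forall>n v w. F n (v + w) = F n v + F n w) \<and> (\<forall>n c w. F n (sc c w) = sc c (F n w)) \<and>
     (\<forall>w. \<exists>N. \<forall>n\<ge>N. F n w = 0)"

lemma is_field_add: "is_field F \<Longrightarrow> F n (v + w) = F n v + F n w"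
  and is_field_scale: "is_field F \<Longrightarrow> F n (sc c w) = sc c (F n w)"
  and is_field_bound: "is_field F \<Longrightarrow> \<exists>N. \<forall>n\<ge>N. F n w = 0"
  by (simp_all add: is_field_def)

lemma is_field_plus: "is_field F \<Longrightarrow> is_field G \<Longrightarrow> is_field (\<lambda>q w. F q w + G q w)"
proof -
  assume F: "is_field F" "is_field G"
  have "\<exists>N. \<forall>k\<ge>N. F k w + G k w = 0" for w
  proof -
    obtain N N' where "\<forall>k\<ge>N. F k w = 0" "\<forall>k\<ge>N'. G k w = 0" using is_field_bound F by metis
    then have "\<forall>k\<ge>max N N'. F k w + G k w = 0" by simp
    then show ?thesis by blast
  qed
  then show ?thesis
    unfolding is_field_def using F by (simp add: is_field_add is_field_scale scale_right_distrib add_ac)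
qed

lemma is_field_times: "is_field F \<Longrightarrow> is_field (\<lambda>q w. sc c (F q w))"
proof -
  assume F: "is_field F"
  have "\<exists>N. \<forall>k\<ge>N. sc c (F k w) = 0" for w
    using is_field_bound[OF F, of w] by (metis scale_zero_right)
  then show ?thesis
    unfolding is_field_def using F by (simp add: is_field_add is_field_scale scale_right_distrib mult.commute)
qed

lemma is_field_linear: "is_field F \<Longrightarrow> Vector_Spaces.linear sc sc (F n)"
  by (simp add: Vector_Spaces.linear_def module_hom_def module_hom_axioms_def
      vector_space_axioms module_axioms is_field_add is_field_scale)

lemma is_field_zero [simp]: "is_field F \<Longrightarrow> F n 0 = 0"
  using is_field_scale[of F n 0 0] by simp

lemma is_field_minus: "is_field F \<Longrightarrow> F n (- w) = - F n w"
  using is_field_scale[of F n "-1" w] by simp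

lemma is_field_diff: "is_field F \<Longrightarrow> F n (v - w) = F n v - F n w"
  using is_field_add[of F n v "- w"] by (simp add: is_field_minus)

lemma is_field_sum: "is_field F \<Longrightarrow> F n (\<Sum>i\<in>I. g i) = (\<Sum>i\<in>I. F n (g i))"
  by (induction I rule: infinite_finite_induct) (simp_all add: is_field_add)

end

text \<open>Only finitely many rows \<open>g s\<close> are nonzero, so the cutoffs of the rows have
  a maximum. This supplies cutoffs for sums nested in sums.\<close>

lemma eventually_uniform:
  fixes g :: "nat \<Rightarrow> nat \<Rightarrow> 'w::zero"
  assumes "\<And>s. \<forall>\<^sub>F K in sequentially. \<forall>i\<ge>K. g s i = 0"
    and "\<forall>\<^sub>F s in sequentially. \<forall>i. g s i = 0"
  shows "\<forall>\<^sub>F K in sequentially. \<forall>i\<ge>K. \<forall>s. g s i = 0"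
proof -
  obtain S where S: "\<And>s i. s \<ge> S \<Longrightarrow> g s i = 0"
    using assms(2) by (auto simp: eventually_sequentially)
  have "\<forall>\<^sub>F K in sequentially. \<forall>s\<in>{..<S}. \<forall>i\<ge>K. g s i = 0"
    using assms(1) by (intro eventually_ball_finite) auto
  then show ?thesis
    by eventually_elim (metis S lessThan_iff not_less)
qed

context complex_vector_space
begin

lemma is_field_eventually: "is_field F \<Longrightarrow> \<forall>\<^sub>F K in sequentially. \<forall>i\<ge>K. F (q + int i) w = 0"
proof -
  assume "is_field F"
  then obtain N where "\<And>n. n \<ge> N \<Longrightarrow> F n w = 0" using is_field_bound by blast
  then have "\<forall>i\<ge>nat (N - q). F (q + int i) w = 0" by auto
  then show ?thesis unfolding eventually_sequentially
    by (intro exI[of _ "nat (N - q)"]) auto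
qed

lemma is_field_eventually_uniform:
  assumes "is_field F" and "\<forall>\<^sub>F s in sequentially. v s = 0"
  shows "\<forall>\<^sub>F K in sequentially. \<forall>i\<ge>K. \<forall>s. F (c s + int i) (v s) = 0"
  by (rule eventually_uniform)
     (use is_field_eventually[OF assms(1)] assms in \<open>auto elim: eventually_mono\<close>)

lemma is_field_eventually_zero:
  assumes "is_field F"
  shows "\<forall>\<^sub>F s in sequentially. F (q + int s) w = 0"
  using is_field_eventually[OF assms, of q w] by (rule eventually_mono) auto

end

section \<open>Fields on a restricted module\<close>

text \<open>The affinization seen only through its modes: \<open>kap\<close> is the form on currents
  already multiplied by the level, and the index type \<open>'a\<close> carries no linear structure,
  which is added in \<open>level_module\<close>.\<close>

locale mode_module = complex_vector_space sc
  for sc :: "complex \<Rightarrow> 'w::ab_group_add \<Rightarrow> 'w" +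
  fixes act :: "'a \<Rightarrow> int \<Rightarrow> 'w \<Rightarrow> 'w" and kap :: "'a \<Rightarrow> 'a \<Rightarrow> complex"
  assumes act_add: "act a n (v + w) = act a n v + act a n w"
    and act_scale: "act a n (sc c w) = sc c (act a n w)"
    and act_commute: "act a m (act b n w) = act b n (act a m w) +
      (if m + n = 0 then sc (of_int m * kap a b) w else 0)"
    and act_smooth: "\<exists>N. \<forall>n\<ge>N. \<forall>a. act a n w = 0"
begin

lemma act_is_field [simp]: "is_field (act a)"
  unfolding is_field_def
proof (intro conjI allI)
  show "\<exists>N. \<forall>n\<ge>N. act a n w = 0" for w
    using act_smooth[of w] by blast
qed (simp_all add: act_add act_scale)

lemma act_zero [simp]: "act a n 0 = 0"
  by simp

lemma act_nonneg_commute: "act a (int i) (act b (int j) w) = act b (int j) (act a (int i) w)"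
  by (subst act_commute) auto

text \<open>The coefficients of \<open>a(z)\<^sub>(\<^sub>n\<^sub>)F(z)\<close>: the right-hand side of the Jacobi identity for \<open>p = 0\<close>,
  taken as a definition.\<close>

definition nprod :: "'a \<Rightarrow> int \<Rightarrow> (int \<Rightarrow> 'w \<Rightarrow> 'w) \<Rightarrow> int \<Rightarrow> 'w \<Rightarrow> 'w" where
  "nprod a n F q w = Sum_any (\<lambda>i::nat. sc (signed_choose n i)
     (act a (n - int i) (F (q + int i) w) - sc (sign_power n) (F (q + n - int i) (act a (int i) w))))"

lemma nprod_lessThan:
  assumes F: "is_field F" and "\<And>i. i \<ge> K \<Longrightarrow> F (q + int i) w = 0" "\<And>i. i \<ge> K \<Longrightarrow> act a (int i) w = 0"
  shows "nprod a n F q w = (\<Sum>i<K. sc (signed_choose n i) (act a (n - int i) (F (q + int i) w)))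
       - (\<Sum>i<K. sc (sign_power n * signed_choose n i) (F (q + n - int i) (act a (int i) w)))"
proof -
  have "nprod a n F q w = (\<Sum>i<K. sc (signed_choose n i)
     (act a (n - int i) (F (q + int i) w) - sc (sign_power n) (F (q + n - int i) (act a (int i) w))))"
    unfolding nprod_def by (rule Sum_any_lessThan) (simp add: assms)
  then show ?thesis by (simp add: sum_subtractf scale_right_diff_distrib mult.commute)
qed

text \<open>Stated for all large cutoffs, so that several n-th products can be compared at one
  common \<open>K\<close>. A conclusion that does not mention \<open>K\<close> then holds outright,
  since some large \<open>K\<close> exists.\<close>

lemma nprod_eventually:
  assumes F: "is_field F"
  shows "\<forall>\<^sub>F K in sequentially. nprod a n F q w =
      (\<Sum>i<K. sc (signed_choose n i) (act a (n - int i) (F (q + int i) w)))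
       - (\<Sum>i<K. sc (sign_power n * signed_choose n i) (F (q + n - int i) (act a (int i) w)))"
  using is_field_eventually[OF F, of q w] is_field_eventually[OF act_is_field, of a 0 w]
  by eventually_elim (rule nprod_lessThan[OF F], auto)

lemma nprod_add_right:
  assumes F: "is_field F"
  shows "nprod a n F q (v + w) = nprod a n F q v + nprod a n F q w"
proof -
  have "\<forall>\<^sub>F K in sequentially. nprod a n F q (v + w) = nprod a n F q v + nprod a n F q w"
    using nprod_eventually[OF F, of a n q v] nprod_eventually[OF F, of a n q w]
      nprod_eventually[OF F, of a n q "v + w"]
    by eventually_elim (simp add: act_add is_field_add[OF F] scale_right_distrib sum.distrib)
  then show ?thesis by simp
qed

lemma nprod_scale_right:
  assumes F: "is_field F"
  shows "nprod a n F q (sc c w) = sc c (nprod a n F q w)"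
proof -
  have "\<forall>\<^sub>F K in sequentially. nprod a n F q (sc c w) = sc c (nprod a n F q w)"
    using nprod_eventually[OF F, of a n q "sc c w"] nprod_eventually[OF F, of a n q w]
    by eventually_elim (simp add: act_scale is_field_scale[OF F] scale_sum_right scale_right_diff_distrib mult.commute)
  then show ?thesis by simp
qed

text \<open>Only finitely many of the vectors \<open>act a (int s) w\<close> are nonzero, so the
  truncation bounds of \<open>F\<close> on them have a common bound that does not depend on the
  summation index.\<close>

lemma nprod_is_field [simp]:
  assumes F: "is_field F"
  shows "is_field (nprod a n F)"
proof -
  have "\<exists>N. \<forall>q\<ge>N. nprod a n F q w = 0" for w
  proof -
    obtain N where N: "\<And>k. k \<ge> N \<Longrightarrow> F k w = 0" using is_field_bound[OF F] by blast
    have "\<forall>\<^sub>F s in sequentially. act a (int s) w = 0"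
      using is_field_eventually_zero[OF act_is_field, of a 0 w] by simp
    then have "\<forall>\<^sub>F K in sequentially. \<forall>i\<ge>K. \<forall>s. F (n - int s + int i) (act a (int s) w) = 0"
      by (rule is_field_eventually_uniform[OF F])
    then obtain K where K: "\<And>i s. i \<ge> K \<Longrightarrow> F (n - int s + int i) (act a (int s) w) = 0"
      by (auto simp: eventually_sequentially)
    show ?thesis
    proof (intro exI[of _ "max N (int K)"] allI impI)
      fix q assume q: "max N (int K) \<le> q"
      have "F (q + n - int i) (act a (int i) w) = 0" for i
      proof -
        have "q + n - int i = n - int i + int (nat q)" using q by simp
        then show ?thesis using K[of "nat q" i] q by (simp only: nat_le_iff le_nat_iff)
      qed
      then show "nprod a n F q w = 0"
        unfolding nprod_def using q N by simp
    qed
  qed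
  then show ?thesis
    unfolding is_field_def using nprod_add_right[OF F] nprod_scale_right[OF F] by blast
qed

lemma nprod_zero [simp]: "nprod a n (\<lambda>_ _. 0) = (\<lambda>_ _. 0)"
  by (simp add: nprod_def fun_eq_iff)

lemma nprod_add_field:
  assumes F: "is_field F" "is_field G"
  shows "nprod a n (\<lambda>q w. F q w + G q w) q w = nprod a n F q w + nprod a n G q w"
proof -
  note FG = is_field_plus[OF F]
  have "\<forall>\<^sub>F K in sequentially. nprod a n (\<lambda>q w. F q w + G q w) q w = nprod a n F q w + nprod a n G q w"
    using nprod_eventually[OF F(1), of a n q w] nprod_eventually[OF F(2), of a n q w]
      nprod_eventually[OF FG, of a n q w]
    by eventually_elim (simp add: act_add scale_right_distrib sum.distrib)
  then show ?thesis by simp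
qed

lemma nprod_scale_field:
  assumes F: "is_field F"
  shows "nprod a n (\<lambda>q w. sc c (F q w)) q w = sc c (nprod a n F q w)"
proof -
  note F' = is_field_times[OF F, of c]
  have "\<forall>\<^sub>F K in sequentially. nprod a n (\<lambda>q w. sc c (F q w)) q w = sc c (nprod a n F q w)"
    using nprod_eventually[OF F, of a n q w] nprod_eventually[OF F', of a n q w]
    by eventually_elim (simp add: act_scale scale_right_diff_distrib scale_sum_right mult_ac)
  then show ?thesis by simp
qed

text \<open>No locality is needed: the products with both modes on one side of \<open>F\<close> cancel except for the
  central terms, whose sum is a Vandermonde convolution.\<close>

lemma nprod_commutator:
  assumes F: "is_field F"
  shows "nprod h m (nprod g n F) q w = nprod g n (nprod h m F) q w +
    (if m + n = 0 then sc (of_int m * kap h g) (F q w) else 0)"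
proof -
  let ?G = "nprod g n F" and ?H = "nprod h m F"
  have eh: "\<forall>\<^sub>F s in sequentially. act h (int s) w = 0" for h
    using is_field_eventually_zero[OF act_is_field, of h 0 w] by simp
  have "\<forall>\<^sub>F K in sequentially.
      (\<forall>i\<ge>K. F (q + int i) w = 0) \<and> (\<forall>i\<ge>K. ?G (q + int i) w = 0) \<and> (\<forall>i\<ge>K. ?H (q + int i) w = 0) \<and>
      (\<forall>i\<ge>K. act h (0 + int i) w = 0) \<and> (\<forall>i\<ge>K. act g (0 + int i) w = 0) \<and>
      (\<forall>i\<ge>K. \<forall>s. F (q + m - int s + int i) (act h (int s) w) = 0) \<and>
      (\<forall>i\<ge>K. \<forall>s. F (q + n - int s + int i) (act g (int s) w) = 0) \<and>
      (\<forall>i\<ge>K. \<forall>s. act g (0 + int i) (act h (int s) w) = 0) \<and>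
      (\<forall>i\<ge>K. \<forall>s. act h (0 + int i) (act g (int s) w) = 0) \<and> K > nat (m + n)"
    by (intro eventually_conj is_field_eventually is_field_eventually_uniform eh)
       (simp_all add: F eventually_gt_at_top)

  then obtain K where
    K: "\<And>i. i \<ge> K \<Longrightarrow> F (q + int i) w = 0"
       "\<And>i. i \<ge> K \<Longrightarrow> ?G (q + int i) w = 0" "\<And>i. i \<ge> K \<Longrightarrow> ?H (q + int i) w = 0"
       "\<And>i. i \<ge> K \<Longrightarrow> act h (int i) w = 0" "\<And>i. i \<ge> K \<Longrightarrow> act g (int i) w = 0"
       "\<And>i s. i \<ge> K \<Longrightarrow> F (q + m - int s + int i) (act h (int s) w) = 0"
       "\<And>i s. i \<ge> K \<Longrightarrow> F (q + n - int s + int i) (act g (int s) w) = 0"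
       "\<And>i s. i \<ge> K \<Longrightarrow> act g (int i) (act h (int s) w) = 0"
       "\<And>i s. i \<ge> K \<Longrightarrow> act h (int i) (act g (int s) w) = 0" "K > nat (m + n)"
    using eventually_happens'[OF sequentially_bot] by (smt (verit) add_0)
  have G0: "nprod h m ?G q w = (\<Sum>i<K. sc (signed_choose m i) (act h (m - int i) (?G (q + int i) w)))
       - (\<Sum>i<K. sc (sign_power m * signed_choose m i) (?G (q + m - int i) (act h (int i) w)))"
    using F K(2,4) by (intro nprod_lessThan) auto
  have H0: "nprod g n ?H q w = (\<Sum>i<K. sc (signed_choose n i) (act g (n - int i) (?H (q + int i) w)))
       - (\<Sum>i<K. sc (sign_power n * signed_choose n i) (?H (q + n - int i) (act g (int i) w)))"
    using F K(3,5) by (intro nprod_lessThan) auto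
  have G1: "?G (q + int i) w = (\<Sum>j<K. sc (signed_choose n j) (act g (n - int j) (F (q + int i + int j) w)))
       - (\<Sum>j<K. sc (sign_power n * signed_choose n j) (F (q + int i + n - int j) (act g (int j) w)))" for i
    by (rule nprod_lessThan[OF F]) (use K(1)[of "i + _"] K(5) in \<open>auto simp: add.assoc\<close>)
  have H1: "?H (q + int i) w = (\<Sum>j<K. sc (signed_choose m j) (act h (m - int j) (F (q + int i + int j) w)))
       - (\<Sum>j<K. sc (sign_power m * signed_choose m j) (F (q + int i + m - int j) (act h (int j) w)))" for i
    by (rule nprod_lessThan[OF F]) (use K(1)[of "i + _"] K(4) in \<open>auto simp: add.assoc\<close>)
  have G2: "?G (q + m - int i) (act h (int i) w) =
        (\<Sum>j<K. sc (signed_choose n j) (act g (n - int j) (F (q + m - int i + int j) (act h (int i) w))))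
       - (\<Sum>j<K. sc (sign_power n * signed_choose n j) (F (q + m - int i + n - int j) (act g (int j) (act h (int i) w))))" for i
    by (rule nprod_lessThan[OF F]) (use K(6,8) in auto)
  have H2: "?H (q + n - int i) (act g (int i) w) =
        (\<Sum>j<K. sc (signed_choose m j) (act h (m - int j) (F (q + n - int i + int j) (act g (int i) w))))
       - (\<Sum>j<K. sc (sign_power m * signed_choose m j) (F (q + n - int i + m - int j) (act h (int j) (act g (int i) w))))" for i
    by (rule nprod_lessThan[OF F]) (use K(7,9) in auto)
  \<comment> \<open>\<open>?a\<close> has both modes to the left of \<open>F\<close>,
    \<open>?d\<close> both to the right, \<open>?b\<close> and \<open>?c\<close> one on each side.
    Only \<open>?a\<close> depends on the order of the two modes: the modes to the right are
    nonnegative and commute.\<close>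
  let ?a = "\<lambda>i j. sc (signed_choose m i * signed_choose n j) (act h (m - int i) (act g (n - int j) (F (q + int (i + j)) w)))"
  let ?a' = "\<lambda>i j. sc (signed_choose m i * signed_choose n j) (act g (n - int j) (act h (m - int i) (F (q + int (i + j)) w)))"
  let ?b = "\<lambda>i j. sc (signed_choose m i * (sign_power n * signed_choose n j)) (act h (m - int i) (F (q + int i + n - int j) (act g (int j) w)))"
  let ?c = "\<lambda>i j. sc (sign_power m * signed_choose m i * signed_choose n j) (act g (n - int j) (F (q + m - int i + int j) (act h (int i) w)))"
  let ?d = "\<lambda>i j. sc (sign_power m * signed_choose m i * (sign_power n * signed_choose n j)) (F (q + m - int i + n - int j) (act g (int j) (act h (int i) w)))"
  have L: "nprod h m ?G q w = (\<Sum>i<K. \<Sum>j<K. ?a i j) - (\<Sum>i<K. \<Sum>j<K. ?b i j)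
     - (\<Sum>i<K. \<Sum>j<K. ?c i j) + (\<Sum>i<K. \<Sum>j<K. ?d i j)"
    unfolding G0 G1 G2 by
       (simp add: is_field_diff F is_field_sum is_field_scale scale_right_diff_distrib scale_sum_right
         sum_subtractf algebra_simps)
  have "nprod g n ?H q w = (\<Sum>j<K. \<Sum>i<K. ?a' i j) - (\<Sum>j<K. \<Sum>i<K. ?c i j)
     - (\<Sum>j<K. \<Sum>i<K. ?b i j) + (\<Sum>j<K. \<Sum>i<K. ?d i j)"
    unfolding H0 H1 H2 act_nonneg_commute[of h _ g] by
       (simp add: is_field_diff F is_field_sum is_field_scale scale_right_diff_distrib scale_sum_right
         sum_subtractf algebra_simps)
  then have R: "nprod g n ?H q w = (\<Sum>i<K. \<Sum>j<K. ?a' i j) - (\<Sum>i<K. \<Sum>j<K. ?c i j)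
     - (\<Sum>i<K. \<Sum>j<K. ?b i j) + (\<Sum>i<K. \<Sum>j<K. ?d i j)"
    by (simp only: sum.swap[of ?a' "{..<K}" "{..<K}"] sum.swap[of ?b "{..<K}" "{..<K}"]
      sum.swap[of ?c "{..<K}" "{..<K}"] sum.swap[of ?d "{..<K}" "{..<K}"])
  \<comment> \<open>The central terms live on the single diagonal \<open>i + j = m + n\<close>.
    Their factor \<open>m - i\<close> is absorbed into the binomial coefficient, so Vandermonde is
    applied with the upper indices \<open>m - 1\<close> and \<open>n\<close>.\<close>
  define D where "D A = (if int A = m + n then sc (kap h g) (F (q + m + n) w) else 0)" for A
  have m': "signed_choose m i * (of_int m - of_nat i) = of_int m * signed_choose (m - 1) i" for i
    using gbinomial_absorb_comp[of "of_int m :: complex" i] by (simp add: signed_choose_def mult_ac)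
  have "?a i j - ?a' i j = sc (of_int m) (sc (signed_choose (m - 1) i * signed_choose n j) (D (i + j)))" for i j
  proof -
    have "?a i j - ?a' i j = sc (signed_choose m i * signed_choose n j) (if int (i + j) = m + n
        then sc (of_int (m - int i) * kap h g) (F (q + int (i + j)) w) else 0)"
      by (subst act_commute[of h _ g]) (auto simp: scale_right_distrib)
    also have "\<dots> = sc ((signed_choose m i * (of_int m - of_nat i)) * signed_choose n j) (D (i + j))"
      by (auto simp: D_def algebra_simps)
    finally show ?thesis by (simp add: m' mult_ac)
  qed
  then have "nprod h m ?G q w - nprod g n ?H q w
     = sc (of_int m) (\<Sum>i<K. \<Sum>j<K. sc (signed_choose (m - 1) i * signed_choose n j) (D (i + j)))"
    unfolding L R by (simp add: scale_sum_right flip: sum_subtractf)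
  also have "\<dots> = sc (of_int m) (\<Sum>A<K. sc (signed_choose (m + n - 1) A) (D A))"
    by (subst vandermonde_sum_signed) (use K(10) in \<open>auto simp: D_def algebra_simps\<close>)
  also have "(\<Sum>A<K. sc (signed_choose (m + n - 1) A) (D A)) = (if m + n = 0 then sc (kap h g) (F q w) else 0)"
  proof (cases "m + n \<ge> 0")
    case True
    have "(\<Sum>A<K. sc (signed_choose (m + n - 1) A) (D A)) = (\<Sum>A\<in>{nat (m + n)}. sc (signed_choose (m + n - 1) A) (D A))"
      by (rule sum.mono_neutral_right) (use K(10) True in \<open>auto simp: D_def\<close>)
    also have "\<dots> = sc (signed_choose (m + n - 1) (nat (m + n))) (sc (kap h g) (F (q + m + n) w))"
      using True by (simp add: D_def)
    \<comment> \<open>For \<open>m + n > 0\<close> the upper index is a natural number smaller than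
      the lower index, which leaves a central term only for \<open>m + n = 0\<close>.\<close>
    also have "signed_choose (m + n - 1) (nat (m + n)) = (if m + n = 0 then 1 else 0)"
    proof (cases "m + n = 0")
      case False
      then have "(of_int (m + n - 1) :: complex) = of_nat (nat (m + n - 1))"
        using True by simp
      moreover have "(of_nat (nat (m + n - 1)) gchoose nat (m + n) :: complex) = 0"
        using False True by (intro gbinomial_nat_eq_0) linarith
      ultimately show ?thesis using False by (simp only: signed_choose_def) simp
    qed (simp add: signed_choose_def)
    finally show ?thesis by (auto simp: add.assoc)
  qed (auto simp: D_def intro!: sum.neutral)
  finally show ?thesis by (auto simp: algebra_simps)
qed

end

lemma sign_power_nonzero [simp]: "sign_power n \<noteq> 0"
  by (simp add: sign_power_def)

text \<open>This is \<open>gbinomial_delta\<close> at \<open>p = m - 1\<close> and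
  \<open>r = n\<close>, multiplied by \<open>m\<close>, which is absorbed into the lower index. On
  the left stand the contractions of \<open>h(m)\<close> with the modes of \<open>g\<close> to the
  left and to the right of \<open>F\<close> in \<open>nprod g n F\<close>; on the right stands the
  one central term, at \<open>t = - n\<close>, that the commutator formula predicts.\<close>

lemma contraction_coefficient:
  "of_int m * ((if m + n \<ge> 0 then signed_choose n (nat (m + n)) else 0) - (if m \<le> 0 then sign_power n * signed_choose n (nat (- m)) else 0))
   = (if n \<le> 0 then of_int (- n) * (of_int m gchoose nat (- n)) else 0)"
proof -
  have "(if m + n \<ge> 0 then signed_choose n (nat (m + n)) else 0) - (if m \<le> 0 then sign_power n * signed_choose n (nat (- m)) else 0)
     = (if n \<le> - 1 then (of_int (m - 1) gchoose nat (- 1 - n) :: complex) else 0)"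
  proof -
    have "m - 1 + n + 1 = m + n" "- 1 - (m - 1) = - m" "m - 1 \<le> - 1 \<longleftrightarrow> m \<le> 0" by auto
    then show ?thesis
      using gbinomial_delta[of "m - 1" n] by (simp only: signed_choose_def sign_power_def mult.assoc)
  qed
  moreover have "of_int m * (of_int (m - 1) gchoose nat (- 1 - n)) =
      of_int (- n) * (of_int m gchoose nat (- n) :: complex)" if "n \<le> - 1"
  proof -
    define k where "k = nat (- n - 1)"
    have k: "nat (- n) = Suc k" "nat (- 1 - n) = k" "of_int (- n) = (of_nat (Suc k) :: complex)"
      using that by (auto simp: k_def)
    show ?thesis by (simp only: k of_int_diff of_int_1 gbinomial_absorption)
  qed
  ultimately show ?thesis by (cases "n = 0") auto
qed

section \<open>Locality of fields with the currents\<close>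

context mode_module
begin

text \<open>Mutual locality of \<open>F(z)\<close> with every current \<open>h(z)\<close>, in the
  form of the commutator formula. The n-th products with large index vanish as fields, not just on a
  given vector.\<close>

definition local_field :: "(int \<Rightarrow> 'w \<Rightarrow> 'w) \<Rightarrow> bool" where
  "local_field F \<longleftrightarrow> is_field F \<and>
     (\<forall>h. \<forall>\<^sub>F t in sequentially. nprod h (int t) F = (\<lambda>_ _. 0)) \<and>
     (\<forall>h m q w. act h m (F q w) - F q (act h m w) =
        Sum_any (\<lambda>t::nat. sc (of_int m gchoose t) (nprod h (int t) F (m + q - int t) w)))"

lemma local_field_is_field: "local_field F \<Longrightarrow> is_field F"
  by (simp add: local_field_def)

lemma local_field_bound:
  "local_field F \<Longrightarrow> \<forall>\<^sub>F T in sequentially. \<forall>t\<ge>T. \<forall>q w. nprod h (int t) F q w = 0"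
  unfolding local_field_def eventually_sequentially by (metis le_trans)

lemma local_field_commutator:
  assumes "local_field F" and "\<And>t. t \<ge> K \<Longrightarrow> nprod h (int t) F = (\<lambda>_ _. 0)"
  shows "act h m (F q w) - F q (act h m w) =
        (\<Sum>t<K. sc (of_int m gchoose t) (nprod h (int t) F (m + q - int t) w))"
proof -
  have "act h m (F q w) - F q (act h m w) =
        Sum_any (\<lambda>t::nat. sc (of_int m gchoose t) (nprod h (int t) F (m + q - int t) w))"
    using assms(1) by (auto simp: local_field_def)
  also have "\<dots> = (\<Sum>t<K. sc (of_int m gchoose t) (nprod h (int t) F (m + q - int t) w))"
    by (rule Sum_any_lessThan) (simp add: assms)
  finally show ?thesis .
qed

text \<open>An analogue of Dong's lemma. A mode \<open>h(m)\<close> passes through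
  \<open>nprod g n F\<close> by the Leibniz rule: its commutators with \<open>F\<close> assemble to
  \<open>nprod g n (nprod h t F)\<close>, its contractions with \<open>g\<close> to a central term,
  and \<open>nprod_commutator\<close> recognises the two together as
  \<open>nprod h t (nprod g n F)\<close>.\<close>

lemma nprod_local:
  assumes F: "local_field F"
  shows "local_field (nprod g n F)"
  unfolding local_field_def
proof (intro conjI allI)
  note fF [simp] = local_field_is_field[OF F]
  show "is_field (nprod g n F)" by simp
  have comm: "nprod h (int t) (nprod g n F) q w = nprod g n (nprod h (int t) F) q w +
      (if int t + n = 0 then sc (of_nat t * kap h g) (F q w) else 0)" for h t q w
    by (subst nprod_commutator) auto
  have ev0: "\<forall>\<^sub>F t in sequentially. nprod h (int t) F = (\<lambda>_ _. 0)" for h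
    using F by (auto simp: local_field_def)
  show ev: "\<forall>\<^sub>F t in sequentially. nprod h (int t) (nprod g n F) = (\<lambda>_ _. 0)" for h
    using ev0[of h] eventually_gt_at_top[of "nat (- n)"]
    by eventually_elim (intro ext, auto simp: comm)
  fix h m q w
  let ?G = "nprod g n F" and ?T = "\<lambda>t. nprod h (int t) F"
  have e1: "\<forall>\<^sub>F s in sequentially. act g (int s) w = 0" 
    using is_field_eventually_zero[OF act_is_field, of g 0 w] by simp
  have e2: "\<forall>\<^sub>F K in sequentially. \<forall>i\<ge>K. \<forall>t. ?T t (m + q - int t + int i) w = 0"
  proof (rule eventually_uniform)
    show "\<forall>\<^sub>F K in sequentially. \<forall>i\<ge>K. ?T t (m + q - int t + int i) w = 0" for t
      by (rule is_field_eventually) simp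
    show "\<forall>\<^sub>F t in sequentially. \<forall>i. ?T t (m + q - int t + int i) w = 0"
      using ev0[of h] by eventually_elim simp
  qed
  have "\<forall>\<^sub>F K in sequentially.
      (\<forall>i\<ge>K. F (q + int i) w = 0) \<and> (\<forall>i\<ge>K. F (q + int i) (act h m w) = 0) \<and>
      (\<forall>i\<ge>K. act g (0 + int i) w = 0) \<and> (\<forall>i\<ge>K. act g (0 + int i) (act h m w) = 0) \<and>
      (\<forall>t\<ge>K. \<forall>q w. ?T t q w = 0) \<and> (\<forall>t\<ge>K. \<forall>q w. nprod h (int t) ?G q w = 0) \<and>
      (\<forall>i\<ge>K. \<forall>t. ?T t (m + q - int t + int i) w = 0) \<and>
      K > nat (m + n) \<and> K > nat (- m) \<and> K > nat (- n)"
  proof (intro eventually_conj is_field_eventually e2 local_field_bound[OF F])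
    show "\<forall>\<^sub>F K in sequentially. \<forall>t\<ge>K. \<forall>q w. nprod h (int t) ?G q w = 0"
      using ev[of h] unfolding eventually_sequentially by (metis le_trans)
  qed (simp_all add: eventually_gt_at_top)
  from eventually_happens'[OF sequentially_bot this] obtain K where
    K: "\<And>i. i \<ge> K \<Longrightarrow> F (q + int i) w = 0" "\<And>i. i \<ge> K \<Longrightarrow> F (q + int i) (act h m w) = 0"
       "\<And>i. i \<ge> K \<Longrightarrow> act g (int i) w = 0" "\<And>i. i \<ge> K \<Longrightarrow> act g (int i) (act h m w) = 0"
       "\<And>t. t \<ge> K \<Longrightarrow> ?T t = (\<lambda>_ _. 0)" "\<And>t. t \<ge> K \<Longrightarrow> nprod h (int t) ?G = (\<lambda>_ _. 0)"
       "\<And>i t. i \<ge> K \<Longrightarrow> ?T t (m + q - int t + int i) w = 0"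
       "K > nat (m + n)" "K > nat (- m)" "K > nat (- n)"
    by (elim exE conjE) (rule that, auto simp: fun_eq_iff)
  have c: "act h m (F x v) = F x (act h m v) + (\<Sum>t<K. sc (of_int m gchoose t) (?T t (m + x - int t) v))"
    for x v using local_field_commutator[where K = K and h = h and m = m and q = x and w = v, OF F K(5)] by (simp add: algebra_simps)
  define D where "D = sc (of_int m * kap h g) (F (m + n + q) w)"
  let ?A = "\<lambda>i. sc (signed_choose n i) (act g (n - int i) (F (q + int i) (act h m w)))"
  let ?B = "\<lambda>i. sc (sign_power n * signed_choose n i) (F (q + n - int i) (act g (int i) (act h m w)))"
  let ?X = "\<lambda>i t. sc (of_int m gchoose t) (sc (signed_choose n i) (act g (n - int i) (?T t (m + q - int t + int i) w)))"
  let ?Z = "\<lambda>i t. sc (of_int m gchoose t) (sc (sign_power n * signed_choose n i) (?T t (m + q - int t + n - int i) (act g (int i) w)))"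
  have G1: "act h m (?G q w) = (\<Sum>i<K. sc (signed_choose n i) (act h m (act g (n - int i) (F (q + int i) w))))
       - (\<Sum>i<K. sc (sign_power n * signed_choose n i) (act h m (F (q + n - int i) (act g (int i) w))))"
    using K(1,3) by (subst nprod_lessThan[where K = K]) (simp_all add: is_field_diff is_field_sum is_field_scale)
  have t1: "sc (signed_choose n i) (act h m (act g (n - int i) (F (q + int i) w))) =
      ?A i + (\<Sum>t<K. ?X i t) + sc (signed_choose n i) (if int i = m + n then D else 0)" for i
  proof -
    have "act h m (act g (n - int i) (F (q + int i) w)) =
       act g (n - int i) (act h m (F (q + int i) w)) + (if int i = m + n then D else 0)"
      by (subst act_commute) (auto simp: D_def algebra_simps)
    also have "act h m (F (q + int i) w) = F (q + int i) (act h m w)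
       + (\<Sum>t<K. sc (of_int m gchoose t) (?T t (m + q - int t + int i) w))"
      by (subst c) (simp add: algebra_simps)
    finally show ?thesis
      by (simp add: is_field_add is_field_sum is_field_scale scale_right_distrib scale_sum_right mult.commute)
  qed
  have t2: "sc (sign_power n * signed_choose n i) (act h m (F (q + n - int i) (act g (int i) w))) =
      ?B i + (\<Sum>t<K. ?Z i t) + sc (sign_power n * signed_choose n i) (if int i = - m then D else 0)" for i
  proof -
    have "act h m (F (q + n - int i) (act g (int i) w)) = F (q + n - int i) (act h m (act g (int i) w))
       + (\<Sum>t<K. sc (of_int m gchoose t) (?T t (m + q - int t + n - int i) (act g (int i) w)))"
      by (subst c) (simp add: algebra_simps)
    also have "F (q + n - int i) (act h m (act g (int i) w)) =
        F (q + n - int i) (act g (int i) (act h m w)) + (if int i = - m then D else 0)"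
      by (subst act_commute) (auto simp: D_def is_field_add is_field_scale algebra_simps)
    finally show ?thesis
      by (simp add: is_field_add is_field_sum is_field_scale scale_right_distrib scale_sum_right mult.commute add_ac)
  qed
  have G2: "?G q (act h m w) = (\<Sum>i<K. ?A i) - (\<Sum>i<K. ?B i)"
    using K(2,4) by (subst nprod_lessThan[where K = K]) simp_all
  have TG: "nprod g n (?T t) (m + q - int t) w =
      (\<Sum>i<K. sc (signed_choose n i) (act g (n - int i) (?T t (m + q - int t + int i) w)))
    - (\<Sum>i<K. sc (sign_power n * signed_choose n i) (?T t (m + q - int t + n - int i) (act g (int i) w)))" for t
    using K(3,7) by (intro nprod_lessThan) simp_all
  \<comment> \<open>The mode \<open>h(m)\<close> contracts with \<open>g(n - i)\<close> for
    \<open>i = m + n\<close> only and with \<open>g(i)\<close> for \<open>i = - m\<close> only,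
    while the expected central term occurs for \<open>t = - n\<close> only. The three coefficients
    are compared in \<open>contraction_coefficient\<close>.\<close>
  have s1: "(\<Sum>i<K. sc (signed_choose n i) (if int i = m + n then D else 0)) = sc (if m + n \<ge> 0 then signed_choose n (nat (m + n)) else 0) D"
  proof (cases "m + n \<ge> 0")
    case True
    have "(\<Sum>i<K. sc (signed_choose n i) (if int i = m + n then D else 0)) = (\<Sum>i\<in>{nat (m + n)}. sc (signed_choose n i) (if int i = m + n then D else 0))"
      using K(8) True by (intro sum.mono_neutral_right) auto
    then show ?thesis using True by simp
  qed (auto intro!: sum.neutral)
  have s2: "(\<Sum>i<K. sc (sign_power n * signed_choose n i) (if int i = - m then D else 0)) = sc (if m \<le> 0 then sign_power n * signed_choose n (nat (- m)) else 0) D"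
  proof (cases "m \<le> 0")
    case True
    have "(\<Sum>i<K. sc (sign_power n * signed_choose n i) (if int i = - m then D else 0)) = (\<Sum>i\<in>{nat (- m)}. sc (sign_power n * signed_choose n i) (if int i = - m then D else 0))"
      using K(9) True by (intro sum.mono_neutral_right) auto
    then show ?thesis using True by simp
  qed (auto intro!: sum.neutral)
  have s3: "(\<Sum>t<K. sc (of_int m gchoose t) (if int t + n = 0 then sc (of_nat t * kap h g) (F (m + q - int t) w) else 0))
      = sc (if n \<le> 0 then of_int (- n) * (of_int m gchoose nat (- n)) else 0) (sc (kap h g) (F (m + n + q) w))"
  proof (cases "n \<le> 0")
    case True
    let ?f = "\<lambda>t. sc (of_int m gchoose t) (if int t + n = 0 then sc (of_nat t * kap h g) (F (m + q - int t) w) else 0)"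
    have "(\<Sum>t<K. ?f t) = (\<Sum>t\<in>{nat (- n)}. ?f t)"
      using K(10) True by (intro sum.mono_neutral_right) auto
    then show ?thesis using True by (simp add: algebra_simps)
  qed (auto intro!: sum.neutral)
  have "act h m (?G q w) - ?G q (act h m w) =
     (\<Sum>i<K. \<Sum>t<K. ?X i t) - (\<Sum>i<K. \<Sum>t<K. ?Z i t) +
     (sc (if m + n \<ge> 0 then signed_choose n (nat (m + n)) else 0) D - sc (if m \<le> 0 then sign_power n * signed_choose n (nat (- m)) else 0) D)"
    unfolding G1 G2 t1 t2 sum.distrib s1 s2 by (simp add: algebra_simps)
  also have "sc (if m + n \<ge> 0 then signed_choose n (nat (m + n)) else 0) D - sc (if m \<le> 0 then sign_power n * signed_choose n (nat (- m)) else 0) D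
     = sc (of_int m * ((if m + n \<ge> 0 then signed_choose n (nat (m + n)) else 0) - (if m \<le> 0 then sign_power n * signed_choose n (nat (- m)) else 0)))
          (sc (kap h g) (F (m + n + q) w))"
    unfolding D_def by (simp add: left_diff_distrib right_diff_distrib scale_left_diff_distrib mult_ac)
  also have "\<dots> = (\<Sum>t<K. sc (of_int m gchoose t) (if int t + n = 0 then sc (of_nat t * kap h g) (F (m + q - int t) w) else 0))"
    by (simp only: contraction_coefficient s3)
  also have "(\<Sum>i<K. \<Sum>t<K. ?X i t) - (\<Sum>i<K. \<Sum>t<K. ?Z i t) =
      (\<Sum>t<K. sc (of_int m gchoose t) (nprod g n (?T t) (m + q - int t) w))"
    unfolding TG sum.swap[of ?X "{..<K}" "{..<K}"] sum.swap[of ?Z "{..<K}" "{..<K}"]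
    by (simp only: scale_right_diff_distrib sum_subtractf scale_sum_right)
  finally have "act h m (?G q w) - ?G q (act h m w) =
     (\<Sum>t<K. sc (of_int m gchoose t) (nprod h (int t) ?G (m + q - int t) w))"
    by (simp add: comm scale_right_distrib sum.distrib)
  also have "\<dots> = Sum_any (\<lambda>t::nat. sc (of_int m gchoose t) (nprod h (int t) ?G (m + q - int t) w))"
    by (rule Sum_any_lessThan[symmetric]) (simp add: K(6))
  finally show "act h m (?G q w) - ?G q (act h m w) =
      Sum_any (\<lambda>t::nat. sc (of_int m gchoose t) (nprod h (int t) ?G (m + q - int t) w))" .
qed

text \<open>Replaces the \<open>Sum_any\<close> of the commutator formula by finite sums with any
  sufficiently large cutoff. The bound \<open>K\<close> is past the last nonzero n-th product, so
  all cutoffs above it give the same sum.\<close>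

lemma local_field_intro:
  assumes "is_field F" and "\<And>h. \<forall>\<^sub>F t in sequentially. nprod h (int t) F = (\<lambda>_ _. 0)"
    and "\<And>h m q w K. (\<And>t. t \<ge> K \<Longrightarrow> nprod h (int t) F = (\<lambda>_ _. 0)) \<Longrightarrow> \<forall>\<^sub>F K' in sequentially. K' \<ge> K \<longrightarrow>
      act h m (F q w) - F q (act h m w) =
        (\<Sum>t<K'. sc (of_int m gchoose t) (nprod h (int t) F (m + q - int t) w))"
  shows "local_field F"
  unfolding local_field_def
proof (intro conjI allI)
  fix h m q w
  obtain K where K: "\<And>t. t \<ge> K \<Longrightarrow> nprod h (int t) F = (\<lambda>_ _. 0)"
    using assms(2)[of h] unfolding eventually_sequentially by blast
  have "\<forall>\<^sub>F K' in sequentially. act h m (F q w) - F q (act h m w) =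
      Sum_any (\<lambda>t::nat. sc (of_int m gchoose t) (nprod h (int t) F (m + q - int t) w))"
  proof -
    have "\<forall>\<^sub>F K' in sequentially. K' \<ge> K \<longrightarrow> act h m (F q w) - F q (act h m w) =
        (\<Sum>t<K'. sc (of_int m gchoose t) (nprod h (int t) F (m + q - int t) w))"
      by (rule assms(3)) (rule K)
    then show ?thesis
      using eventually_ge_at_top[of K] by eventually_elim (subst Sum_any_lessThan, use K in auto)
  qed
  then show "act h m (F q w) - F q (act h m w) =
      Sum_any (\<lambda>t::nat. sc (of_int m gchoose t) (nprod h (int t) F (m + q - int t) w))"
    by simp
qed (use assms in auto)

lemma local_field_plus:
  assumes F: "local_field F" and G: "local_field G"
  shows "local_field (\<lambda>q w. F q w + G q w)"
proof (rule local_field_intro)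
  note f = local_field_is_field[OF F] local_field_is_field[OF G]
  show "is_field (\<lambda>q w. F q w + G q w)" by (intro is_field_plus f)
  fix h m q w
  have ev: "\<forall>\<^sub>F t in sequentially. nprod h (int t) F = (\<lambda>_ _. 0)"
    "\<forall>\<^sub>F t in sequentially. nprod h (int t) G = (\<lambda>_ _. 0)"
    using F G unfolding local_field_def by auto
  show "\<forall>\<^sub>F t in sequentially. nprod h (int t) (\<lambda>q w. F q w + G q w) = (\<lambda>_ _. 0)"
    using ev by eventually_elim (intro ext, simp add: nprod_add_field f)
  show "\<forall>\<^sub>F K' in sequentially. K' \<ge> K \<longrightarrow> act h m (F q w + G q w) - (F q (act h m w) + G q (act h m w)) =
      (\<Sum>t<K'. sc (of_int m gchoose t) (nprod h (int t) (\<lambda>q w. F q w + G q w) (m + q - int t) w))" for K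
    using local_field_bound[OF F, of h] local_field_bound[OF G, of h]
  proof eventually_elim
    case (elim K')
    show ?case
      using local_field_commutator[OF F, of K' h m q w] local_field_commutator[OF G, of K' h m q w] elim
      by (auto simp: nprod_add_field f scale_right_distrib sum.distrib act_add fun_eq_iff algebra_simps)
  qed
qed

lemma local_field_times:
  assumes F: "local_field F"
  shows "local_field (\<lambda>q w. sc c (F q w))"
proof (rule local_field_intro)
  note f = local_field_is_field[OF F]
  show "is_field (\<lambda>q w. sc c (F q w))" by (intro is_field_times f)
  fix h m q w
  have ev: "\<forall>\<^sub>F t in sequentially. nprod h (int t) F = (\<lambda>_ _. 0)"
    using F unfolding local_field_def by auto
  show "\<forall>\<^sub>F t in sequentially. nprod h (int t) (\<lambda>q w. sc c (F q w)) = (\<lambda>_ _. 0)"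
    using ev by eventually_elim (intro ext, simp add: nprod_scale_field f)
  show "\<forall>\<^sub>F K' in sequentially. K' \<ge> K \<longrightarrow> act h m (sc c (F q w)) - sc c (F q (act h m w)) =
      (\<Sum>t<K'. sc (of_int m gchoose t) (nprod h (int t) (\<lambda>q w. sc c (F q w)) (m + q - int t) w))" for K
    using local_field_bound[OF F, of h]
  proof eventually_elim
    case (elim K')
    have "act h m (sc c (F q w)) - sc c (F q (act h m w)) = sc c (act h m (F q w) - F q (act h m w))"
      by (simp add: act_scale scale_right_diff_distrib)
    also have "act h m (F q w) - F q (act h m w) =
        (\<Sum>t<K'. sc (of_int m gchoose t) (nprod h (int t) F (m + q - int t) w))"
      using elim by (intro local_field_commutator[OF F]) (simp add: fun_eq_iff)
    finally show ?case by (simp add: nprod_scale_field f scale_sum_right mult.commute)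
  qed
qed

definition identity_field :: "int \<Rightarrow> 'w \<Rightarrow> 'w" where
  "identity_field n w = (if n = - 1 then w else 0)"

lemma identity_field_is_field [simp]: "is_field identity_field"
  unfolding is_field_def
proof (intro conjI allI)
  show "\<exists>N. \<forall>n\<ge>N. identity_field n w = 0" for w
    by (rule exI[of _ 0]) (simp add: identity_field_def)
qed (simp_all add: identity_field_def)

text \<open>For \<open>t >= 0\<close> the two expansions of \<open>(x - y)^t\<close> agree, so the
  two halves of the n-th product cancel; this is \<open>gbinomial_delta\<close> with right-hand side
  0.\<close>

lemma nprod_identity_nonneg: "nprod h (int t) identity_field q w = 0"
proof -
  have "\<forall>\<^sub>F K in sequentially. nprod h (int t) identity_field q w = 0"
    using nprod_eventually[OF identity_field_is_field, of h "int t" q w] 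
      eventually_gt_at_top[of "nat (- 1 - q)"] eventually_gt_at_top[of "nat (q + int t + 1)"]
  proof eventually_elim
    case (elim K)
    define x where "x = act h (int t + q + 1) w"
    have idx: "int t - int i = int t + q + 1" if "q + int i = - 1" for i using that by simp
    have "(\<Sum>i<K. sc (signed_choose (int t) i) (act h (int t - int i) (identity_field (q + int i) w)))
        = (\<Sum>i<K. if int i = - 1 - q then sc (signed_choose (int t) i) x else 0)"
      by (intro sum.cong refl) (auto simp: identity_field_def x_def idx algebra_simps)
    also have "\<dots> = (if q \<le> - 1 then sc (signed_choose (int t) (nat (- 1 - q))) x else 0)"
    proof (cases "q \<le> - 1")
      case True
      have "(\<Sum>i<K. if int i = - 1 - q then sc (signed_choose (int t) i) x else 0) =
        (\<Sum>i\<in>{nat (- 1 - q)}. if int i = - 1 - q then sc (signed_choose (int t) i) x else 0)"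
        using elim True by (intro sum.mono_neutral_right) auto
      then show ?thesis using True by simp
    qed (auto intro!: sum.neutral)
    finally have 1: "(\<Sum>i<K. sc (signed_choose (int t) i) (act h (int t - int i) (identity_field (q + int i) w))) = \<dots>" .
    have "(\<Sum>i<K. sc (sign_power (int t) * signed_choose (int t) i) (identity_field (q + int t - int i) (act h (int i) w)))
        = (\<Sum>i<K. if int i = q + int t + 1 then sc (sign_power (int t) * signed_choose (int t) i) x else 0)"
      by (intro sum.cong) (auto simp: identity_field_def x_def algebra_simps)
    also have "\<dots> = (if q + int t + 1 \<ge> 0 then sc (sign_power (int t) * signed_choose (int t) (nat (q + int t + 1))) x else 0)"
    proof (cases "q + int t + 1 \<ge> 0")
      case True
      have "(\<Sum>i<K. if int i = q + int t + 1 then sc (sign_power (int t) * signed_choose (int t) i) x else 0) =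
        (\<Sum>i\<in>{nat (q + int t + 1)}. if int i = q + int t + 1 then sc (sign_power (int t) * signed_choose (int t) i) x else 0)"
        using elim True by (intro sum.mono_neutral_right) auto
      then show ?thesis using True by simp
    qed (auto intro!: sum.neutral)
    finally have 2: "(\<Sum>i<K. sc (sign_power (int t) * signed_choose (int t) i) (identity_field (q + int t - int i) (act h (int i) w))) = \<dots>" .
    have "(if q + int t + 1 \<ge> 0 then signed_choose (int t) (nat (q + int t + 1)) else 0)
      - (if q \<le> - 1 then sign_power (int t) * signed_choose (int t) (nat (- 1 - q)) else 0) = 0"
    proof -
      have "\<not> int t \<le> - 1" by simp
      from if_not_P[OF this] show ?thesis
        using gbinomial_delta[of q "int t"] by (simp only: signed_choose_def sign_power_def mult.assoc)
    qed
    then have c: "(if q \<le> - 1 then signed_choose (int t) (nat (- 1 - q)) else 0) =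
       (if q + int t + 1 \<ge> 0 then sign_power (int t) * signed_choose (int t) (nat (q + int t + 1)) else 0)"
      using sign_power_square[of "int t"] by (auto split: if_splits simp flip: mult.assoc)
    have "nprod h (int t) identity_field q w =
       sc (if q \<le> - 1 then signed_choose (int t) (nat (- 1 - q)) else 0) x
     - sc (if q + int t + 1 \<ge> 0 then sign_power (int t) * signed_choose (int t) (nat (q + int t + 1)) else 0) x"
      unfolding elim(1) 1 2 by simp
    then show ?case unfolding c by simp
  qed
  then show ?thesis by simp
qed

lemma identity_field_local: "local_field identity_field"
  unfolding local_field_def
proof (intro conjI allI)
  show "\<forall>\<^sub>F t in sequentially. nprod h (int t) identity_field = (\<lambda>_ _. 0)" for h
    by (auto simp: fun_eq_iff nprod_identity_nonneg)
  show "act h m (identity_field q w) - identity_field q (act h m w) =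
        Sum_any (\<lambda>t::nat. sc (of_int m gchoose t) (nprod h (int t) identity_field (m + q - int t) w))" for h m q w
    by (simp add: nprod_identity_nonneg) (simp add: identity_field_def)
qed simp

end

lemma sum_rotate:
  "(\<Sum>e\<in>A. \<Sum>s\<in>B. \<Sum>t\<in>C. f e s t) = (\<Sum>t\<in>C. \<Sum>e\<in>A. \<Sum>s\<in>B. f e s t)"
proof -
  have "(\<Sum>e\<in>A. \<Sum>s\<in>B. \<Sum>t\<in>C. f e s t) = (\<Sum>e\<in>A. \<Sum>t\<in>C. \<Sum>s\<in>B. f e s t)"
    by (intro sum.cong refl sum.swap)
  also have "\<dots> = (\<Sum>t\<in>C. \<Sum>e\<in>A. \<Sum>s\<in>B. f e s t)"
    by (rule sum.swap)
  finally show ?thesis .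
qed

section \<open>The state-field correspondence and the Jacobi identity\<close>

text \<open>\<open>Y\<close> is a homomorphism from a module generated by \<open>vac\<close> to the
  fields on \<open>W\<close>, on which modes act by n-th products. Both modules share
  \<open>kap\<close>, that is, the level. Generation by \<open>vac\<close> is expressed as an
  induction rule, because every property of \<open>Y v\<close> is proved along it.\<close>

locale mode_field_map = M: mode_module scM actM kap + W: mode_module scW actW kap
  for scM :: "complex \<Rightarrow> 'm::ab_group_add \<Rightarrow> 'm" and actM :: "'a \<Rightarrow> int \<Rightarrow> 'm \<Rightarrow> 'm"
    and kap :: "'a \<Rightarrow> 'a \<Rightarrow> complex"
    and scW :: "complex \<Rightarrow> 'w::ab_group_add \<Rightarrow> 'w" and actW :: "'a \<Rightarrow> int \<Rightarrow> 'w \<Rightarrow> 'w" +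
  fixes vac :: 'm and Y :: "'m \<Rightarrow> int \<Rightarrow> 'w \<Rightarrow> 'w"
  assumes Y_add: "Y (u + v) q w = Y u q w + Y v q w"
    and Y_scale: "Y (scM c v) q w = scW c (Y v q w)"
    and Y_vac: "Y vac = W.identity_field"
    and Y_act: "Y (actM h n v) = W.nprod h n (Y v)"
    and vac_induct: "P vac \<Longrightarrow> (\<And>h n v. P v \<Longrightarrow> P (actM h n v)) \<Longrightarrow>
      (\<And>u v. P u \<Longrightarrow> P v \<Longrightarrow> P (u + v)) \<Longrightarrow> (\<And>c v. P v \<Longrightarrow> P (scM c v)) \<Longrightarrow> P v"
begin

lemma Y_local: "W.local_field (Y v)"
proof (induction v rule: vac_induct)
  case 1
  then show ?case by (simp add: Y_vac W.identity_field_local)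
next
  case (2 h n v)
  then show ?case by (simp add: Y_act W.nprod_local)
next
  case (3 u v)
  have "Y (u + v) = (\<lambda>q w. Y u q w + Y v q w)" by (intro ext) (rule Y_add)
  then show ?case using W.local_field_plus[OF 3] by simp
next
  case (4 c v)
  have "Y (scM c v) = (\<lambda>q w. scW c (Y v q w))" by (intro ext) (rule Y_scale)
  then show ?case using W.local_field_times[OF 4] by simp
qed

lemma Y_is_field [simp]: "W.is_field (Y v)"
  using Y_local by (rule W.local_field_is_field)

lemma Y_zero [simp]: "Y 0 q w = 0"
  using Y_scale[of 0 0 q w] by simp

lemma Y_minus: "Y (- v) q w = - Y v q w"
  using Y_scale[of "-1" v q w] by simp

lemma Y_diff: "Y (u - v) q w = Y u q w - Y v q w"
  using Y_add[of u "- v"] by (simp add: Y_minus)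

lemma Y_sum: "Y (\<Sum>i\<in>I. f i) q w = (\<Sum>i\<in>I. Y (f i) q w)"
  by (induction I rule: infinite_finite_induct) (simp_all add: Y_add)

lemma Y_commutator:
  assumes "\<And>t. t \<ge> K \<Longrightarrow> actM h (int t) v = 0"
  shows "actW h m (Y v q w) - Y v q (actW h m w) =
    (\<Sum>t<K. scW (of_int m gchoose t) (Y (actM h (int t) v) (m + q - int t) w))"
proof -
  have "W.nprod h (int t) (Y v) = (\<lambda>_ _. 0)" if "t \<ge> K" for t
    using assms[OF that] by (simp add: fun_eq_iff flip: Y_act)
  from W.local_field_commutator[where h = h and m = m and q = q and w = w, OF Y_local this] show ?thesis
    by (simp add: Y_act)
qed

end

section \<open>The two sides of the Jacobi identity\<close>

context complex_vector_space
begin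

text \<open>The left-hand side of the Jacobi identity for two arbitrary fields. For
  \<open>A = act a\<close> and \<open>p = 0\<close> it is the n-th product
  \<open>nprod a r B q w\<close>.\<close>

definition borcherds :: "(int \<Rightarrow> 'w \<Rightarrow> 'w) \<Rightarrow> (int \<Rightarrow> 'w \<Rightarrow> 'w) \<Rightarrow> int \<Rightarrow> int \<Rightarrow> int \<Rightarrow> 'w \<Rightarrow> 'w" where
  "borcherds A B p q r w = Sum_any (\<lambda>i::nat. sc (signed_choose r i)
     (A (p + r - int i) (B (q + int i) w) - sc (sign_power r) (B (q + r - int i) (A (p + int i) w))))"

lemma borcherds_lessThan:
  assumes "is_field A" "is_field B" "\<And>i. i \<ge> K \<Longrightarrow> B (q + int i) w = 0" "\<And>i. i \<ge> K \<Longrightarrow> A (p + int i) w = 0"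
  shows "borcherds A B p q r w = (\<Sum>s<K. sc (signed_choose r s) (A (p + r - int s) (B (q + int s) w)))
     - (\<Sum>s<K. sc (sign_power r * signed_choose r s) (B (q + r - int s) (A (p + int s) w)))"
proof -
  have "borcherds A B p q r w = (\<Sum>i<K. sc (signed_choose r i)
     (A (p + r - int i) (B (q + int i) w) - sc (sign_power r) (B (q + r - int i) (A (p + int i) w))))"
    unfolding borcherds_def by (rule Sum_any_lessThan) (simp add: assms)
  then show ?thesis by (simp add: sum_subtractf scale_right_diff_distrib mult.commute)
qed

end

locale mode_field_pair = V: mode_field_map scM actM kap scM actM vac YM +
  Y: mode_field_map scM actM kap scW actW vac YW
  for scM :: "complex \<Rightarrow> 'm::ab_group_add \<Rightarrow> 'm" and actM :: "'a \<Rightarrow> int \<Rightarrow> 'm \<Rightarrow> 'm"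
    and kap :: "'a \<Rightarrow> 'a \<Rightarrow> complex"
    and scW :: "complex \<Rightarrow> 'w::ab_group_add \<Rightarrow> 'w" and actW :: "'a \<Rightarrow> int \<Rightarrow> 'w \<Rightarrow> 'w"
    and vac :: 'm and YM :: "'m \<Rightarrow> int \<Rightarrow> 'm \<Rightarrow> 'm" and YW :: "'m \<Rightarrow> int \<Rightarrow> 'w \<Rightarrow> 'w"
begin

definition borcherds_right :: "'m \<Rightarrow> 'm \<Rightarrow> int \<Rightarrow> int \<Rightarrow> int \<Rightarrow> 'w \<Rightarrow> 'w" where
  "borcherds_right a b p q r w =
     Sum_any (\<lambda>i::nat. scW (of_int p gchoose i) (YW (YM a (r + int i) b) (p + q - int i) w))"

lemma borcherds_right_lessThan:
  assumes "\<And>j. j \<ge> K \<Longrightarrow> YM a (r + int j) b = 0"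
  shows "borcherds_right a b p q r w =
    (\<Sum>i<K. scW (of_int p gchoose i) (YW (YM a (r + int i) b) (p + q - int i) w))"
  unfolding borcherds_right_def by (rule Sum_any_lessThan) (simp add: assms)

text \<open>Both sides of the Jacobi identity for \<open>(h(n)a, b)\<close> are the same combination of the respective
  sides for \<open>(a, b)\<close> and \<open>(a, h(e)b)\<close>. For the left-hand side this uses the commutator formula of \<open>h\<close>
  with \<open>b\<close>, for the right-hand side that \<open>Y(h(n)a)\<close> is an \<open>n\<close>-th product.\<close>

lemma borcherds_iterate_left:
  defines "BL \<equiv> Y.W.borcherds"
  shows "\<forall>\<^sub>F K in sequentially. BL (YW (actM h n a)) (YW b) p q r w =
     (\<Sum>e<K. scW (signed_choose n e) (actW h (n - int e) (BL (YW a) (YW b) (p + int e) q r w)))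
   - (\<Sum>e<K. scW (sign_power n * signed_choose n e) (BL (YW a) (YW b) (p + n - int e) q r (actW h (int e) w)))
   - (\<Sum>e<K. scW (sign_power n * signed_choose n e) (BL (YW a) (YW (actM h (int e) b)) p q (n + r - int e) w))"
proof -
  let ?A = "YW a" and ?B = "YW b" and ?C = "YW (actM h n a)" and ?hb = "\<lambda>t. YW (actM h (int t) b)"
  have fin: "\<forall>\<^sub>F s in sequentially. ?B (q + int s) w = 0" "\<forall>\<^sub>F s in sequentially. actW h (int s) w = 0"
    "\<forall>\<^sub>F s in sequentially. actM h (int s) b = 0"
    using Y.W.is_field_eventually_zero[OF Y.Y_is_field, of b q w] Y.W.is_field_eventually_zero[OF Y.W.act_is_field, of h 0 w]
      V.M.is_field_eventually_zero[OF V.M.act_is_field, of h 0 b] by simp_all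
  have fin': "\<forall>\<^sub>F t in sequentially. \<forall>i. ?hb t (c t i) v = 0" for c :: "nat \<Rightarrow> nat \<Rightarrow> int" and v
    using fin(3) by eventually_elim simp
  have "\<forall>\<^sub>F K in sequentially.
      (\<forall>i\<ge>K. ?B (q + int i) w = 0) \<and> (\<forall>i\<ge>K. ?A (p + int i) w = 0) \<and>
      (\<forall>i\<ge>K. actW h (0 + int i) w = 0) \<and>
      (\<forall>i\<ge>K. \<forall>s. ?A (p + r - int s + int i) (?B (q + int s) w) = 0) \<and>
      (\<forall>i\<ge>K. \<forall>s. actW h (0 + int i) (?B (q + int s) w) = 0) \<and>
      (\<forall>i\<ge>K. ?C (p + int i) w = 0) \<and>
      (\<forall>i\<ge>K. \<forall>e. ?B (q + int i) (actW h (int e) w) = 0) \<and>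
      (\<forall>i\<ge>K. \<forall>e. ?A (p + n - int e + int i) (actW h (int e) w) = 0) \<and>
      (\<forall>t\<ge>K. actM h (0 + int t) b = 0) \<and>
      (\<forall>i\<ge>K. \<forall>t. ?hb t (q - int t + int i) w = 0) \<and>
      (\<forall>i\<ge>K. \<forall>t. ?hb t (q + int i) w = 0)"
    by (intro eventually_conj Y.W.is_field_eventually V.M.is_field_eventually Y.W.is_field_eventually_uniform
        eventually_uniform fin fin') simp_all
  then show ?thesis
  proof eventually_elim
    case (elim K)
    then have
    K: "\<And>i. i \<ge> K \<Longrightarrow> ?B (q + int i) w = 0" "\<And>i. i \<ge> K \<Longrightarrow> ?A (p + int i) w = 0"
       "\<And>i. i \<ge> K \<Longrightarrow> actW h (int i) w = 0"
       "\<And>i s. i \<ge> K \<Longrightarrow> ?A (p + r - int s + int i) (?B (q + int s) w) = 0"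
       "\<And>i s. i \<ge> K \<Longrightarrow> actW h (int i) (?B (q + int s) w) = 0"
       "\<And>i. i \<ge> K \<Longrightarrow> ?C (p + int i) w = 0"
       "\<And>i e. i \<ge> K \<Longrightarrow> ?B (q + int i) (actW h (int e) w) = 0"
       "\<And>i e. i \<ge> K \<Longrightarrow> ?A (p + n - int e + int i) (actW h (int e) w) = 0"
       "\<And>t. t \<ge> K \<Longrightarrow> actM h (int t) b = 0"
       "\<And>i t. i \<ge> K \<Longrightarrow> ?hb t (q - int t + int i) w = 0"
       "\<And>i t. i \<ge> K \<Longrightarrow> ?hb t (q + int i) w = 0"
      by (auto simp only: add_0)
    have K2: "?A (p + int s + int i) w = 0" "?A (p + int i + int s) w = 0" if "i \<ge> K" for i s
      using K(2)[of "s + i"] K(2)[of "i + s"] that by (simp_all add: add.assoc)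
    \<comment> \<open>\<open>T1\<close> to \<open>T4\<close> are the terms of the left-hand side.
      \<open>U2\<close> and \<open>U3\<close> arise from \<open>T2\<close> and \<open>T3\<close> by
      moving the mode of \<open>h\<close> across \<open>b\<close>, and are what the first two sums
      on the right contain; so \<open>T2 - U2\<close> and \<open>U3 - T3\<close> must produce the
      third sum.\<close>
    define T1 where "T1 s e = scW (signed_choose n e * signed_choose r s) (actW h (n - int e) (?A (p + r - int s + int e) (?B (q + int s) w)))" for s e
    define T2 where "T2 s e = scW (sign_power n * (signed_choose n e * signed_choose r s)) (?A (p + r - int s + n - int e) (actW h (int e) (?B (q + int s) w)))" for s e
    define U2 where "U2 s e = scW (sign_power n * (signed_choose n e * signed_choose r s)) (?A (p + r - int s + n - int e) (?B (q + int s) (actW h (int e) w)))" for s e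
    define T3 where "T3 s e = scW (sign_power r * (signed_choose n e * signed_choose r s)) (?B (q + r - int s) (actW h (n - int e) (?A (p + int s + int e) w)))" for s e
    define U3 where "U3 s e = scW (sign_power r * (signed_choose n e * signed_choose r s)) (actW h (n - int e) (?B (q + r - int s) (?A (p + int s + int e) w)))" for s e
    define T4 where "T4 s e = scW (sign_power n * sign_power r * (signed_choose n e * signed_choose r s)) (?B (q + r - int s) (?A (p + int s + n - int e) (actW h (int e) w)))" for s e
    have C1: "?C (p + r - int s) (?B (q + int s) w) =
      (\<Sum>e<K. scW (signed_choose n e) (actW h (n - int e) (?A (p + r - int s + int e) (?B (q + int s) w))))
     - (\<Sum>e<K. scW (sign_power n * signed_choose n e) (?A (p + r - int s + n - int e) (actW h (int e) (?B (q + int s) w))))" for s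
      unfolding Y.Y_act by (rule Y.W.nprod_lessThan) (simp_all add: K)
    have C2: "?C (p + int s) w =
      (\<Sum>e<K. scW (signed_choose n e) (actW h (n - int e) (?A (p + int s + int e) w)))
     - (\<Sum>e<K. scW (sign_power n * signed_choose n e) (?A (p + int s + n - int e) (actW h (int e) w)))" for s
      unfolding Y.Y_act by (rule Y.W.nprod_lessThan) (simp_all add: K K2)
    have L0: "BL ?C ?B p q r w = (\<Sum>s<K. scW (signed_choose r s) (?C (p + r - int s) (?B (q + int s) w)))
     - (\<Sum>s<K. scW (sign_power r * signed_choose r s) (?B (q + r - int s) (?C (p + int s) w)))"
      unfolding BL_def by (rule Y.W.borcherds_lessThan) (simp_all add: K)
    have L: "BL ?C ?B p q r w = (\<Sum>s<K. \<Sum>e<K. T1 s e) - (\<Sum>s<K. \<Sum>e<K. T2 s e)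
       - (\<Sum>s<K. \<Sum>e<K. T3 s e) + (\<Sum>s<K. \<Sum>e<K. T4 s e)"
      unfolding L0 C1 C2 T1_def T2_def T3_def T4_def
      by (simp add: Y.W.is_field_diff Y.W.is_field_sum Y.W.is_field_scale Y.W.scale_right_diff_distrib
          Y.W.scale_sum_right sum_subtractf mult_ac)
    have R1: "BL ?A ?B (p + int e) q r w = (\<Sum>s<K. scW (signed_choose r s) (?A (p + r - int s + int e) (?B (q + int s) w)))
     - (\<Sum>s<K. scW (sign_power r * signed_choose r s) (?B (q + r - int s) (?A (p + int s + int e) w)))" for e
      unfolding BL_def by (subst Y.W.borcherds_lessThan[where K = K]) (simp_all add: K K2, simp add: algebra_simps)
    have R2: "BL ?A ?B (p + n - int e) q r (actW h (int e) w) =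
       (\<Sum>s<K. scW (signed_choose r s) (?A (p + r - int s + n - int e) (?B (q + int s) (actW h (int e) w))))
     - (\<Sum>s<K. scW (sign_power r * signed_choose r s) (?B (q + r - int s) (?A (p + int s + n - int e) (actW h (int e) w))))" for e
      unfolding BL_def by (subst Y.W.borcherds_lessThan[where K = K]) (simp_all add: K, simp add: algebra_simps)
    have R3: "BL ?A (?hb e) p q (n + r - int e) w =
       (\<Sum>s<K. scW (signed_choose (n + r - int e) s) (?A (p + (n + r - int e) - int s) (?hb e (q + int s) w)))
     - (\<Sum>s<K. scW (sign_power (n + r - int e) * signed_choose (n + r - int e) s) (?hb e (q + (n + r - int e) - int s) (?A (p + int s) w)))" for e
      unfolding BL_def by (rule Y.W.borcherds_lessThan) (simp_all add: K)
    have S1: "(\<Sum>e<K. scW (signed_choose n e) (actW h (n - int e) (BL ?A ?B (p + int e) q r w)))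
        = (\<Sum>e<K. \<Sum>s<K. T1 s e) - (\<Sum>e<K. \<Sum>s<K. U3 s e)"
      unfolding R1 T1_def U3_def
      by (simp add: Y.W.is_field_diff Y.W.is_field_sum Y.W.is_field_scale Y.W.scale_right_diff_distrib
          Y.W.scale_sum_right sum_subtractf mult_ac)
    have S2: "(\<Sum>e<K. scW (sign_power n * signed_choose n e) (BL ?A ?B (p + n - int e) q r (actW h (int e) w)))
        = (\<Sum>e<K. \<Sum>s<K. U2 s e) - (\<Sum>e<K. \<Sum>s<K. T4 s e)"
      unfolding R2 U2_def T4_def
      by (simp add: Y.W.scale_right_diff_distrib Y.W.scale_sum_right sum_subtractf mult_ac)
    have c: "actW h m (?B x v) - ?B x (actW h m v) =
        (\<Sum>t<K. scW (of_int m gchoose t) (?hb t (m + x - int t) v))" for m x v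
      by (rule Y.Y_commutator) (rule K(9))
    \<comment> \<open>For fixed \<open>t\<close> the commutator terms depend on \<open>e\<close> and
      \<open>s\<close> only through \<open>e + s\<close>, which makes the Vandermonde sums
      applicable. \<open>H\<close> has the same role for \<open>U3 - T3\<close>.\<close>
    define G where "G t x = ?A (p + (n + r) - int x) (?hb t (q - int t + int x) w)" for t x
    have G0: "G t x = 0" if "x \<ge> K" for t x
      using that by (simp add: G_def K)
    define H where "H t x = ?hb t (q + (n + r - int t) - int x) (?A (p + int x) w)" for t x
    have H0: "H t x = 0" if "x \<ge> K" for t x
      using that by (simp add: H_def K)
    have "(\<Sum>e<K. \<Sum>s<K. T2 s e) - (\<Sum>e<K. \<Sum>s<K. U2 s e) =
       scW (sign_power n) (\<Sum>e<K. \<Sum>s<K. \<Sum>t<K. scW ((of_nat e gchoose t) * (signed_choose n e * signed_choose r s)) (G t (e + s)))"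
    proof -
      have "T2 s e - U2 s e = scW (sign_power n) (\<Sum>t<K. scW ((of_nat e gchoose t) * (signed_choose n e * signed_choose r s)) (G t (e + s)))" for s e
      proof -
        have "T2 s e - U2 s e = scW (sign_power n * (signed_choose n e * signed_choose r s)) (?A (p + r - int s + n - int e)
            (actW h (int e) (?B (q + int s) w) - ?B (q + int s) (actW h (int e) w)))"
          by (simp add: T2_def U2_def Y.W.is_field_diff Y.W.scale_right_diff_distrib)
        also have "\<dots> = (\<Sum>t<K. scW (sign_power n * (signed_choose n e * signed_choose r s) * (of_nat e gchoose t)) (?A (p + r - int s + n - int e)
            (?hb t (int e + (q + int s) - int t) w)))"
          unfolding c by (simp add: Y.W.is_field_sum Y.W.is_field_scale Y.W.scale_sum_right)
        also have "\<dots> = (\<Sum>t<K. scW (sign_power n * (signed_choose n e * signed_choose r s) * (of_nat e gchoose t)) (G t (e + s)))"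
          unfolding G_def by (simp add: algebra_simps)
        finally show ?thesis by (simp add: Y.W.scale_sum_right mult_ac)
      qed
      then show ?thesis by (simp add: Y.W.scale_sum_right flip: sum_subtractf)
    qed
    also have "\<dots> = scW (sign_power n) (\<Sum>t<K. \<Sum>e<K. \<Sum>s<K. scW ((of_nat e gchoose t) * (signed_choose n e * signed_choose r s)) (G t (e + s)))"
      by (subst sum_rotate) (rule refl)
    also have "\<dots> = scW (sign_power n) (\<Sum>t<K. \<Sum>s<K. scW (signed_choose n t * signed_choose (n + r - int t) s) (G t (s + t)))"
      by (intro arg_cong[where f = "scW (sign_power n)"] sum.cong refl Y.W.vandermonde_sum_mixed) (rule G0)
    finally have E1: "(\<Sum>e<K. \<Sum>s<K. T2 s e) - (\<Sum>e<K. \<Sum>s<K. U2 s e) = \<dots>" .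
    have "(\<Sum>e<K. \<Sum>s<K. U3 s e) - (\<Sum>e<K. \<Sum>s<K. T3 s e) =
       scW (sign_power r) (\<Sum>e<K. \<Sum>s<K. \<Sum>t<K. scW (of_int n gchoose t) (scW (signed_choose (n - int t) e * signed_choose r s) (H t (e + s))))"
    proof -
      have "U3 s e - T3 s e = scW (sign_power r) (\<Sum>t<K. scW (of_int n gchoose t) (scW (signed_choose (n - int t) e * signed_choose r s) (H t (e + s))))" for s e
      proof -
        have b: "signed_choose n e * (of_int (n - int e) gchoose t) = (of_int n gchoose t) * signed_choose (n - int t) e" for t
          using gbinomial_multinomial_swap[of "of_int n" e t] by (simp add: signed_choose_def)
        have "U3 s e - T3 s e = scW (sign_power r * (signed_choose n e * signed_choose r s)) 
            (actW h (n - int e) (?B (q + r - int s) (?A (p + int s + int e) w)) - ?B (q + r - int s) (actW h (n - int e) (?A (p + int s + int e) w)))"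
          by (simp add: T3_def U3_def Y.W.scale_right_diff_distrib)
        also have "\<dots> = (\<Sum>t<K. scW (sign_power r * signed_choose r s * (signed_choose n e * (of_int (n - int e) gchoose t)))
            (?hb t (n - int e + (q + r - int s) - int t) (?A (p + int s + int e) w)))"
          unfolding c by (simp add: Y.W.scale_sum_right mult_ac)
        also have "\<dots> = (\<Sum>t<K. scW (sign_power r * signed_choose r s * (signed_choose n e * (of_int (n - int e) gchoose t))) (H t (e + s)))"
          unfolding H_def by (simp add: algebra_simps)
        finally show ?thesis unfolding b by (simp add: Y.W.scale_sum_right mult_ac)
      qed
      then show ?thesis by (simp add: Y.W.scale_sum_right flip: sum_subtractf)
    qed
    also have "\<dots> = scW (sign_power r) (\<Sum>t<K. \<Sum>e<K. \<Sum>s<K. scW (of_int n gchoose t) (scW (signed_choose (n - int t) e * signed_choose r s) (H t (e + s))))"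
      by (subst sum_rotate) (rule refl)
    also have "\<dots> = scW (sign_power r) (\<Sum>t<K. scW (of_int n gchoose t) (\<Sum>x<K. scW (signed_choose (n - int t + r) x) (H t x)))"
      by (simp only: flip: Y.W.scale_sum_right)
         (intro arg_cong[where f = "scW (sign_power r)"] arg_cong2[where f = scW] sum.cong refl
           Y.W.vandermonde_sum_signed, rule H0)
    finally have E2: "(\<Sum>e<K. \<Sum>s<K. U3 s e) - (\<Sum>e<K. \<Sum>s<K. T3 s e) = \<dots>" .
    have S3: "(\<Sum>e<K. scW (sign_power n * signed_choose n e) (BL ?A (?hb e) p q (n + r - int e) w)) =
        scW (sign_power n) (\<Sum>t<K. \<Sum>s<K. scW (signed_choose n t * signed_choose (n + r - int t) s) (G t (s + t)))
      - scW (sign_power r) (\<Sum>t<K. scW (of_int n gchoose t) (\<Sum>x<K. scW (signed_choose (n - int t + r) x) (H t x)))"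
    proof -
      \<comment> \<open>The signs \<open>(-1)^n\<close> and \<open>(-1)^e\<close> occur twice each
        and cancel, which leaves \<open>(-1)^r\<close>.\<close>
      have b: "sign_power n * signed_choose n e * (sign_power (n + r - int e) * z) = sign_power r * (of_int n gchoose e) * z" for e z
      proof -
        have "sign_power n * signed_choose n e * (sign_power (n + r - int e) * z) =
          (sign_power n * sign_power n) * ((- 1) ^ e * (- 1) ^ e) * (sign_power r * (of_int n gchoose e) * z)"
          by (simp only: signed_choose_def sign_power_diff_nat sign_power_add mult_ac)
        then show ?thesis by (simp flip: power_mult_distrib)
      qed
      have g: "?A (p + (n + r - int e) - int s) (?hb e (q + int s) w) = G e (s + e)" for e s
        by (simp add: G_def algebra_simps)
      have i: "n + r - int e = n - int e + r" for e by simp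
      show ?thesis unfolding R3 g H_def[symmetric]
        by (simp add: Y.W.scale_right_diff_distrib Y.W.scale_sum_right sum_subtractf b)
           (simp add: i mult_ac)
    qed
    have "BL ?C ?B p q r w = (\<Sum>e<K. \<Sum>s<K. T1 s e) - (\<Sum>e<K. \<Sum>s<K. T2 s e)
       - (\<Sum>e<K. \<Sum>s<K. T3 s e) + (\<Sum>e<K. \<Sum>s<K. T4 s e)"
      unfolding L by (simp only: sum.swap[of T1] sum.swap[of T2] sum.swap[of T3] sum.swap[of T4])
    then show ?case unfolding S1 S2 S3 E1[symmetric] E2[symmetric] by simp
  qed
qed

text \<open>The n-th product is used twice: in \<open>M\<close> to expand the products of
  \<open>h(n) a\<close> with \<open>b\<close>, and in \<open>W\<close> to expand the field of a
  vector \<open>h(n - i) c\<close>. The terms in which \<open>h\<close> meets \<open>b\<close>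
  directly form the third sum; in the first two sums the upper indices \<open>p + e\<close> and
  \<open>p + n - e\<close> are split by Vandermonde into \<open>p\<close> and the rest.\<close>

lemma borcherds_iterate_right:
  shows "\<forall>\<^sub>F K in sequentially. borcherds_right (actM h n a) b p q r w =
     (\<Sum>e<K. scW (signed_choose n e) (actW h (n - int e) (borcherds_right a b (p + int e) q r w)))
   - (\<Sum>e<K. scW (sign_power n * signed_choose n e) (borcherds_right a b (p + n - int e) q r (actW h (int e) w)))
   - (\<Sum>e<K. scW (sign_power n * signed_choose n e) (borcherds_right a (actM h (int e) b) p q (n + r - int e) w))"
proof -
  have fin: "\<forall>\<^sub>F s in sequentially. actM h (int s) b = 0" "\<forall>\<^sub>F j in sequentially. YM a (r + int j) b = 0"
    using V.M.is_field_eventually_zero[OF V.M.act_is_field, of h 0 b] V.M.is_field_eventually_zero[OF V.Y_is_field, of a r b]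
    by simp_all
  have fin': "\<forall>\<^sub>F j in sequentially. \<forall>i. YW (YM a (r + int j) b) (c j i) v = 0"
    for c :: "nat \<Rightarrow> nat \<Rightarrow> int" and v
    using fin(2) by eventually_elim simp
  have "\<forall>\<^sub>F K in sequentially.
      (\<forall>i\<ge>K. actW h (0 + int i) w = 0) \<and> (\<forall>t\<ge>K. actM h (0 + int t) b = 0) \<and>
      (\<forall>j\<ge>K. YM a (r + int j) b = 0) \<and> (\<forall>j\<ge>K. YM (actM h n a) (r + int j) b = 0) \<and>
      (\<forall>i\<ge>K. \<forall>j. YW (YM a (r + int j) b) (p + q - int j + int i) w = 0) \<and>
      (\<forall>j\<ge>K. \<forall>i. YM a (r + n - int i + int j) (actM h (int i) b) = 0)"
    by (intro eventually_conj Y.W.is_field_eventually V.M.is_field_eventually V.M.is_field_eventually_uniform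
        eventually_uniform fin fin') simp_all
  then show ?thesis
  proof eventually_elim
    case (elim K)
    then have
    K: "\<And>i. i \<ge> K \<Longrightarrow> actW h (int i) w = 0" "\<And>i. i \<ge> K \<Longrightarrow> actM h (int i) b = 0"
       "\<And>j. j \<ge> K \<Longrightarrow> YM a (r + int j) b = 0" "\<And>j. j \<ge> K \<Longrightarrow> YM (actM h n a) (r + int j) b = 0"
       "\<And>i j. i \<ge> K \<Longrightarrow> YW (YM a (r + int j) b) (p + q - int j + int i) w = 0"
       "\<And>i j. j \<ge> K \<Longrightarrow> YM a (r + n - int i + int j) (actM h (int i) b) = 0"
      by (auto simp only: add_0)
    define c where "c J = YM a (r + int J) b" for J
    have c0: "c J = 0" if "J \<ge> K" for J using K(3)[OF that] by (simp add: c_def)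
    have c1: "YW (c J) (p + q - int J + int i) w = 0" if "i \<ge> K" for J i
      using K(5)[OF that] by (simp add: c_def)
    have Y1: "YM (actM h n a) (r + int j) b = (\<Sum>i<K. scM (signed_choose n i) (actM h (n - int i) (c (i + j))))
        - (\<Sum>i<K. scM (sign_power n * signed_choose n i) (YM a (r + n - int i + int j) (actM h (int i) b)))" for j
      unfolding V.Y_act c_def
      by (subst V.M.nprod_lessThan[where K = K]) (use K(3)[of "j + _"] K(2) in \<open>auto simp: algebra_simps\<close>)
    have YA: "YW (actM h (n - int i) (c (i + j))) (p + q - int j) w =
        (\<Sum>k<K. scW (signed_choose (n - int i) k) (actW h (n - int (i + k)) (YW (c (i + j)) (p + q + int (i + k) - int (i + j)) w)))
      - (\<Sum>k<K. scW (sign_power (n - int i) * signed_choose (n - int i) k) (YW (c (i + j)) (p + q + n - int k - int (i + j)) (actW h (int k) w)))" for i j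
    proof -
      have "YW (c (i + j)) (p + q - int j + int k) w = 0" if "k \<ge> K" for k
        using c1[of "i + k" "i + j"] that by (simp add: algebra_simps)
      then show ?thesis
        unfolding Y.Y_act by (subst Y.W.nprod_lessThan[where K = K]) (simp_all add: K(1), simp add: algebra_simps)
    qed
    define E where "E e J = actW h (n - int e) (YW (c J) (p + q + int e - int J) w)" for e J
    have E0: "E e J = 0" if "e \<ge> K \<or> J \<ge> K" for e J
    proof (cases "J \<ge> K")
      case False
      then show ?thesis using that c1[of e J] by (simp add: E_def algebra_simps)
    qed (simp add: E_def c0)
    define F where "F k J = YW (c J) (p + q + n - int k - int J) (actW h (int k) w)" for k J
    have F0: "F k J = 0" if "J \<ge> K" for k J using that by (simp add: F_def c0)
    let ?third = "\<Sum>e<K. scW (sign_power n * signed_choose n e) (borcherds_right a (actM h (int e) b) p q (n + r - int e) w)"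
    have third: "?third = (\<Sum>j<K. scW (of_int p gchoose j)
       (\<Sum>i<K. scW (sign_power n * signed_choose n i) (YW (YM a (r + n - int i + int j) (actM h (int i) b)) (p + q - int j) w)))"
    proof -
      have "borcherds_right a (actM h (int e) b) p q (n + r - int e) w =
        (\<Sum>j<K. scW (of_int p gchoose j) (YW (YM a (r + n - int e + int j) (actM h (int e) b)) (p + q - int j) w))" for e
        by (subst borcherds_right_lessThan[where K = K]) (use K(6)[of _ e] in \<open>auto simp: algebra_simps\<close>)
      then have "?third = (\<Sum>e<K. \<Sum>j<K. scW (of_int p gchoose j) (scW (sign_power n * signed_choose n e)
          (YW (YM a (r + n - int e + int j) (actM h (int e) b)) (p + q - int j) w)))"
        by (simp add: Y.W.scale_sum_right mult_ac)
      then show ?thesis by (subst (asm) sum.swap) (simp only: Y.W.scale_sum_right)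
    qed
    have first: "(\<Sum>e<K. scW (signed_choose n e) (actW h (n - int e) (borcherds_right a b (p + int e) q r w))) =
       (\<Sum>j<K. \<Sum>i<K. \<Sum>k<K. scW ((of_int p gchoose j) * (signed_choose n i * signed_choose (n - int i) k)) (E (i + k) (i + j)))"
    proof -
      have "actW h (n - int e) (borcherds_right a b (p + int e) q r w) =
         (\<Sum>J<K. scW ((of_nat e + of_int p) gchoose J) (E e J))" for e
        by (subst borcherds_right_lessThan[where K = K])
          (simp_all add: K E_def Y.W.is_field_sum Y.W.is_field_scale c_def algebra_simps)
      also have "(\<Sum>J<K. scW ((of_nat e + of_int p) gchoose J) (E e J)) =
         (\<Sum>i<K. \<Sum>j<K. scW ((of_nat e gchoose i) * (of_int p gchoose j)) (E e (i + j)))" for e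
        by (rule Y.W.vandermonde_sum[symmetric]) (simp add: E0)
      finally have "(\<Sum>e<K. scW (signed_choose n e) (actW h (n - int e) (borcherds_right a b (p + int e) q r w))) =
         (\<Sum>e<K. \<Sum>i<K. \<Sum>j<K. scW (signed_choose n e * ((of_nat e gchoose i) * (of_int p gchoose j))) (E e (i + j)))"
        by (simp add: Y.W.scale_sum_right)
      also have "\<dots> = (\<Sum>i<K. \<Sum>j<K. \<Sum>e<K. scW (signed_choose n e * ((of_nat e gchoose i) * (of_int p gchoose j))) (E e (i + j)))"
        by (rule sum_rotate[symmetric])
      also have "\<dots> = (\<Sum>i<K. \<Sum>j<K. \<Sum>k<K. scW ((of_int p gchoose j) * (signed_choose n i * signed_choose (n - int i) k)) (E (i + k) (i + j)))"
      proof (rule sum.cong[OF refl], rule sum.cong[OF refl])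
        fix i j
        have b: "signed_choose n (k + i) * (of_nat (k + i) gchoose i) = signed_choose n i * signed_choose (n - int i) k" for k
          using gbinomial_multinomial[of "of_int n" i k] gbinomial_multinomial[of "of_int n" k i]
            gbinomial_multinomial_swap[of "of_int n" i k]
          by (simp add: signed_choose_def power_add mult_ac)
        have "(\<Sum>e<K. scW (signed_choose n e * ((of_nat e gchoose i) * (of_int p gchoose j))) (E e (i + j))) =
           (\<Sum>k<K. scW (signed_choose n (k + i) * ((of_nat (k + i) gchoose i) * (of_int p gchoose j))) (E (k + i) (i + j)))"
          by (rule sum_shift_truncated) (simp_all add: gbinomial_nat_eq_0 E0)
        also have "\<dots> = (\<Sum>k<K. scW ((of_int p gchoose j) * (signed_choose n (k + i) * (of_nat (k + i) gchoose i))) (E (k + i) (i + j)))"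
          by (simp only: mult_ac)
        finally show "(\<Sum>e<K. scW (signed_choose n e * ((of_nat e gchoose i) * (of_int p gchoose j))) (E e (i + j))) =
           (\<Sum>k<K. scW ((of_int p gchoose j) * (signed_choose n i * signed_choose (n - int i) k)) (E (i + k) (i + j)))"
          unfolding b by (simp add: add.commute)
      qed
      also have "\<dots> = (\<Sum>j<K. \<Sum>i<K. \<Sum>k<K. scW ((of_int p gchoose j) * (signed_choose n i * signed_choose (n - int i) k)) (E (i + k) (i + j)))"
        by (rule sum.swap)
      finally show ?thesis .
    qed
    have second: "(\<Sum>e<K. scW (sign_power n * signed_choose n e) (borcherds_right a b (p + n - int e) q r (actW h (int e) w))) =
       (\<Sum>j<K. \<Sum>i<K. \<Sum>k<K. scW ((of_int p gchoose j) * (signed_choose n i * (sign_power (n - int i) * signed_choose (n - int i) k))) (F k (i + j)))"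
    proof -
      have "borcherds_right a b (p + n - int e) q r (actW h (int e) w) =
         (\<Sum>J<K. scW ((of_int (n - int e) + of_int p) gchoose J) (F e J))" for e
        by (subst borcherds_right_lessThan[where K = K])
          (simp_all add: K F_def c_def algebra_simps)
      also have "(\<Sum>J<K. scW ((of_int (n - int e) + of_int p) gchoose J) (F e J)) =
         (\<Sum>i<K. \<Sum>j<K. scW ((of_int (n - int e) gchoose i) * (of_int p gchoose j)) (F e (i + j)))" for e
        by (rule Y.W.vandermonde_sum[symmetric]) (simp add: F0)
      finally have "(\<Sum>e<K. scW (sign_power n * signed_choose n e) (borcherds_right a b (p + n - int e) q r (actW h (int e) w))) =
         (\<Sum>e<K. \<Sum>i<K. \<Sum>j<K. scW (sign_power n * signed_choose n e * ((of_int (n - int e) gchoose i) * (of_int p gchoose j))) (F e (i + j)))"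
        by (simp add: Y.W.scale_sum_right)
      also have "\<dots> = (\<Sum>i<K. \<Sum>j<K. \<Sum>e<K. scW (sign_power n * signed_choose n e * ((of_int (n - int e) gchoose i) * (of_int p gchoose j))) (F e (i + j)))"
        by (rule sum_rotate[symmetric])
      also have "\<dots> = (\<Sum>i<K. \<Sum>j<K. \<Sum>k<K. scW ((of_int p gchoose j) * (signed_choose n i * (sign_power (n - int i) * signed_choose (n - int i) k))) (F k (i + j)))"
      proof (intro sum.cong refl arg_cong2[where f = scW])
        fix i j e
        have "signed_choose n i * (sign_power (n - int i) * signed_choose (n - int i) e) =
           ((- 1) ^ i * (- 1) ^ i) * sign_power n * (- 1) ^ e * ((of_int n gchoose i) * (of_int (n - int i) gchoose e))"
          by (simp only: signed_choose_def sign_power_diff_nat mult_ac)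
        also have "(of_int n gchoose i) * (of_int (n - int i) gchoose e) = (of_int n gchoose e) * (of_int (n - int e) gchoose i :: complex)"
          using gbinomial_multinomial_swap[of "of_int n" i e] by simp
        finally show "sign_power n * signed_choose n e * ((of_int (n - int e) gchoose i) * (of_int p gchoose j)) =
           (of_int p gchoose j) * (signed_choose n i * (sign_power (n - int i) * signed_choose (n - int i) e))"
          by (simp add: signed_choose_def mult_ac flip: power_mult_distrib)
      qed
      also have "\<dots> = (\<Sum>j<K. \<Sum>i<K. \<Sum>k<K. scW ((of_int p gchoose j) * (signed_choose n i * (sign_power (n - int i) * signed_choose (n - int i) k))) (F k (i + j)))"
        by (rule sum.swap)
      finally show ?thesis .
    qed
    have "borcherds_right (actM h n a) b p q r w =
       (\<Sum>j<K. scW (of_int p gchoose j) (YW (YM (actM h n a) (r + int j) b) (p + q - int j) w))"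
      by (rule borcherds_right_lessThan) (rule K(4))
    also have "\<dots> = (\<Sum>j<K. scW (of_int p gchoose j) (\<Sum>i<K. scW (signed_choose n i) (YW (actM h (n - int i) (c (i + j))) (p + q - int j) w)))
        - (\<Sum>j<K. scW (of_int p gchoose j) (\<Sum>i<K. scW (sign_power n * signed_choose n i) (YW (YM a (r + n - int i + int j) (actM h (int i) b)) (p + q - int j) w)))"
      unfolding Y1 by (simp only: Y.Y_diff Y.Y_sum Y.Y_scale Y.W.scale_right_diff_distrib sum_subtractf)
    also have "(\<Sum>j<K. scW (of_int p gchoose j) (\<Sum>i<K. scW (signed_choose n i) (YW (actM h (n - int i) (c (i + j))) (p + q - int j) w)))
       = (\<Sum>j<K. \<Sum>i<K. \<Sum>k<K. scW ((of_int p gchoose j) * (signed_choose n i * signed_choose (n - int i) k)) (E (i + k) (i + j)))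
       - (\<Sum>j<K. \<Sum>i<K. \<Sum>k<K. scW ((of_int p gchoose j) * (signed_choose n i * (sign_power (n - int i) * signed_choose (n - int i) k))) (F k (i + j)))"
      unfolding YA E_def F_def
      by (simp only: Y.W.scale_right_diff_distrib Y.W.scale_sum_right sum_subtractf Y.W.scale_scale mult.assoc)
    finally show ?case unfolding first second third .
  qed
qed

text \<open>Induction on \<open>a\<close>. The hypothesis is needed for all \<open>b\<close>,
  \<open>p\<close>, \<open>q\<close>, \<open>r\<close>, \<open>w\<close>, since the recursion passes
  from \<open>b\<close> to \<open>h(e) b\<close>, from \<open>w\<close> to \<open>h(e) w\<close>,
  and shifts the exponents.\<close>

theorem borcherds_identity:
  "Y.W.borcherds (YW a) (YW b) p q r w = borcherds_right a b p q r w"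
proof (induction a arbitrary: b p q r w rule: V.vac_induct)
  case 1
  let ?B = "YW b"
  have "\<forall>\<^sub>F K in sequentially. K > nat (p + r + 1) \<and> K > nat (- 1 - p) \<and> K > nat (- 1 - r) \<and>
     (\<forall>i\<ge>K. ?B (q + int i) w = 0)"
    by (intro eventually_conj Y.W.is_field_eventually) (simp_all add: eventually_gt_at_top)
  from eventually_happens'[OF sequentially_bot this] obtain K where
    K: "K > nat (p + r + 1)" "K > nat (- 1 - p)" "K > nat (- 1 - r)" "\<And>i. i \<ge> K \<Longrightarrow> ?B (q + int i) w = 0"
    by auto
  \<comment> \<open>Each of the three sums yields a multiple of this one vector, so the vacuum case
    is the scalar identity \<open>gbinomial_delta\<close>.\<close>
  define x where "x = ?B (p + q + r + 1) w"
  have pick: "(\<Sum>i<K. if int i = k then f i else 0) = (if k \<ge> 0 then f (nat k) else 0)"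
    if "nat k < K" for f :: "nat \<Rightarrow> 'w" and k
  proof (cases "k \<ge> 0")
    case True
    have "(\<Sum>i<K. if int i = k then f i else 0) = (\<Sum>i\<in>{nat k}. if int i = k then f i else 0)"
      using that True by (intro sum.mono_neutral_right) auto
    then show ?thesis using True by simp
  qed (auto intro!: sum.neutral)
  have Z: "Y.W.identity_field (p + int i) w = 0" if "i \<ge> K" for i
  proof -
    have "p + int i \<noteq> - 1" using that K(2) by linarith
    then show ?thesis by (simp add: Y.W.identity_field_def)
  qed
  have L1: "(\<Sum>s<K. scW (signed_choose r s) (Y.W.identity_field (p + r - int s) (?B (q + int s) w)))
    = (\<Sum>s<K. if int s = p + r + 1 then scW (signed_choose r s) x else 0)"
  proof (intro sum.cong refl)
    fix s
    have "q + int s = p + q + r + 1" if "int s = p + r + 1" using that by simp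
    moreover have "p + r - int s = - 1 \<longleftrightarrow> int s = p + r + 1" by auto
    ultimately show "scW (signed_choose r s) (Y.W.identity_field (p + r - int s) (?B (q + int s) w)) =
      (if int s = p + r + 1 then scW (signed_choose r s) x else 0)"
      by (simp add: Y.W.identity_field_def x_def add_ac)
  qed
  have L2: "(\<Sum>s<K. scW (sign_power r * signed_choose r s) (?B (q + r - int s) (Y.W.identity_field (p + int s) w)))
    = (\<Sum>s<K. if int s = - 1 - p then scW (sign_power r * signed_choose r s) x else 0)"
  proof (intro sum.cong refl)
    fix s
    have "?B (q + r - int s) w = x" if "int s = - 1 - p"
      using that by (auto simp: x_def intro!: arg_cong[where f = "\<lambda>k. YW b k w"])
    moreover have "p + int s = - 1 \<longleftrightarrow> int s = - 1 - p" by auto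
    ultimately show "scW (sign_power r * signed_choose r s) (?B (q + r - int s) (Y.W.identity_field (p + int s) w)) =
      (if int s = - 1 - p then scW (sign_power r * signed_choose r s) x else 0)"
      by (auto simp: Y.W.identity_field_def)
  qed
  have V: "YM vac k b = (if k = - 1 then b else 0)" for k
    by (simp add: V.Y_vac V.M.identity_field_def)
  have R: "borcherds_right vac b p q r w = (\<Sum>i<K. if int i = - 1 - r then scW (of_int p gchoose i) x else 0)"
  proof (subst borcherds_right_lessThan[where K = K])
    show "YM vac (r + int j) b = 0" if "j \<ge> K" for j
    proof -
      have "r + int j \<noteq> - 1" using that K(3) by linarith
      then show ?thesis by (simp add: V)
    qed
    show "(\<Sum>i<K. scW (of_int p gchoose i) (YW (YM vac (r + int i) b) (p + q - int i) w)) =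
       (\<Sum>i<K. if int i = - 1 - r then scW (of_int p gchoose i) x else 0)"
    proof (intro sum.cong refl)
      fix i
      have "YW b (p + q - int i) w = x" if "int i = - 1 - r"
        using that by (auto simp: x_def intro!: arg_cong[where f = "\<lambda>k. YW b k w"])
      moreover have "r + int i = - 1 \<longleftrightarrow> int i = - 1 - r" by auto
      ultimately show "scW (of_int p gchoose i) (YW (YM vac (r + int i) b) (p + q - int i) w) =
         (if int i = - 1 - r then scW (of_int p gchoose i) x else 0)"
        by (auto simp: V)
    qed
  qed
  have "(if p + r + 1 \<ge> 0 then signed_choose r (nat (p + r + 1)) else 0) - (if - 1 - p \<ge> 0 then sign_power r * signed_choose r (nat (- 1 - p)) else 0)
     = (if - 1 - r \<ge> 0 then of_int p gchoose nat (- 1 - r) else 0)"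
  proof -
    have "- 1 - p \<ge> 0 \<longleftrightarrow> p \<le> - 1" "- 1 - r \<ge> 0 \<longleftrightarrow> r \<le> - 1" by auto
    then show ?thesis
      using gbinomial_delta[of p r] by (simp only: signed_choose_def sign_power_def mult.assoc)
  qed
  then have "scW (if p + r + 1 \<ge> 0 then signed_choose r (nat (p + r + 1)) else 0) x
      - scW (if - 1 - p \<ge> 0 then sign_power r * signed_choose r (nat (- 1 - p)) else 0) x
     = scW (if - 1 - r \<ge> 0 then of_int p gchoose nat (- 1 - r) else 0) x"
    by (simp only: flip: Y.W.scale_left_diff_distrib)
  then show ?case
    unfolding Y.Y_vac R
    by (subst Y.W.borcherds_lessThan[where K = K])
       (use K in \<open>simp_all add: Z L1 L2 pick if_distrib[of "\<lambda>c. scW c x"] cong: if_cong\<close>)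
next
  case (2 h n a)
  have "\<forall>\<^sub>F K in sequentially. Y.W.borcherds (YW (actM h n a)) (YW b) p q r w = borcherds_right (actM h n a) b p q r w"
    using borcherds_iterate_left[of h n a b p q r w] borcherds_iterate_right[of h n a b p q r w]
    by eventually_elim (simp only: 2)
  then show ?case by simp
next
  case (3 u v)
  have "\<forall>\<^sub>F K in sequentially.
      (\<forall>i\<ge>K. YW b (q + int i) w = 0) \<and> (\<forall>i\<ge>K. YW u (p + int i) w = 0) \<and> (\<forall>i\<ge>K. YW v (p + int i) w = 0) \<and>
      (\<forall>i\<ge>K. YM u (r + int i) b = 0) \<and> (\<forall>i\<ge>K. YM v (r + int i) b = 0)"
    by (intro eventually_conj Y.W.is_field_eventually V.M.is_field_eventually) simp_all
  from eventually_happens'[OF sequentially_bot this] obtain K where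
    K: "\<And>i. i \<ge> K \<Longrightarrow> YW b (q + int i) w = 0" "\<And>i. i \<ge> K \<Longrightarrow> YW u (p + int i) w = 0" "\<And>i. i \<ge> K \<Longrightarrow> YW v (p + int i) w = 0"
     "\<And>i. i \<ge> K \<Longrightarrow> YM u (r + int i) b = 0" "\<And>i. i \<ge> K \<Longrightarrow> YM v (r + int i) b = 0"
    by auto
  have "Y.W.borcherds (YW (u + v)) (YW b) p q r w = Y.W.borcherds (YW u) (YW b) p q r w + Y.W.borcherds (YW v) (YW b) p q r w"
    by (simp add: Y.W.borcherds_lessThan[where K = K] K Y.Y_add Y.W.is_field_add Y.W.scale_right_distrib sum.distrib)
  moreover have "borcherds_right (u + v) b p q r w = borcherds_right u b p q r w + borcherds_right v b p q r w"
    by (simp add: borcherds_right_lessThan[where K = K] K Y.Y_add V.Y_add Y.W.scale_right_distrib sum.distrib)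
  ultimately show ?case by (simp add: 3)
next
  case (4 c v)
  have "\<forall>\<^sub>F K in sequentially.
      (\<forall>i\<ge>K. YW b (q + int i) w = 0) \<and> (\<forall>i\<ge>K. YW v (p + int i) w = 0) \<and> (\<forall>i\<ge>K. YM v (r + int i) b = 0)"
    by (intro eventually_conj Y.W.is_field_eventually V.M.is_field_eventually) simp_all
  from eventually_happens'[OF sequentially_bot this] obtain K where
    K: "\<And>i. i \<ge> K \<Longrightarrow> YW b (q + int i) w = 0" "\<And>i. i \<ge> K \<Longrightarrow> YW v (p + int i) w = 0" "\<And>i. i \<ge> K \<Longrightarrow> YM v (r + int i) b = 0"
    by auto
  have "Y.W.borcherds (YW (scM c v)) (YW b) p q r w = scW c (Y.W.borcherds (YW v) (YW b) p q r w)"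
    by (simp add: Y.W.borcherds_lessThan[where K = K] K Y.Y_scale Y.W.is_field_scale Y.W.scale_right_diff_distrib
        Y.W.scale_sum_right mult_ac)
  moreover have "borcherds_right (scM c v) b p q r w = scW c (borcherds_right v b p q r w)"
    by (simp add: borcherds_right_lessThan[where K = K] K Y.Y_scale V.Y_scale Y.W.scale_sum_right mult_ac)
  ultimately show ?case by (simp add: 4)
qed

lemma jacobi: "jacobi_identity scW YM YW"
  using borcherds_identity
  by (simp add: jacobi_identity_def Y.W.borcherds_def borcherds_right_def signed_choose_def sign_power_def)

end

section \<open>Modules for the affinization\<close>

lemma linear_addD: "Vector_Spaces.linear s t f \<Longrightarrow> f (x + y) = f x + f y"
  and linear_scaleD: "Vector_Spaces.linear s t f \<Longrightarrow> f (s c x) = t c (f x)"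
  using module_hom.add[of s t f] module_hom.scale[of s t f] by (auto simp: Vector_Spaces.linear_def)

lemma linear_domainD: "Vector_Spaces.linear s t f \<Longrightarrow> vector_space s"
  by (simp add: Vector_Spaces.linear_def)

lemma linearI:
  assumes "vector_space s" "vector_space t"
    and "\<And>x y. f (x + y) = f x + f y" "\<And>c x. f (s c x) = t c (f x)"
  shows "Vector_Spaces.linear s t f"
  using assms by (simp add: Vector_Spaces.linear_def module_hom_def module_hom_axioms_def vector_space_def module_def)

lemma sum_single_lookup: "(\<Sum>k\<in>Poly_Mapping.keys X. Poly_Mapping.single k (Poly_Mapping.lookup X k)) = X"
proof (rule poly_mapping_eqI)
  fix k
  have "Poly_Mapping.lookup (\<Sum>k\<in>Poly_Mapping.keys X. Poly_Mapping.single k (Poly_Mapping.lookup X k)) k =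
     (\<Sum>j\<in>Poly_Mapping.keys X. if j = k then Poly_Mapping.lookup X k else 0)"
    unfolding lookup_sum by (intro sum.cong refl) (auto simp: lookup_single when_def)
  then show "Poly_Mapping.lookup (\<Sum>k\<in>Poly_Mapping.keys X. Poly_Mapping.single k (Poly_Mapping.lookup X k)) k =
      Poly_Mapping.lookup X k"
    by (simp add: in_keys_iff)
qed

lemma lookup_map_times: "Poly_Mapping.lookup (Poly_Mapping.map ((*) (c::complex)) X) p = c * Poly_Mapping.lookup X p"
  by (simp add: Poly_Mapping.map.rep_eq when_def)

locale affine_lie = H: form_with_orthonormal_basis scaleH form d u
  for scaleH :: "complex \<Rightarrow> 'h::ab_group_add \<Rightarrow> 'h" and form d u +
  fixes l :: complex
begin

lemma form_add_left: "form (x + y) z = form x z + form y z"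
  and form_scale_left: "form (scaleH c x) z = c * form x z"
  using linear_addD[OF H.form_linear] linear_scaleD[OF H.form_linear] by auto

lemma form_add_right: "form z (x + y) = form z x + form z y"
  and form_scale_right: "form z (scaleH c x) = c * form z x"
  by (simp_all add: H.form_sym[of z] form_add_left form_scale_left)

lemma form_zero_left [simp]: "form 0 z = 0"
  using form_scale_left[of 0 0 z] by simp

lemma form_zero_right [simp]: "form z 0 = 0"
  by (simp add: H.form_sym[of z])

lemma form_diff_left: "form (x - y) z = form x z - form y z"
  using form_add_left[of "x - y" y z] by simp

lemma form_sum_left: "form (\<Sum>i\<in>I. f i) z = (\<Sum>i\<in>I. form (f i) z)"
  by (induction I rule: infinite_finite_induct) (simp_all add: form_add_left)

text \<open>The difference of the two sides is orthogonal to a spanning set, hence 0 by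
  nondegeneracy.\<close>

lemma orthonormal_expansion: "x = (\<Sum>i=1..d. scaleH (form (u i) x) (u i))"
proof -
  let ?y = "x - (\<Sum>i=1..d. scaleH (form (u i) x) (u i))"
  have "form ?y (u k) = 0" if "k \<in> {1..d}" for k
  proof -
    have "(\<Sum>i=1..d. form (u i) x * form (u i) (u k)) = (\<Sum>i=1..d. if i = k then form (u k) x else 0)"
      by (intro sum.cong refl) (use that H.u_orthonormal in auto)
    then show ?thesis
      using that by (simp add: form_diff_left form_sum_left form_scale_left H.form_sym[of x])
  qed
  then have 0: "u ` {1..d} \<subseteq> {z. form ?y z = 0}" by auto
  have "H.subspace {z. form ?y z = 0}"
    by (rule H.subspaceI) (auto simp: form_add_right form_scale_right)
  from H.span_minimal[OF 0 this] have "form ?y z = 0" for z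
    using H.u_span by auto
  then have "?y = 0" by (rule H.form_nondegenerate)
  then show ?thesis by simp
qed

lemma parseval: "form x y = (\<Sum>i=1..d. form (u i) x * form (u i) y)"
  by (subst orthonormal_expansion[of x]) (simp add: form_sum_left form_scale_left)

lemma current_form_atMost:
  assumes "degree a \<le> n"
  shows "current_form form a b = (\<Sum>i\<le>n. form (coeff a i) (coeff b i))"
  unfolding current_form_def using assms
  by (intro sum.mono_neutral_left) (auto simp: coeff_eq_0)

lemma current_form_zero [simp]: "current_form form 0 b = 0" "current_form form a 0 = 0"
  by (simp_all add: current_form_def)

definition kap :: "'h poly \<Rightarrow> 'h poly \<Rightarrow> complex" where
  "kap a b = l * current_form form a b"

lemma coeff_map_scale [simp]: "coeff (map_poly (scaleH c) a) i = scaleH c (coeff a i)"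
  by (simp add: coeff_map_poly)

lemma affine_scale_single: "affine_scale scaleH c (Poly_Mapping.single n a, t) =
    (Poly_Mapping.single n (map_poly (scaleH c) a), c * t)"
  unfolding affine_scale_def
  by (auto intro!: poly_mapping_eqI simp: Poly_Mapping.map.rep_eq lookup_single when_def)

lemma affine_bracket_single:
  "affine_bracket form (Poly_Mapping.single m a, s) (Poly_Mapping.single n b, t) =
    (0, if m + n = 0 then of_int m * current_form form a b else 0)"
proof (cases "a = 0")
  case False
  then show ?thesis by (auto simp: affine_bracket_def lookup_single when_def)
qed (simp add: affine_bracket_def)

lemma affine_bracket_central: "affine_bracket form (0, c) x = 0"
  by (simp add: affine_bracket_def zero_prod_def)

end

text \<open>Kept apart from \<open>level_module\<close> because for M(l) the level and the
  smoothness are consequences of the presentation, and their proofs already use the rules collected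
  here.\<close>

locale level_module_base = affine_lie scaleH form d u l
  for scaleH :: "complex \<Rightarrow> 'h::ab_group_add \<Rightarrow> 'h" and form d u l +
  fixes sc :: "complex \<Rightarrow> 'w::ab_group_add \<Rightarrow> 'w" and rho :: "'h affine \<Rightarrow> 'w \<Rightarrow> 'w"
  assumes lie: "lie_module (affine_scale scaleH) (affine_bracket form) sc rho"
begin

sublocale complex_vector_space sc
  using lie linear_domainD unfolding lie_module_def complex_vector_space_def by blast

lemma rho_add: "rho x (v + w) = rho x v + rho x w"
  and rho_scale: "rho x (sc c w) = sc c (rho x w)"
  and rho_add_left: "rho (x + y) w = rho x w + rho y w"
  and rho_scale_left: "rho (affine_scale scaleH c x) w = sc c (rho x w)"
  and rho_bracket: "rho (affine_bracket form x y) w = rho x (rho y w) - rho y (rho x w)"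
proof -
  have 1: "Vector_Spaces.linear sc sc (rho x)" 
    and 2: "Vector_Spaces.linear (affine_scale scaleH) sc (\<lambda>x. rho x w)" for x w
    using lie unfolding lie_module_def by blast+
  show "rho x (v + w) = rho x v + rho x w" "rho x (sc c w) = sc c (rho x w)"
    "rho (x + y) w = rho x w + rho y w" "rho (affine_scale scaleH c x) w = sc c (rho x w)"
    using linear_addD[OF 1] linear_scaleD[OF 1] linear_addD[OF 2] linear_scaleD[OF 2] by auto
  show "rho (affine_bracket form x y) w = rho x (rho y w) - rho y (rho x w)"
    using lie unfolding lie_module_def by blast
qed

lemma affine_vector_space: "vector_space (affine_scale scaleH)"
  using lie linear_domainD unfolding lie_module_def by blast

lemma rho_zero_left [simp]: "rho 0 w = 0"
  using rho_add_left[of 0 0 w] by simp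

lemma rho_zero [simp]: "rho x 0 = 0"
  using rho_add[of x 0 0] by simp

lemma rho_sum_left: "rho (\<Sum>i\<in>I. f i) w = (\<Sum>i\<in>I. rho (f i) w)"
  by (induction I rule: infinite_finite_induct) (simp_all add: rho_add_left)

lemma rho_sum: "rho x (\<Sum>i\<in>I. f i) = (\<Sum>i\<in>I. rho x (f i))"
  by (induction I rule: infinite_finite_induct) (simp_all add: rho_add)

lemma mode_add_left: "mode rho (a + b) n w = mode rho a n w + mode rho b n w"
  using rho_add_left[of "(Poly_Mapping.single n a, 0)" "(Poly_Mapping.single n b, 0)" w]
  by (simp add: mode_def single_add)

lemma mode_scale_left: "mode rho (map_poly (scaleH c) a) n w = sc c (mode rho a n w)"
  using rho_scale_left[of c "(Poly_Mapping.single n a, 0)" w]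
  by (simp add: mode_def affine_scale_single)

lemma mode_zero_left [simp]: "mode rho 0 n w = 0"
  using mode_add_left[of 0 0 n w] by simp

lemma mode_sum_left: "mode rho (\<Sum>i\<in>I. f i) n w = (\<Sum>i\<in>I. mode rho (f i) n w)"
  by (induction I rule: infinite_finite_induct) (simp_all add: mode_add_left)

lemma rho_modes: "rho x w = (\<Sum>m\<in>Poly_Mapping.keys (fst x). mode rho (Poly_Mapping.lookup (fst x) m) m w) + rho (0, snd x) w"
proof -
  have "x = (\<Sum>m\<in>Poly_Mapping.keys (fst x). (Poly_Mapping.single m (Poly_Mapping.lookup (fst x) m), 0)) + (0, snd x)"
    by (simp add: prod_eq_iff fst_sum snd_sum sum_single_lookup)
  then show ?thesis
    unfolding mode_def by (metis (no_types, lifting) rho_add_left rho_sum_left sum.cong)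
qed

end

locale level_module = level_module_base +
  assumes level: "rho (0, c) w = sc (l * c) w"
    and smooth: "\<exists>N. \<forall>n\<ge>N. \<forall>a. mode rho a n w = 0"
begin

sublocale mode_module sc "mode rho" kap
proof
  show "mode rho a m (mode rho b n w) = mode rho b n (mode rho a m w) +
      (if m + n = 0 then sc (of_int m * kap a b) w else 0)" for a m b n w
  proof -
    have "mode rho a m (mode rho b n w) - mode rho b n (mode rho a m w) =
      rho (0, if m + n = 0 then of_int m * current_form form a b else 0) w"
      unfolding mode_def by (simp only: rho_bracket[symmetric] affine_bracket_single)
    then show ?thesis by (simp add: level kap_def algebra_simps split: if_splits)
  qed
qed (simp_all add: mode_def rho_add rho_scale smooth[unfolded mode_def])

lemma nprod_add_left:
  assumes F: "is_field F"
  shows "nprod (a + b) n F q w = nprod a n F q w + nprod b n F q w"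
proof -
  have "\<forall>\<^sub>F K in sequentially. nprod (a + b) n F q w = nprod a n F q w + nprod b n F q w"
    using nprod_eventually[OF F, of a n q w] nprod_eventually[OF F, of b n q w] nprod_eventually[OF F, of "a + b" n q w]
    by eventually_elim (simp add: mode_add_left is_field_add[OF F] scale_right_distrib sum.distrib)
  then show ?thesis by simp
qed

lemma nprod_scale_left:
  assumes F: "is_field F"
  shows "nprod (map_poly (scaleH c) a) n F q w = sc c (nprod a n F q w)"
proof -
  have "\<forall>\<^sub>F K in sequentially. nprod (map_poly (scaleH c) a) n F q w = sc c (nprod a n F q w)"
    using nprod_eventually[OF F, of a n q w] nprod_eventually[OF F, of "map_poly (scaleH c) a" n q w]
    by eventually_elim (simp add: mode_scale_left is_field_scale[OF F] scale_right_diff_distrib scale_sum_right mult_ac)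
  then show ?thesis by simp
qed

end

section \<open>The universal property of the induced module\<close>

text \<open>The formula of \<open>word_action\<close> for an arbitrary function on words: it is
  needed both for words acting on M(l) and for words acting on a target of the universal
  property.\<close>

definition linear_extension :: "(complex \<Rightarrow> 'f \<Rightarrow> 'f) \<Rightarrow> ('p \<Rightarrow> 'f) \<Rightarrow> ('p \<Rightarrow>\<^sub>0 complex) \<Rightarrow> 'f::comm_monoid_add" where
  "linear_extension s phi X = (\<Sum>p\<in>Poly_Mapping.keys X. s (Poly_Mapping.lookup X p) (phi p))"

lemma word_action_eq: "word_action s rho X v = linear_extension s (\<lambda>p. foldr rho p v) X"
  by (simp add: word_action_def linear_extension_def)

context complex_vector_space
begin

lemma linear_extension_superset:
  assumes "finite S" "Poly_Mapping.keys X \<subseteq> S"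
  shows "linear_extension sc phi X = (\<Sum>p\<in>S. sc (Poly_Mapping.lookup X p) (phi p))"
  unfolding linear_extension_def
  by (rule sum.mono_neutral_left) (use assms in \<open>auto simp: in_keys_iff\<close>)

lemma linear_extension_add:
  "linear_extension sc phi (X + X') = linear_extension sc phi X + linear_extension sc phi X'"
proof -
  let ?S = "Poly_Mapping.keys X \<union> Poly_Mapping.keys X'"
  have "Poly_Mapping.keys (X + X') \<subseteq> ?S" by (rule Poly_Mapping.keys_add)
  then show ?thesis
    by (simp add: linear_extension_superset[of ?S] lookup_add scale_left_distrib sum.distrib)
qed

lemma linear_extension_scale:
  "linear_extension sc phi (Poly_Mapping.map ((*) c) X) = sc c (linear_extension sc phi X)"
proof -
  have "Poly_Mapping.keys (Poly_Mapping.map ((*) c) X) \<subseteq> Poly_Mapping.keys X"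
    by (auto simp: in_keys_iff lookup_map_times)
  then show ?thesis
    by (simp add: linear_extension_superset[of "Poly_Mapping.keys X"] lookup_map_times scale_sum_right)
qed

lemma linear_extension_single: "linear_extension sc phi (Poly_Mapping.single p c) = sc c (phi p)"
  by (simp add: linear_extension_def)

lemma linear_extension_zero [simp]: "linear_extension sc phi 0 = 0"
  by (simp add: linear_extension_def)

lemma linear_extension_diff:
  "linear_extension sc phi (X - X') = linear_extension sc phi X - linear_extension sc phi X'"
  using linear_extension_add[of phi "X - X'" X'] by simp

end

lemma vector_space_poly_mapping: "vector_space (\<lambda>c. Poly_Mapping.map ((*) (c::complex)) :: ('p \<Rightarrow>\<^sub>0 complex) \<Rightarrow> _)"
  by unfold_locales
    (auto intro!: poly_mapping_eqI simp: lookup_map_times lookup_add algebra_simps)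

section \<open>The induced module and its generation by modes\<close>

locale vacuum_setup = affine_lie scaleH form d u l
  for scaleH :: "complex \<Rightarrow> 'h::ab_group_add \<Rightarrow> 'h" and form d u l +
  fixes scM :: "complex \<Rightarrow> 'm::ab_group_add \<Rightarrow> 'm" and rhoM :: "'h affine \<Rightarrow> 'm \<Rightarrow> 'm" and vac :: 'm
  assumes vacuum_module: "vacuum_module scaleH form l scM rhoM vac"
begin

sublocale B: level_module_base scaleH form d u l scM rhoM
  by unfold_locales (use vacuum_module in \<open>simp add: vacuum_module_def induced_module_def\<close>)

abbreviation relations where
  "relations \<equiv> enveloping_relations (affine_scale scaleH) (affine_bracket form) \<union>
     character_relations {x. \<forall>m<0. Poly_Mapping.lookup (fst x) m = 0} (\<lambda>x. l * snd x)"

abbreviation word_value where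
  "word_value \<equiv> linear_extension scM (\<lambda>p. foldr rhoM p vac)"

lemma word_value_surj: "\<exists>X. m = word_value X"
  using vacuum_module unfolding vacuum_module_def induced_module_def word_action_eq by auto

lemma word_value_kernel:
  "word_value X = 0 \<longleftrightarrow> X \<in> module.span (\<lambda>c. Poly_Mapping.map ((*) c)) relations"
  using vacuum_module unfolding vacuum_module_def induced_module_def word_action_eq by auto

lemma vac_character:
  assumes "\<forall>m<0. Poly_Mapping.lookup (fst x) m = 0"
  shows "rhoM x vac = scM (l * snd x) vac"
proof -
  interpret P: vector_space "\<lambda>c. Poly_Mapping.map ((*) (c::complex)) :: ('h affine list \<Rightarrow>\<^sub>0 complex) \<Rightarrow> _"
    by (rule vector_space_poly_mapping)
  let ?X = "Poly_Mapping.single ([] @ [x]) 1 - Poly_Mapping.single [] (l * snd x)"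
  have "?X \<in> relations" unfolding character_relations_def using assms by blast
  then have "word_value ?X = 0" unfolding word_value_kernel by (rule P.span_base)
  then show ?thesis by (simp add: B.linear_extension_diff B.linear_extension_single)
qed

lemma mode_vac: "mode rhoM a (int n) vac = 0"
proof -
  have "rhoM (Poly_Mapping.single (int n) a, 0) vac = 0"
    by (subst vac_character) (auto simp: lookup_single when_def)
  then show ?thesis by (simp add: mode_def)
qed

lemma word_induct:
  assumes "P vac" "\<And>x v. P v \<Longrightarrow> P (rhoM x v)" "\<And>u v. P u \<Longrightarrow> P v \<Longrightarrow> P (u + v)" "\<And>c v. P v \<Longrightarrow> P (scM c v)"
  shows "P v"
proof -
  obtain X where X: "v = word_value X" using word_value_surj by blast
  have 0: "P 0" using assms(4)[OF assms(1), of 0] by simp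
  have "P (foldr rhoM p vac)" for p by (induction p) (use assms in auto)
  then have "P (\<Sum>p\<in>I. scM (c p) (foldr rhoM p vac))" for I c
    by (induction I rule: infinite_finite_induct) (use 0 assms in auto)
  then show ?thesis by (simp add: X linear_extension_def)
qed

text \<open>The element \<open>k\<close> is central and acts by \<open>l\<close> on the
  generator.\<close>

lemma level_M: "rhoM (0, c) v = scM (l * c) v"
proof (induction v rule: word_induct)
  case 1
  show ?case by (simp add: vac_character)
next
  case (2 x v)
  have "rhoM (0, c) (rhoM x v) = rhoM x (rhoM (0, c) v)"
    using B.rho_bracket[of "(0, c)" x v] by (simp add: affine_bracket_central)
  then show ?case by (simp add: 2 B.rho_scale)
qed (simp_all add: B.rho_add B.rho_scale B.scale_right_distrib mult.commute)

text \<open>An element of the affinization acts as a finite sum of modes plus a scalar, so the modes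
  alone generate M(l).\<close>

lemma vac_induct:
  assumes "P vac" "\<And>a n v. P v \<Longrightarrow> P (mode rhoM a n v)" "\<And>u v. P u \<Longrightarrow> P v \<Longrightarrow> P (u + v)" "\<And>c v. P v \<Longrightarrow> P (scM c v)"
  shows "P v"
proof (induction v rule: word_induct)
  case (2 x v)
  have 0: "P 0" using assms(4)[OF assms(1), of 0] by simp
  have "P (\<Sum>m\<in>I. mode rhoM (f m) m v)" for I f
    by (induction I rule: infinite_finite_induct) (use 0 assms 2 in auto)
  then show ?case by (subst B.rho_modes) (simp add: assms 2 level_M)
qed (use assms in auto)

sublocale M: level_module scaleH form d u l scM rhoM
proof
  have comm: "mode rhoM a m (mode rhoM b n w) = mode rhoM b n (mode rhoM a m w) +
      (if m + n = 0 then scM (of_int m * kap a b) w else 0)" for a m b n w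
  proof -
    have "mode rhoM a m (mode rhoM b n w) - mode rhoM b n (mode rhoM a m w) =
      rhoM (0, if m + n = 0 then of_int m * current_form form a b else 0) w"
      unfolding mode_def by (simp only: B.rho_bracket[symmetric] affine_bracket_single)
    then show ?thesis by (simp add: level_M kap_def algebra_simps split: if_splits)
  qed
  show "\<exists>N. \<forall>n\<ge>N. \<forall>a. mode rhoM a n v = 0" for v
  proof (induction v rule: vac_induct)
    case 1
    have "mode rhoM a n vac = 0" if "n \<ge> 0" for a n
      using mode_vac[of a "nat n"] that by simp
    then show ?case by blast
  next
    case (2 b m v)
    then obtain N where N: "\<And>n a. n \<ge> N \<Longrightarrow> mode rhoM a n v = 0" by blast
    \<comment> \<open>The bound \<open>1 - m\<close> makes \<open>n + m\<close> positive and so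
      excludes the central term.\<close>
    have "mode rhoM a n (mode rhoM b m v) = 0" if "n \<ge> max N (1 - m)" for n a
      using that N by (subst comm) (simp add: mode_def)
    then show ?case by blast
  next
    case (3 u v)
    then obtain N N' where N: "\<And>n a. n \<ge> N \<Longrightarrow> mode rhoM a n u = 0" "\<And>n a. n \<ge> N' \<Longrightarrow> mode rhoM a n v = 0" by blast
    have "mode rhoM a n (u + v) = 0" if "n \<ge> max N N'" for n a
      using that N[of n a] by (simp add: mode_def B.rho_add)
    then show ?case by blast
  next
    case (4 c v)
    then show ?case by (auto simp: mode_def B.rho_scale)
  qed
qed (rule level_M)

end

text \<open>A target for the universal property, given by operators for the modes alone. The axioms
  are relative to a subspace \<open>S\<close> because in the main application the type contains all
  operator-valued series, while n-th products are controlled only on fields.\<close>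

locale vacuum_target = vacuum_setup scaleH form d u l scM rhoM vac + F: vector_space scF
  for scaleH :: "complex \<Rightarrow> 'h::ab_group_add \<Rightarrow> 'h" and form d u l scM rhoM and vac :: "'m::ab_group_add"
    and scF :: "complex \<Rightarrow> 'f::ab_group_add \<Rightarrow> 'f" +
  fixes oper :: "'h poly \<Rightarrow> int \<Rightarrow> 'f \<Rightarrow> 'f" and S :: "'f set" and e :: 'f
  assumes S_subspace: "F.subspace S" and e_S: "e \<in> S" and oper_S: "f \<in> S \<Longrightarrow> oper a n f \<in> S"
    and oper_add: "f \<in> S \<Longrightarrow> g \<in> S \<Longrightarrow> oper a n (f + g) = oper a n f + oper a n g"
    and oper_scale: "f \<in> S \<Longrightarrow> oper a n (scF c f) = scF c (oper a n f)"
    and oper_add_left: "f \<in> S \<Longrightarrow> oper (a + b) n f = oper a n f + oper b n f"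
    and oper_scale_left: "f \<in> S \<Longrightarrow> oper (map_poly (scaleH c) a) n f = scF c (oper a n f)"
    and oper_commute: "f \<in> S \<Longrightarrow> oper a m (oper b n f) = oper b n (oper a m f) +
      (if m + n = 0 then scF (of_int m * kap a b) f else 0)"
    and oper_e: "oper a (int k) e = 0"
begin

lemmas S_closed = F.subspace_add[OF S_subspace] F.subspace_scale[OF S_subspace]
  F.subspace_sum[OF S_subspace] F.subspace_0[OF S_subspace]

lemma oper_zero_left [simp]: "f \<in> S \<Longrightarrow> oper 0 n f = 0"
  using oper_add_left[of f 0 0 n] by simp

lemma oper_sum: "(\<And>i. i \<in> I \<Longrightarrow> f i \<in> S) \<Longrightarrow> oper a n (\<Sum>i\<in>I. f i) = (\<Sum>i\<in>I. oper a n (f i))"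
proof (induction I rule: infinite_finite_induct)
  case (insert x I)
  then have "(\<Sum>i\<in>I. f i) \<in> S" by (intro S_closed) auto
  then show ?case using insert by (simp add: oper_add)
qed (use oper_scale[of 0 a n 0] S_closed(4) in auto)

definition lie_oper :: "'h affine \<Rightarrow> 'f \<Rightarrow> 'f" where
  "lie_oper x f = (\<Sum>m\<in>Poly_Mapping.keys (fst x). oper (Poly_Mapping.lookup (fst x) m) m f) + scF (l * snd x) f"

lemma lie_oper_superset:
  assumes "f \<in> S" "finite K" "Poly_Mapping.keys (fst x) \<subseteq> K"
  shows "lie_oper x f = (\<Sum>m\<in>K. oper (Poly_Mapping.lookup (fst x) m) m f) + scF (l * snd x) f"
proof -
  have "(\<Sum>m\<in>Poly_Mapping.keys (fst x). oper (Poly_Mapping.lookup (fst x) m) m f) = (\<Sum>m\<in>K. oper (Poly_Mapping.lookup (fst x) m) m f)"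
    by (rule sum.mono_neutral_left) (use assms in \<open>auto simp: in_keys_iff\<close>)
  then show ?thesis by (simp add: lie_oper_def)
qed

lemma lie_oper_S: "f \<in> S \<Longrightarrow> lie_oper x f \<in> S"
  unfolding lie_oper_def by (intro S_closed oper_S)

lemma lie_oper_add: "f \<in> S \<Longrightarrow> g \<in> S \<Longrightarrow> lie_oper x (f + g) = lie_oper x f + lie_oper x g"
  by (simp add: lie_oper_def oper_add sum.distrib F.scale_right_distrib)

lemma lie_oper_scale: "f \<in> S \<Longrightarrow> lie_oper x (scF c f) = scF c (lie_oper x f)"
  by (simp add: lie_oper_def oper_scale F.scale_right_distrib F.scale_sum_right mult.commute)

lemma lie_oper_add_left:
  assumes "f \<in> S"
  shows "lie_oper (x + y) f = lie_oper x f + lie_oper y f"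
proof -
  let ?K = "Poly_Mapping.keys (fst x) \<union> Poly_Mapping.keys (fst y)"
  have "Poly_Mapping.keys (fst (x + y)) \<subseteq> ?K" using Poly_Mapping.keys_add[of "fst x" "fst y"] by simp
  then show ?thesis
    using assms by (simp add: lie_oper_superset[of f ?K] lookup_add oper_add_left sum.distrib
        F.scale_left_distrib algebra_simps)
qed

lemma lie_oper_scale_left:
  assumes "f \<in> S"
  shows "lie_oper (affine_scale scaleH c x) f = scF c (lie_oper x f)"
proof -
  have lk: "Poly_Mapping.lookup (fst (affine_scale scaleH c x)) m = map_poly (scaleH c) (Poly_Mapping.lookup (fst x) m)" for m
    by (simp add: affine_scale_def Poly_Mapping.map.rep_eq when_def)
  then have "Poly_Mapping.keys (fst (affine_scale scaleH c x)) \<subseteq> Poly_Mapping.keys (fst x)"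
    by (auto simp: in_keys_iff)
  then show ?thesis
    using assms by (simp add: lie_oper_superset[of f "Poly_Mapping.keys (fst x)"] lk oper_scale_left)
      (simp add: affine_scale_def F.scale_right_distrib F.scale_sum_right mult_ac)
qed

text \<open>All summands except the double sum are symmetric in \<open>x\<close> and
  \<open>y\<close>, so only the double sum is left in the commutator.\<close>

lemma lie_oper_twice:
  assumes f: "f \<in> S"
  shows "lie_oper x (lie_oper y f) =
      (\<Sum>m\<in>Poly_Mapping.keys (fst x). \<Sum>n\<in>Poly_Mapping.keys (fst y).
         oper (Poly_Mapping.lookup (fst x) m) m (oper (Poly_Mapping.lookup (fst y) n) n f))
      + (scF (l * snd y) (\<Sum>m\<in>Poly_Mapping.keys (fst x). oper (Poly_Mapping.lookup (fst x) m) m f)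
        + scF (l * snd x) (\<Sum>n\<in>Poly_Mapping.keys (fst y). oper (Poly_Mapping.lookup (fst y) n) n f))
      + scF (l * snd x) (scF (l * snd y) f)"
proof -
  let ?s = "\<Sum>n\<in>Poly_Mapping.keys (fst y). oper (Poly_Mapping.lookup (fst y) n) n f"
  have s: "?s \<in> S" "scF (l * snd y) f \<in> S" using f by (auto intro!: S_closed oper_S)
  have "oper a m (lie_oper y f) = (\<Sum>n\<in>Poly_Mapping.keys (fst y). oper a m (oper (Poly_Mapping.lookup (fst y) n) n f))
       + scF (l * snd y) (oper a m f)" for a m
    unfolding lie_oper_def by (simp add: oper_add[OF s] oper_scale[OF f] oper_sum oper_S[OF f])
  then show ?thesis
    by (subst lie_oper_def) (simp add: lie_oper_def[of y] sum.distrib F.scale_sum_right F.scale_right_distrib algebra_simps)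
qed

lemma lie_oper_bracket:
  assumes f: "f \<in> S"
  shows "lie_oper x (lie_oper y f) - lie_oper y (lie_oper x f) = lie_oper (affine_bracket form x y) f"
proof -
  let ?X = "Poly_Mapping.keys (fst x)" and ?Y = "Poly_Mapping.keys (fst y)"
  let ?x = "Poly_Mapping.lookup (fst x)" and ?y = "Poly_Mapping.lookup (fst y)"
  have "lie_oper x (lie_oper y f) - lie_oper y (lie_oper x f) =
     (\<Sum>m\<in>?X. \<Sum>n\<in>?Y. oper (?x m) m (oper (?y n) n f)) - (\<Sum>n\<in>?Y. \<Sum>m\<in>?X. oper (?y n) n (oper (?x m) m f))"
    unfolding lie_oper_twice[OF f] by (simp add: mult.commute)
  also have "(\<Sum>n\<in>?Y. \<Sum>m\<in>?X. oper (?y n) n (oper (?x m) m f)) = (\<Sum>m\<in>?X. \<Sum>n\<in>?Y. oper (?y n) n (oper (?x m) m f))"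
    by (rule sum.swap)
  also have "(\<Sum>m\<in>?X. \<Sum>n\<in>?Y. oper (?x m) m (oper (?y n) n f)) - \<dots> =
     (\<Sum>m\<in>?X. \<Sum>n\<in>?Y. if m + n = 0 then scF (of_int m * kap (?x m) (?y n)) f else 0)"
    unfolding sum_subtractf[symmetric] by (subst oper_commute[OF f]) simp
  also have "\<dots> = (\<Sum>m\<in>?X. scF (of_int m * kap (?x m) (?y (- m))) f)"
  proof (intro sum.cong refl)
    fix m
    have "(\<Sum>n\<in>?Y. if m + n = 0 then scF (of_int m * kap (?x m) (?y n)) f else 0) =
      (\<Sum>n\<in>?Y. if n = - m then scF (of_int m * kap (?x m) (?y (- m))) f else 0)"
      by (intro sum.cong refl) auto
    also have "\<dots> = scF (of_int m * kap (?x m) (?y (- m))) f"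
      by (simp add: in_keys_iff kap_def)
    finally show "(\<Sum>n\<in>?Y. if m + n = 0 then scF (of_int m * kap (?x m) (?y n)) f else 0) = \<dots>" .
  qed
  also have "\<dots> = lie_oper (affine_bracket form x y) f"
    by (simp add: lie_oper_def affine_bracket_def kap_def sum_distrib_left mult_ac flip: F.scale_sum_left)
  finally show ?thesis .
qed

lemma foldr_lie_oper_S: "f \<in> S \<Longrightarrow> foldr lie_oper p f \<in> S"
  by (induction p) (simp_all add: lie_oper_S)

lemma foldr_lie_oper_add: "f \<in> S \<Longrightarrow> g \<in> S \<Longrightarrow> foldr lie_oper p (f + g) = foldr lie_oper p f + foldr lie_oper p g"
  by (induction p) (simp_all add: lie_oper_add foldr_lie_oper_S)

lemma foldr_lie_oper_scale: "f \<in> S \<Longrightarrow> foldr lie_oper p (scF c f) = scF c (foldr lie_oper p f)"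
  by (induction p) (simp_all add: lie_oper_scale foldr_lie_oper_S)

lemma lie_oper_e:
  assumes "\<forall>m<0. Poly_Mapping.lookup (fst x) m = 0"
  shows "lie_oper x e = scF (l * snd x) e"
proof -
  have "oper (Poly_Mapping.lookup (fst x) m) m e = 0" for m
  proof (cases "m < 0")
    case False
    then show ?thesis using oper_e[of _ "nat m"] by simp
  qed (use assms e_S in auto)
  then show ?thesis by (simp add: lie_oper_def)
qed

sublocale FC: complex_vector_space scF
  by (simp add: complex_vector_space_def F.vector_space_axioms)

abbreviation target_value where
  "target_value \<equiv> linear_extension scF (\<lambda>p. foldr lie_oper p e)"

lemma target_value_relations: "X \<in> relations \<Longrightarrow> target_value X = 0"
proof -
  assume "X \<in> relations"
  then consider
    (add) p q x y where "X = Poly_Mapping.single (p @ [x + y] @ q) 1 - Poly_Mapping.single (p @ [x] @ q) 1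
        - Poly_Mapping.single (p @ [y] @ q) 1"
  | (scale) p q c x where "X = Poly_Mapping.single (p @ [affine_scale scaleH c x] @ q) 1 - Poly_Mapping.single (p @ [x] @ q) c"
  | (bracket) p q x y where "X = Poly_Mapping.single (p @ [x, y] @ q) 1 - Poly_Mapping.single (p @ [y, x] @ q) 1
        - Poly_Mapping.single (p @ [affine_bracket form x y] @ q) 1"
  | (char) p x where "X = Poly_Mapping.single (p @ [x]) 1 - Poly_Mapping.single p (l * snd x)"
      "\<forall>m<0. Poly_Mapping.lookup (fst x) m = 0"
    unfolding enveloping_relations_def character_relations_def by blast
  then show ?thesis
  proof cases
    case add
    then show ?thesis
      by (simp add: FC.linear_extension_diff FC.linear_extension_single lie_oper_add_left foldr_lie_oper_S e_S
          foldr_lie_oper_add lie_oper_S)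
  next
    case scale
    then show ?thesis
      by (simp add: FC.linear_extension_diff FC.linear_extension_single lie_oper_scale_left foldr_lie_oper_S e_S
          foldr_lie_oper_scale lie_oper_S)
  next
    case bracket
    have f: "foldr lie_oper q e \<in> S" by (simp add: foldr_lie_oper_S e_S)
    have "lie_oper x (lie_oper y (foldr lie_oper q e)) = lie_oper y (lie_oper x (foldr lie_oper q e))
        + lie_oper (affine_bracket form x y) (foldr lie_oper q e)"
      using lie_oper_bracket[OF f, of x y] by (simp add: algebra_simps)
    then show ?thesis
      using f by (simp add: bracket FC.linear_extension_diff FC.linear_extension_single foldr_lie_oper_add lie_oper_S)
  next
    case char
    then show ?thesis
      by (simp add: FC.linear_extension_diff FC.linear_extension_single lie_oper_e foldr_lie_oper_scale e_S)
  qed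
qed

lemma target_value_kernel:
  assumes "word_value X = 0"
  shows "target_value X = 0"
proof -
  interpret P: vector_space "\<lambda>c. Poly_Mapping.map ((*) (c::complex)) :: ('h affine list \<Rightarrow>\<^sub>0 complex) \<Rightarrow> _"
    by (rule vector_space_poly_mapping)
  have "P.subspace {X. target_value X = 0}"
    by (rule P.subspaceI) (simp_all add: FC.linear_extension_add FC.linear_extension_scale)
  then have "P.span relations \<subseteq> {X. target_value X = 0}"
    by (intro P.span_minimal subsetI CollectI target_value_relations)
  then show ?thesis using assms unfolding word_value_kernel by blast
qed

theorem universal_property:
  "\<exists>T. (\<forall>v w. T (v + w) = T v + T w) \<and> (\<forall>c v. T (scM c v) = scF c (T v)) \<and> (\<forall>v. T v \<in> S) \<and>
     T vac = e \<and> (\<forall>a n v. T (mode rhoM a n v) = oper a n (T v))"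
proof -
  \<comment> \<open>Some preimage under \<open>word_value\<close> is chosen; by
    \<open>target_value_kernel\<close> the result does not depend on the choice.\<close>
  define T where "T v = target_value (SOME X. v = word_value X)" for v
  have T: "T (word_value X) = target_value X" for X
  proof -
    have "word_value X = word_value (SOME X'. word_value X = word_value X')"
      by (rule someI) (rule refl)
    then have "word_value (X - (SOME X'. word_value X = word_value X')) = 0"
      by (simp add: B.linear_extension_diff)
    from target_value_kernel[OF this] show ?thesis
      by (simp add: T_def FC.linear_extension_diff)
  qed
  have add: "T (v + w) = T v + T w" for v w
    using word_value_surj[of v] word_value_surj[of w]
    by (metis T B.linear_extension_add FC.linear_extension_add)
  have scale: "T (scM c v) = scF c (T v)" for c v
    using word_value_surj[of v] by (metis T B.linear_extension_scale FC.linear_extension_scale)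
  have TS: "T v \<in> S" for v
  proof -
    obtain X where "v = word_value X" using word_value_surj by blast
    moreover have "target_value X \<in> S"
      unfolding linear_extension_def by (intro S_closed foldr_lie_oper_S e_S)
    ultimately show ?thesis by (simp add: T)
  qed
  have word: "T (foldr rhoM p vac) = foldr lie_oper p e" for p
    using T[of "Poly_Mapping.single p 1"] by (simp add: B.linear_extension_single FC.linear_extension_single)
  have zero: "T 0 = 0" using scale[of 0 0] by simp
  have lie: "T (rhoM x v) = lie_oper x (T v)" for x v
  proof -
    obtain X where X: "v = word_value X" using word_value_surj by blast
    have sum: "T (\<Sum>p\<in>I. f p) = (\<Sum>p\<in>I. T (f p))" for I and f :: "'h affine list \<Rightarrow> 'm"
      by (induction I rule: infinite_finite_induct) (simp_all add: add zero)
    have sum': "lie_oper x (\<Sum>p\<in>I. f p) = (\<Sum>p\<in>I. lie_oper x (f p))" if "\<And>p. f p \<in> S"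
      for I and f :: "'h affine list \<Rightarrow> 'f"
    proof (induction I rule: infinite_finite_induct)
      case (insert y I)
      then show ?case by (simp add: lie_oper_add that S_closed)
    qed (use lie_oper_scale[of 0 x 0] S_closed(4) in auto)
    have "T (rhoM x v) = (\<Sum>p\<in>Poly_Mapping.keys X. scF (Poly_Mapping.lookup X p) (lie_oper x (foldr lie_oper p e)))"
      using word[of "x # _"] by (simp add: X linear_extension_def B.rho_sum B.rho_scale sum scale)
    also have "\<dots> = lie_oper x (target_value X)"
      unfolding linear_extension_def by (simp add: sum' lie_oper_scale foldr_lie_oper_S e_S S_closed)
    finally show ?thesis by (simp add: X T)
  qed
  have "T (mode rhoM a n v) = oper a n (T v)" for a n v
    \<comment> \<open>The case \<open>a = 0\<close> is apart because then \<open>single n a\<close>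
      has no keys, and the sum in \<open>lie_oper\<close> is empty.\<close>
    unfolding mode_def lie by (cases "a = 0") (simp_all add: lie_oper_def TS)
  then show ?thesis using add scale TS word[of "[]"] by (intro exI[of _ T]) simp
qed

end

section \<open>Normally ordered products\<close>

lemma Sum_any_lists:
  fixes g :: "int list \<Rightarrow> 'w::comm_monoid_add"
  assumes fin: "finite {ms. g ms \<noteq> 0}" and "g [] = 0" and M: "finite M"
    and sub: "\<And>m ms. g (m # ms) \<noteq> 0 \<Longrightarrow> m \<in> M"
  shows "Sum_any g = (\<Sum>m\<in>M. Sum_any (\<lambda>ms. g (m # ms)))"
proof -
  let ?A = "\<lambda>m. {ms. g (m # ms) \<noteq> 0}"
  have finA: "finite (?A m)" for m
  proof (rule finite_subset)
    show "?A m \<subseteq> tl ` {ms. g ms \<noteq> 0}" by (auto intro!: image_eqI[of _ tl "m # _"])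
    show "finite (tl ` {ms. g ms \<noteq> 0})" using fin by blast
  qed
  have eq: "{ms. g ms \<noteq> 0} = (\<lambda>(m, ms). m # ms) ` (SIGMA m:M. ?A m)"
  proof (intro equalityI subsetI)
    fix ms assume "ms \<in> {ms. g ms \<noteq> 0}"
    then have "g ms \<noteq> 0" by simp
    moreover from this obtain m ms' where "ms = m # ms'" using assms(2) by (cases ms) auto
    ultimately show "ms \<in> (\<lambda>(m, ms). m # ms) ` (SIGMA m:M. ?A m)" using sub by force
  qed auto
  have "Sum_any g = sum g ((\<lambda>(m, ms). m # ms) ` (SIGMA m:M. ?A m))"
    unfolding Sum_any.expand_set eq[symmetric] ..
  also have "\<dots> = (\<Sum>(m, ms)\<in>(SIGMA m:M. ?A m). g (m # ms))"
    by (subst sum.reindex) (auto simp: inj_on_def case_prod_unfold)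
  also have "\<dots> = (\<Sum>m\<in>M. \<Sum>ms\<in>?A m. g (m # ms))"
    using M finA by (subst sum.Sigma) auto
  finally show ?thesis by (simp add: Sum_any.expand_set)
qed

text \<open>The coefficient of \<open>a(m)\<close> in the divided derivative of order
  \<open>r - 1\<close> of \<open>a(z)\<close> is the one in the n-th product for
  \<open>n = - r\<close>. This is shown here for \<open>m <= - r\<close>, in
  \<open>derivative_coefficient_nonneg\<close> for \<open>m >= 0\<close>, where the minus sign is
  that of the second half of the n-th product; between these ranges
  \<open>derivative_coefficient_gap\<close> gives 0.\<close>

lemma derivative_coefficient_neg:
  assumes "r \<ge> 1"
  shows "(of_int (- (- int r - int i) - 1) gchoose (r - 1) :: complex) = signed_choose (- int r) i"
proof -
  obtain s where r: "r = Suc s" using assms by (metis Suc_le_D One_nat_def)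
  have "(of_nat (s + i) gchoose s :: complex) = of_nat (s + i) gchoose i"
    using gbinomial_of_nat_symmetric[of s "s + i", where 'a = complex] by simp
  moreover have "signed_choose (- int r) i = of_nat (s + i) gchoose i"
    unfolding signed_choose_def gbinomial_signed_upper by (simp add: r add.commute)
  moreover have "(of_int (- (- int r - int i) - 1) :: complex) = of_nat (s + i)" by (simp add: r)
  moreover have "r - 1 = s" by (simp add: r)
  ultimately show ?thesis by (simp only:)
qed

lemma derivative_coefficient_nonneg:
  assumes "r \<ge> 1"
  shows "(of_int (- int i - 1) gchoose (r - 1) :: complex) = - (sign_power (- int r) * signed_choose (- int r) i)"
proof -
  obtain s where r: "r = Suc s" using assms by (metis Suc_le_D One_nat_def)
  have "(- 1) ^ s * ((of_int (- int i - 1) :: complex) gchoose s) = of_nat (s + i) gchoose s"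
    unfolding gbinomial_signed_upper by (simp add: add_ac)
  also have "\<dots> = signed_choose (- int r) i"
    using derivative_coefficient_neg[OF assms, of i] by (simp add: r add.commute)
  finally have "(- 1) ^ s * ((- 1) ^ s * ((of_int (- int i - 1) :: complex) gchoose s)) = (- 1) ^ s * signed_choose (- int r) i"
    by simp
  then have "((of_int (- int i - 1) :: complex) gchoose s) = (- 1) ^ s * signed_choose (- int r) i"
    by (simp flip: mult.assoc power_mult_distrib)
  moreover have "sign_power (- int r) = - ((- 1) ^ s)"
    using sign_power_diff_nat[of 0 r] by (simp add: r sign_power_def)
  ultimately show ?thesis by (simp add: r)
qed

lemma derivative_coefficient_gap:
  assumes "- int r < m" "m < 0"
  shows "(of_int (- m - 1) gchoose (r - 1) :: complex) = 0"
proof -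
  have "(of_int (- m - 1) :: complex) = of_nat (nat (- m - 1))" using assms by simp
  moreover have "nat (- m - 1) < r - 1" using assms by linarith
  ultimately show ?thesis by (simp only: gbinomial_nat_eq_0)
qed

section \<open>Finiteness and recursion for normally ordered products\<close>

context mode_module
begin

lemma normal_ordered_Nil [simp]: "normal_ordered act [] w = w"
  by (simp add: normal_ordered_def)

lemma normal_ordered_Cons_neg: "m < 0 \<Longrightarrow> normal_ordered act ((a, m) # xs) w = act a m (normal_ordered act xs w)"
  by (simp add: normal_ordered_def)

lemma nonneg_foldr_commute:
  assumes "\<forall>(b, k)\<in>set ys. k \<ge> 0" "m \<ge> 0"
  shows "act a m (foldr (\<lambda>(b, k). act b k) ys w) = foldr (\<lambda>(b, k). act b k) ys (act a m w)"
  using assms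
proof (induction ys)
  case (Cons y ys)
  obtain b k where y: "y = (b, k)" by (cases y)
  have "act a m (act b k v) = act b k (act a m v)" for v
    using act_nonneg_commute[of a "nat m" b "nat k" v] Cons.prems by (simp add: y)
  then show ?case using Cons by (simp add: y)
qed simp

text \<open>A nonnegative mode commutes with the nonnegative modes that stand to its right after
  ordering, so it may be applied to the vector at once.\<close>

lemma normal_ordered_Cons_nonneg:
  assumes "m \<ge> 0"
  shows "normal_ordered act ((a, m) # xs) w = normal_ordered act xs (act a m w)"
  using assms by (simp add: normal_ordered_def foldr_append) (subst nonneg_foldr_commute, auto)

lemma normal_ordered_zero [simp]: "normal_ordered act xs 0 = 0"
proof -
  have "foldr (\<lambda>(b, k). act b k) ys 0 = 0" for ys by (induction ys) auto
  then show ?thesis by (simp add: normal_ordered_def)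
qed

text \<open>Induction on the factors: a negative first mode leaves an even larger sum to the others,
  and a nonnegative one either kills \<open>w\<close> or is among finitely many, whose bounds have a
  maximum.\<close>

lemma normal_ordered_bound:
  "\<exists>N. \<forall>ms. length ms = length as \<longrightarrow> sum_list ms \<ge> N \<longrightarrow> normal_ordered act (zip as ms) w = 0"
proof (induction as arbitrary: w)
  case Nil
  show ?case by (intro exI[of _ 1]) simp
next
  case (Cons a as)
  obtain N where N: "\<And>v ms. length ms = length as \<Longrightarrow> sum_list ms \<ge> N v \<Longrightarrow> normal_ordered act (zip as ms) v = 0"
    using Cons.IH by metis
  obtain K where K: "\<And>i. i \<ge> K \<Longrightarrow> act a (int i) w = 0"
    using is_field_eventually[OF act_is_field, of a 0 w] by (auto simp: eventually_sequentially)
  define N' where "N' = Max (insert (N w) ((\<lambda>i. N (act a (int i) w) + int i) ` {..<K}))"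
  have "normal_ordered act (zip (a # as) ms) w = 0" if ms: "length ms = length (a # as)" "sum_list ms \<ge> N'" for ms
  proof -
    obtain m ms' where m: "ms = m # ms'" "length ms' = length as" using ms by (cases ms) auto
    show ?thesis
    proof (cases "m < 0")
      case True
      have "N w \<le> N'" unfolding N'_def by (intro Max_ge) auto
      then have "normal_ordered act (zip as ms') w = 0" using m ms True by (intro N) auto
      then show ?thesis using m True by (simp add: normal_ordered_Cons_neg)
    next
      case False
      have "normal_ordered act (zip as ms') (act a m w) = 0"
      proof (cases "nat m < K")
        case True
        then have "N (act a (int (nat m)) w) + int (nat m) \<le> N'"
          unfolding N'_def by (intro Max_ge insertI2 imageI) auto
        then show ?thesis using m ms False by (intro N) auto
      next
        case F: False
        then have "act a m w = 0" using K[of "nat m"] False by simp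
        then show ?thesis by simp
      qed
      then show ?thesis using m False by (simp add: normal_ordered_Cons_nonneg)
    qed
  qed
  then show ?case by blast
qed

text \<open>For a fixed total, a first mode is bounded above by truncation, and if negative it is
  bounded below because the others have a bounded sum; the rest is induction.\<close>

lemma normal_ordered_finite:
  "finite {ms. length ms = length as \<and> sum_list ms = s \<and> normal_ordered act (zip as ms) w \<noteq> 0}"
proof (induction as arbitrary: w s)
  case Nil
  have "{ms. length ms = length [] \<and> sum_list ms = s \<and> normal_ordered act (zip [] ms) w \<noteq> 0} \<subseteq> {[]}" by auto
  then show ?case by (rule finite_subset) simp
next
  case (Cons a as)
  obtain N where N: "\<And>ms. length ms = length as \<Longrightarrow> sum_list ms \<ge> N \<Longrightarrow> normal_ordered act (zip as ms) w = 0"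
    using normal_ordered_bound by blast
  obtain K where K: "\<And>i. i \<ge> K \<Longrightarrow> act a (int i) w = 0"
    using is_field_eventually[OF act_is_field, of a 0 w] by (auto simp: eventually_sequentially)
  let ?S = "\<lambda>s w. {ms. length ms = length as \<and> sum_list ms = s \<and> normal_ordered act (zip as ms) w \<noteq> 0}"
  have "{ms. length ms = length (a # as) \<and> sum_list ms = s \<and> normal_ordered act (zip (a # as) ms) w \<noteq> 0}
     \<subseteq> (\<Union>m\<in>{s - N..0}. (#) m ` ?S (s - m) w) \<union> (\<Union>m\<in>{0..int K}. (#) m ` ?S (s - m) (act a m w))"
  proof
    fix ms assume "ms \<in> {ms. length ms = length (a # as) \<and> sum_list ms = s \<and> normal_ordered act (zip (a # as) ms) w \<noteq> 0}"
    then have ms: "length ms = length (a # as)" "sum_list ms = s" "normal_ordered act (zip (a # as) ms) w \<noteq> 0" by auto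
    then obtain m ms' where m: "ms = m # ms'" "length ms' = length as" by (cases ms) auto
    show "ms \<in> (\<Union>m\<in>{s - N..0}. (#) m ` ?S (s - m) w) \<union> (\<Union>m\<in>{0..int K}. (#) m ` ?S (s - m) (act a m w))"
    proof (cases "m < 0")
      case True
      then have "normal_ordered act (zip as ms') w \<noteq> 0" using ms m by (auto simp: normal_ordered_Cons_neg)
      moreover from this have "sum_list ms' < N" using N m(2) not_le by blast
      ultimately have "m \<in> {s - N..0}" "ms' \<in> ?S (s - m) w" using m ms True by auto
      then show ?thesis unfolding m by blast
    next
      case False
      then have n: "normal_ordered act (zip as ms') (act a m w) \<noteq> 0" using ms m by (auto simp: normal_ordered_Cons_nonneg)
      have "\<not> nat m \<ge> K"
      proof
        assume "nat m \<ge> K"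
        then have "act a m w = 0" using K[of "nat m"] False by simp
        then show False using n by simp
      qed
      then have "m \<in> {0..int K}" "ms' \<in> ?S (s - m) (act a m w)" using m ms False n by auto
      then show ?thesis unfolding m by blast
    qed
  qed
  moreover have "finite \<dots>" using Cons.IH by (intro finite_UnI finite_UN_I finite_imageI) auto
  ultimately show ?case by (rule finite_subset)
qed

definition product_term :: "('a \<times> nat) list \<Rightarrow> int \<Rightarrow> int list \<Rightarrow> 'w \<Rightarrow> 'w" where
  "product_term xs n ms w =
     (if length ms = length xs \<and> sum_list ms + int (sum_list (map snd xs)) = n + 1
       then sc (prod_list (map2 (\<lambda>(a, r) m. of_int (- m - 1) gchoose (r - 1)) xs ms))
              (normal_ordered act (zip (map fst xs) ms) w)
       else 0)"

lemma field_product_eq: "field_product sc act xs n w = Sum_any (\<lambda>ms. product_term xs n ms w)"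
  by (simp add: field_product_def product_term_def)

lemma product_term_finite: "finite {ms. product_term xs n ms w \<noteq> 0}"
proof (rule finite_subset)
  show "{ms. product_term xs n ms w \<noteq> 0} \<subseteq> {ms. length ms = length (map fst xs) \<and>
      sum_list ms = n + 1 - int (sum_list (map snd xs)) \<and> normal_ordered act (zip (map fst xs) ms) w \<noteq> 0}"
    by (auto simp: product_term_def split: if_splits)
qed (rule normal_ordered_finite)

lemma product_term_bound: "\<exists>N. \<forall>n\<ge>N. \<forall>ms. product_term xs n ms w = 0"
proof -
  obtain N where N: "\<And>ms. length ms = length (map fst xs) \<Longrightarrow> sum_list ms \<ge> N \<Longrightarrow> normal_ordered act (zip (map fst xs) ms) w = 0"
    using normal_ordered_bound by blast
  have "product_term xs n ms w = 0" if "n \<ge> N + int (sum_list (map snd xs))" for n ms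
    using that by (auto simp: product_term_def intro!: disjI2 N)
  then show ?thesis by blast
qed

lemma product_term_Cons:
  "product_term ((a, r) # xs) n (m # ms) w =
     sc (of_int (- m - 1) gchoose (r - 1))
       (if m < 0 then act a m (product_term xs (n - m - int r) ms w) else product_term xs (n - m - int r) ms (act a m w))"
  by (auto simp: product_term_def normal_ordered_Cons_neg normal_ordered_Cons_nonneg act_scale)

lemma Sum_any_additive:
  fixes f :: "'w \<Rightarrow> 'w"
  assumes "\<And>x y. f (x + y) = f x + f y" and fin: "finite {i. g i \<noteq> 0}"
  shows "Sum_any (\<lambda>i. f (g i)) = f (Sum_any g)"
proof -
  have f0: "f 0 = 0" using assms(1)[of 0 0] by simp
  have "Sum_any (\<lambda>i. f (g i)) = (\<Sum>i\<in>{i. g i \<noteq> 0}. f (g i))"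
    by (rule Sum_any.expand_superset[OF fin]) (auto simp: f0)
  also have "(\<Sum>i\<in>I. f (g i)) = f (\<Sum>i\<in>I. g i)" for I
    by (induction I rule: infinite_finite_induct) (simp_all add: f0 assms(1))
  finally show ?thesis by (simp add: Sum_any.expand_set)
qed

text \<open>Sorting the sum by the first mode separates the creation part, the annihilation part and
  a gap with coefficient 0; the coefficients of the derivative are those of the n-th
  product.\<close>

lemma field_product_Cons:
  assumes r: "r \<ge> 1" and F: "\<And>q w. F q w = field_product sc act xs q w" "is_field F"
  shows "field_product sc act ((a, r) # xs) n w = nprod a (- int r) F n w"
proof -
  let ?g = "\<lambda>ms. product_term ((a, r) # xs) n ms w"
  obtain N where N: "\<And>k ms. k \<ge> N \<Longrightarrow> product_term xs k ms w = 0" using product_term_bound by blast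
  have "\<forall>\<^sub>F K in sequentially. (\<forall>i\<ge>K. F (n + int i) w = 0) \<and> (\<forall>i\<ge>K. act a (0 + int i) w = 0) \<and> K > nat (N - n)"
    by (intro eventually_conj is_field_eventually F) (simp_all add: eventually_gt_at_top)
  from eventually_happens'[OF sequentially_bot this] obtain K where
    K: "\<And>i. i \<ge> K \<Longrightarrow> F (n + int i) w = 0" "\<And>i. i \<ge> K \<Longrightarrow> act a (int i) w = 0" "K > nat (N - n)" by auto
  \<comment> \<open>First modes with \<open>m <= - r\<close>, with \<open>m >= 0\<close>, and those
    in the gap. The condition \<open>K > nat (N - n)\<close> makes \<open>?A\<close> long enough for
    all creation modes that contribute.\<close>
  let ?A = "(\<lambda>i. - int r - int i) ` {..<K}" and ?B = "int ` {..<K}" and ?C = "{- int r<..<0}"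
  have sub: "m \<in> ?A \<union> (?B \<union> ?C)" if "?g (m # ms) \<noteq> 0" for m ms
  proof (cases "m < 0")
    case True
    show ?thesis
    proof (cases "m \<le> - int r")
      case le: True
      have "product_term xs (n - m - int r) ms w \<noteq> 0" using that True by (auto simp: product_term_Cons)
      then have "n - m - int r < N" using N not_le by blast
      then have "nat (- m - int r) < K" using K(3) by linarith
      moreover have "m = - int r - int (nat (- m - int r))" using le by simp
      ultimately show ?thesis by blast
    qed (use True in auto)
  next
    case False
    have "act a m w \<noteq> 0"
    proof
      assume "act a m w = 0"
      moreover have "product_term xs k ms 0 = 0" for k by (simp add: product_term_def)
      ultimately show False using that False by (simp add: product_term_Cons)
    qed
    then have "nat m < K" using K(2)[of "nat m"] False by (cases "nat m < K") auto
    moreover have "m = int (nat m)" using False by simp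
    ultimately show ?thesis by blast
  qed
  let ?h = "\<lambda>m. Sum_any (\<lambda>ms. ?g (m # ms))"
  have "field_product sc act ((a, r) # xs) n w = sum ?h (?A \<union> (?B \<union> ?C))"
    unfolding field_product_eq
    by (rule Sum_any_lists[OF product_term_finite]) (use sub in \<open>auto simp: product_term_def\<close>)
  also have "\<dots> = sum ?h ?A + (sum ?h ?B + sum ?h ?C)"
    by (subst sum.union_disjoint; (subst sum.union_disjoint)?) (use r in auto)
  also have "sum ?h ?C = 0"
  proof (rule sum.neutral, intro ballI)
    fix m assume "m \<in> ?C"
    then have "?g (m # ms) = 0" for ms
      unfolding product_term_Cons by (subst derivative_coefficient_gap) auto
    then show "?h m = 0" by simp
  qed
  also have "sum ?h ?A = (\<Sum>i<K. ?h (- int r - int i))"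
    by (subst sum.reindex) (auto simp: inj_on_def)
  also have "\<dots> = (\<Sum>i<K. sc (signed_choose (- int r) i) (act a (- int r - int i) (F (n + int i) w)))"
  proof (intro sum.cong refl)
    fix i
    have "?g ((- int r - int i) # ms) = sc (signed_choose (- int r) i) (act a (- int r - int i) (product_term xs (n + int i) ms w))" for ms
      unfolding product_term_Cons derivative_coefficient_neg[OF r] using r by (auto simp: algebra_simps)
    then show "?h (- int r - int i) = sc (signed_choose (- int r) i) (act a (- int r - int i) (F (n + int i) w))"
      unfolding F(1) field_product_eq
      by (simp only: Sum_any_additive[where f = "\<lambda>x. sc (signed_choose (- int r) i) (act a (- int r - int i) x)", OF _ product_term_finite]
          act_add scale_right_distrib)
  qed
  also have "sum ?h ?B = (\<Sum>i<K. ?h (int i))"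
    by (subst sum.reindex) (auto simp: inj_on_def)
  also have "\<dots> = (\<Sum>i<K. sc (- (sign_power (- int r) * signed_choose (- int r) i)) (F (n + (- int r) - int i) (act a (int i) w)))"
  proof (intro sum.cong refl)
    fix i
    have "?g (int i # ms) = sc (- (sign_power (- int r) * signed_choose (- int r) i)) (product_term xs (n + (- int r) - int i) ms (act a (int i) w))" for ms
      unfolding product_term_Cons derivative_coefficient_nonneg[OF r] by (simp add: algebra_simps)
    then show "?h (int i) = sc (- (sign_power (- int r) * signed_choose (- int r) i)) (F (n + (- int r) - int i) (act a (int i) w))"
      unfolding F(1) field_product_eq
      by (simp only: Sum_any_additive[where f = "sc (- (sign_power (- int r) * signed_choose (- int r) i))", OF scale_right_distrib product_term_finite])
  qed
  also have "(\<Sum>i<K. sc (signed_choose (- int r) i) (act a (- int r - int i) (F (n + int i) w))) +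
     ((\<Sum>i<K. sc (- (sign_power (- int r) * signed_choose (- int r) i)) (F (n + (- int r) - int i) (act a (int i) w))) + 0) = nprod a (- int r) F n w"
    by (subst nprod_lessThan[OF F(2), where K = K]) (simp_all add: K sum_negf)
  finally show ?thesis .
qed

lemma field_product_Nil: "field_product sc act [] n w = identity_field n w"
proof -
  have "Sum_any (\<lambda>ms. product_term [] n ms w) = (\<Sum>ms\<in>{[]}. product_term [] n ms w)"
    by (rule Sum_any.expand_superset) (auto simp: product_term_def)
  then show ?thesis by (simp add: field_product_eq) (auto simp: product_term_def identity_field_def)
qed

text \<open>The coefficients \<open>signed_choose (- 1) i\<close> are all 1, and exactly one of the
  two sums contains \<open>a(q)\<close>: the first for \<open>q < 0\<close>, the second for
  \<open>q >= 0\<close>.\<close>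

lemma nprod_identity: "nprod a (- 1) identity_field = act a"
proof (intro ext)
  fix q w
  have "\<forall>\<^sub>F K in sequentially. nprod a (- 1) identity_field q w = act a q w"
    using nprod_eventually[OF identity_field_is_field, of a "- 1" q w]
      eventually_gt_at_top[of "nat (- 1 - q)"] eventually_gt_at_top[of "nat q"]
  proof eventually_elim
    case (elim K)
    have sb1: "signed_choose (- 1) i = 1" for i
      using gbinomial_signed_upper[of i "- 1"] by (simp add: signed_choose_def flip: binomial_gbinomial)
    have "(\<Sum>i<K. sc (signed_choose (- 1) i) (act a (- 1 - int i) (identity_field (q + int i) w)))
        = (\<Sum>i<K. if int i = - 1 - q then act a q w else 0)"
    proof (intro sum.cong refl)
      fix i
      have "- 1 - int i = q" if "q + int i = - 1" using that by simp
      then show "sc (signed_choose (- 1) i) (act a (- 1 - int i) (identity_field (q + int i) w)) =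
          (if int i = - 1 - q then act a q w else 0)"
        by (auto simp: identity_field_def sb1)
    qed
    also have "\<dots> = (\<Sum>i\<in>(if q < 0 then {nat (- 1 - q)} else {}). act a q w)"
      by (rule sum.mono_neutral_cong_right) (use elim in \<open>auto split: if_splits\<close>)
    finally have 1: "(\<Sum>i<K. sc (signed_choose (- 1) i) (act a (- 1 - int i) (identity_field (q + int i) w))) = (if q < 0 then act a q w else 0)"
      by simp
    have "(\<Sum>i<K. sc (sign_power (- 1) * signed_choose (- 1) i) (identity_field (q + (- 1) - int i) (act a (int i) w)))
        = (\<Sum>i<K. if int i = q then - act a q w else 0)"
      by (intro sum.cong refl) (auto simp: identity_field_def sb1 sign_power_def)
    also have "\<dots> = (\<Sum>i\<in>(if q \<ge> 0 then {nat q} else {}). - act a q w)"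
      by (rule sum.mono_neutral_cong_right) (use elim in \<open>auto split: if_splits\<close>)
    finally have 2: "(\<Sum>i<K. sc (sign_power (- 1) * signed_choose (- 1) i) (identity_field (q + (- 1) - int i) (act a (int i) w))) = (if q \<ge> 0 then - act a q w else 0)"
      by simp
    show ?case unfolding elim(1) 1 2 by simp
  qed
  then show "nprod a (- 1) identity_field q w = act a q w" by simp
qed

end

section \<open>Vertex algebra structures\<close>

lemma vertex_algebra_moduleI:
  assumes "vertex_algebra scaleV Y vac" "vector_space scaleW"
    and "\<And>n w. Vector_Spaces.linear scaleV scaleW (\<lambda>a. YW a n w)"
    and "\<And>a n. Vector_Spaces.linear scaleW scaleW (YW a n)"
    and "\<And>a w. \<exists>N. \<forall>n\<ge>N. YW a n w = 0"
    and "\<And>n w. YW vac n w = (if n = - 1 then w else 0)"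
    and "jacobi_identity scaleW Y YW"
  shows "vertex_algebra_module scaleV Y vac scaleW YW"
  unfolding vertex_algebra_module_def vertex_algebra_module_axioms_def using assms by blast

section \<open>Spanning of the induced module by creation words\<close>

context vacuum_setup
begin

abbreviation creation_word :: "('h poly \<times> nat) list \<Rightarrow> 'm" where
  "creation_word xs \<equiv> foldr (\<lambda>(a, r). mode rhoM a (- int r)) xs vac"

definition creation_words :: "'m set" where
  "creation_words = {creation_word xs | xs. \<forall>(a, r)\<in>set xs. r \<ge> 1}"

lemma creation_words_Cons: "v \<in> creation_words \<Longrightarrow> r \<ge> 1 \<Longrightarrow> mode rhoM a (- int r) v \<in> creation_words"
proof -
  assume "v \<in> creation_words" "r \<ge> 1"
  then obtain xs where "v = creation_word xs" "\<forall>(a, r)\<in>set ((a, r) # xs). r \<ge> 1"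
    by (auto simp: creation_words_def)
  then have "mode rhoM a (- int r) v = creation_word ((a, r) # xs) \<and> (\<forall>(a, r)\<in>set ((a, r) # xs). r \<ge> 1)"
    by simp
  then show ?thesis unfolding creation_words_def by blast
qed

text \<open>A negative mode prolongs a word. A nonnegative one is moved to the right, at the price
  of a shorter word for each central term, until it kills the vacuum.\<close>

lemma mode_span_creation: "v \<in> B.span creation_words \<Longrightarrow> mode rhoM a n v \<in> B.span creation_words"
proof -
  have words: "mode rhoM a n (creation_word xs) \<in> B.span creation_words"
    if "\<forall>(a, r)\<in>set xs. r \<ge> 1" for xs a n
    using that
  proof (induction xs arbitrary: a n)
    case Nil
    show ?case
    proof (cases "n \<ge> 0")
      case True
      then show ?thesis using mode_vac[of a "nat n"] B.span_zero by simp
    next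
      case False
      have "vac \<in> creation_words" unfolding creation_words_def by (auto intro!: exI[of _ "[]"])
      from creation_words_Cons[OF this, of "nat (- n)" a] show ?thesis
        using False by (auto intro: B.span_base)
    qed
  next
    case (Cons x xs)
    obtain b r where x: "x = (b, r)" by (cases x)
    have r: "r \<ge> 1" and xs: "\<forall>(a, r)\<in>set xs. r \<ge> 1" using Cons.prems by (auto simp: x)
    have w: "creation_word xs \<in> creation_words" using xs unfolding creation_words_def by blast
    have neg: "mode rhoM c (- int k) v \<in> B.span creation_words" if "k \<ge> 1" "v \<in> B.span creation_words" for c k v
      using that(2)
    proof (induction rule: B.span_induct_alt)
      case base
      show ?case using B.span_zero by simp
    next
      case (step e x y)
      then show ?case
        using creation_words_Cons[OF step(1) that(1), of c]
        by (simp add: M.act_add M.act_scale B.span_add B.span_scale B.span_base)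
    qed
    show ?case
    proof (cases "n < 0")
      case True
      then show ?thesis
        using neg[of "nat (- n)" "creation_word (x # xs)" a] B.span_base[OF creation_words_Cons[OF w r, of b]]
        by (simp add: x Suc_le_eq)
    next
      case False
      have "mode rhoM a n (creation_word (x # xs)) = mode rhoM b (- int r) (mode rhoM a n (creation_word xs))
         + (if n + - int r = 0 then scM (of_int n * kap a b) (creation_word xs) else 0)"
        by (simp add: x M.act_commute[of a n b "- int r"])
      also have "\<dots> \<in> B.span creation_words"
        using neg[OF r Cons.IH[OF xs]] w
        by (intro B.span_add) (auto intro: B.span_scale B.span_base B.span_zero)
      finally show ?thesis .
    qed
  qed
  show "v \<in> B.span creation_words \<Longrightarrow> ?thesis"
  proof (induction rule: B.span_induct_alt)
    case base
    show ?case using B.span_zero by simp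
  next
    case (step e x y)
    then have "mode rhoM a n x \<in> B.span creation_words" using words unfolding creation_words_def by blast
    then show ?case using step by (simp add: M.act_add M.act_scale B.span_add B.span_scale)
  qed
qed

lemma creation_words_span: "v \<in> B.span creation_words"
proof (induction v rule: vac_induct)
  case 1
  have "vac \<in> creation_words" unfolding creation_words_def by (auto intro!: exI[of _ "[]"])
  then show ?case by (rule B.span_base)
qed (auto intro: mode_span_creation B.span_add B.span_scale)

lemma creation_induct:
  assumes "P vac" "\<And>a r v. r \<ge> 1 \<Longrightarrow> P v \<Longrightarrow> P (mode rhoM a (- int r) v)"
    and "\<And>u v. P u \<Longrightarrow> P v \<Longrightarrow> P (u + v)" "\<And>c v. P v \<Longrightarrow> P (scM c v)"
  shows "P v"
proof -
  have words: "P (creation_word xs)" if "\<forall>(a, r)\<in>set xs. r \<ge> 1" for xs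
    using that by (induction xs) (use assms(1,2) in auto)
  show ?thesis
    using creation_words_span[of v]
  proof (induction rule: B.span_induct_alt)
    case base
    show ?case using assms(4)[OF assms(1), of 0] by simp
  next
    case (step e x y)
    then have "P x" using words unfolding creation_words_def by blast
    then show ?case using step assms by blast
  qed
qed

end

locale vacuum_rep = vacuum_setup scaleH form d u l scM rhoM vac + W: level_module scaleH form d u l scW rhoW
  for scaleH :: "complex \<Rightarrow> 'h::ab_group_add \<Rightarrow> 'h" and form d u l scM rhoM and vac :: "'m::ab_group_add"
    and scW :: "complex \<Rightarrow> 'w::ab_group_add \<Rightarrow> 'w" and rhoW
begin

abbreviation field_map :: "('m \<Rightarrow> int \<Rightarrow> 'w \<Rightarrow> 'w) \<Rightarrow> bool" where
  "field_map \<equiv> mode_field_map scM (mode rhoM) kap scW (mode rhoW) vac"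

lemma field_mapI:
  assumes "\<And>u v q w. Y (u + v) q w = Y u q w + Y v q w" "\<And>c v q w. Y (scM c v) q w = scW c (Y v q w)"
    and "Y vac = W.identity_field" "\<And>h n v. Y (mode rhoM h n v) = W.nprod h n (Y v)"
  shows "field_map Y"
proof
  show "P v" if "P vac" "\<And>h n v. P v \<Longrightarrow> P (mode rhoM h n v)" "\<And>u v. P u \<Longrightarrow> P v \<Longrightarrow> P (u + v)"
    "\<And>c v. P v \<Longrightarrow> P (scM c v)" for P v
    by (rule vac_induct[where P = P]) (use that in auto)
qed (use assms in auto)

theorem field_map_exists: "\<exists>Y. field_map Y"
proof -
  let ?sF = "\<lambda>c (F :: int \<Rightarrow> 'w \<Rightarrow> 'w) q w. scW c (F q w)"
  interpret F: vector_space ?sF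
    by unfold_locales (auto simp: fun_eq_iff W.scale_right_distrib W.scale_left_distrib)
  note simps = plus_fun_def zero_fun_def
  interpret T: vacuum_target scaleH form d u l scM rhoM vac ?sF W.nprod "{F. W.is_field F}" W.identity_field
  proof
    show "F.subspace {F. W.is_field F}"
      by (rule F.subspaceI) (auto simp: simps W.is_field_plus W.is_field_times, simp add: W.is_field_def)
    show "W.nprod a n (F + G) = W.nprod a n F + W.nprod a n G"
      if "F \<in> {F. W.is_field F}" "G \<in> {F. W.is_field F}" for F G a n
      using that by (simp add: simps fun_eq_iff W.nprod_add_field)
    show "W.nprod (a + b) n F = W.nprod a n F + W.nprod b n F" if "F \<in> {F. W.is_field F}" for F a b n
      using that by (simp add: simps fun_eq_iff W.nprod_add_left)
    show "W.nprod a m (W.nprod b n F) = W.nprod b n (W.nprod a m F) + (if m + n = 0 then ?sF (of_int m * kap a b) F else 0)"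
      if "F \<in> {F. W.is_field F}" for F a m b n
      using that W.nprod_commutator[of F a m b n] by (auto simp: simps fun_eq_iff)
    show "W.nprod a (int k) W.identity_field = 0" for a k
      by (simp add: simps fun_eq_iff W.nprod_identity_nonneg)
  qed (auto simp: fun_eq_iff W.nprod_scale_field W.nprod_scale_left)
  obtain Y where "\<forall>v w. Y (v + w) = Y v + Y w" "\<forall>c v. Y (scM c v) = ?sF c (Y v)"
    "Y vac = W.identity_field" "\<forall>a n v. Y (mode rhoM a n v) = W.nprod a n (Y v)"
    using T.universal_property by blast
  then have "field_map Y" by (intro field_mapI) auto
  then show ?thesis by blast
qed

lemma field_map_unique: "field_map Y \<Longrightarrow> field_map Y' \<Longrightarrow> Y = Y'"
proof
  fix v
  assume Y: "field_map Y" "field_map Y'"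
  interpret Y: mode_field_map scM "mode rhoM" kap scW "mode rhoW" vac Y by (rule Y)
  interpret Y': mode_field_map scM "mode rhoM" kap scW "mode rhoW" vac Y' by (rule Y)
  show "Y v = Y' v"
  proof (induction v rule: vac_induct)
    case 1
    show ?case by (simp only: Y.Y_vac Y'.Y_vac)
  next
    case (2 a n v)
    then show ?case by (simp only: Y.Y_act Y'.Y_act)
  qed (simp_all add: fun_eq_iff Y.Y_add Y'.Y_add Y.Y_scale Y'.Y_scale)
qed

lemma field_map_product_formula:
  assumes Y: "field_map Y"
  shows "has_field_product_formula rhoM vac scW rhoW Y"
proof -
  interpret Y: mode_field_map scM "mode rhoM" kap scW "mode rhoW" vac Y by (rule Y)
  have "Y (creation_word xs) n w = field_product scW (mode rhoW) xs n w" if "\<forall>(a, r)\<in>set xs. r \<ge> 1" for xs n w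
    using that
  proof (induction xs arbitrary: n w)
    case Nil
    show ?case by (simp add: Y.Y_vac W.field_product_Nil)
  next
    case (Cons x xs)
    obtain a r where x: "x = (a, r)" by (cases x)
    have "field_product scW (mode rhoW) ((a, r) # xs) n w = W.nprod a (- int r) (Y (creation_word xs)) n w"
      by (rule W.field_product_Cons) (use Cons x in auto)
    then show ?case by (simp add: x Y.Y_act)
  qed
  then show ?thesis unfolding has_field_product_formula_def by blast
qed

text \<open>Creation words span M(l), so linearity and the product formula leave room for one map
  only, and a field map already satisfies both.\<close>

lemma product_formula_field_map:
  assumes lin: "\<And>n b. Vector_Spaces.linear scM scW (\<lambda>a. Y a n b)"
    and "has_field_product_formula rhoM vac scW rhoW Y"
  shows "field_map Y"
proof -
  obtain Y' where Y': "field_map Y'" using field_map_exists by blast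
  interpret Y': mode_field_map scM "mode rhoM" kap scW "mode rhoW" vac Y' by (rule Y')
  have "Y v n w = Y' v n w" for v n w
    using creation_words_span[of v]
  proof (induction rule: B.span_induct_alt)
    case base
    show ?case using linear_scaleD[OF lin[of n w], of 0 0] by simp
  next
    case (step c x y)
    then have "Y x n w = Y' x n w"
      using assms(2) field_map_product_formula[OF Y']
      unfolding has_field_product_formula_def creation_words_def by auto
    then show ?case
      using step linear_addD[OF lin] linear_scaleD[OF lin] by (simp add: Y'.Y_add Y'.Y_scale)
  qed
  then have "Y = Y'" by (simp add: fun_eq_iff)
  then show ?thesis using Y' by simp
qed

end

section \<open>The vertex algebra structure on M(l)\<close>

context vacuum_setup
begin

sublocale MM: vacuum_rep scaleH form d u l scM rhoM vac scM rhoM ..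

abbreviation YM where "YM \<equiv> vacuum_module_Y scM rhoM vac"

text \<open>Supplies the existence and uniqueness behind the definite description in
  \<open>vacuum_module_Y\<close>.\<close>

lemma YM_field_map: "MM.field_map YM"
proof -
  obtain Y where Y: "MM.field_map Y" using MM.field_map_exists by blast
  interpret Y: mode_field_map scM "mode rhoM" kap scM "mode rhoM" vac Y by (rule Y)
  have "\<exists>!Y. (\<forall>n b. Vector_Spaces.linear scM scM (\<lambda>a. Y a n b)) \<and> has_field_product_formula rhoM vac scM rhoM Y"
  proof (rule ex1I[of _ Y])
    show "(\<forall>n b. Vector_Spaces.linear scM scM (\<lambda>a. Y a n b)) \<and> has_field_product_formula rhoM vac scM rhoM Y"
      using MM.field_map_product_formula[OF Y]
      by (auto intro!: linearI B.vector_space_axioms simp: Y.Y_add Y.Y_scale)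
    show "Y' = Y" if "(\<forall>n b. Vector_Spaces.linear scM scM (\<lambda>a. Y' a n b)) \<and> has_field_product_formula rhoM vac scM rhoM Y'" for Y'
      using that MM.field_map_unique[OF MM.product_formula_field_map Y] by blast
  qed
  from theI'[OF this] show ?thesis
    unfolding vacuum_module_Y_def[symmetric] by (intro MM.product_formula_field_map) auto
qed

sublocale YM: mode_field_map scM "mode rhoM" kap scM "mode rhoM" vac YM
  by (rule YM_field_map)

text \<open>On the vacuum and for \<open>q >= - 1\<close> the n-th product reduces to its first term
  with \<open>i = 0\<close>, since \<open>v(q + i)\<close> for \<open>i >= 1\<close> and all
  \<open>h(i)\<close> kill the vacuum. So the property passes from \<open>v\<close> to
  \<open>h(m) v\<close>.\<close>

lemma YM_creation: "(\<forall>n\<ge>0. YM v n vac = 0) \<and> YM v (- 1) vac = v"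
proof (induction v rule: vac_induct)
  case 1
  show ?case by (simp add: YM.Y_vac M.identity_field_def)
next
  case (2 h m v)
  have z: "mode rhoM h (int i) vac = 0" for i by (rule mode_vac)
  have "YM (mode rhoM h m v) q vac = (\<Sum>i<1. scM (signed_choose m i) (mode rhoM h (m - int i) (YM v (q + int i) vac)))" if "q \<ge> - 1" for q
    unfolding YM.Y_act using that 2
    by (subst M.nprod_lessThan[where K = 1]) (simp_all add: z z[of 0, simplified])
  then show ?case using 2 by simp
qed (simp_all add: YM.Y_add YM.Y_scale)

lemma vertex_algebra_M: "vertex_algebra scM YM vac"
proof -
  interpret P: mode_field_pair scM "mode rhoM" kap scM "mode rhoM" vac YM YM ..
  show ?thesis
  proof (intro vertex_algebra.intro vertex_algebra_axioms.intro)
    show "jacobi_identity scM YM YM" by (rule P.jacobi)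
    show "\<exists>N. \<forall>n\<ge>N. YM a n b = 0" for a b using B.is_field_bound[OF YM.Y_is_field] by blast
    show "Vector_Spaces.linear scM scM (YM a n)" for a n by (rule B.is_field_linear) simp
  qed (use YM_creation in \<open>auto intro!: linearI B.vector_space_axioms
    simp: YM.Y_add YM.Y_scale YM.Y_vac M.identity_field_def\<close>)
qed

end

section \<open>Module structures as homomorphisms into fields\<close>

context vacuum_rep
begin

lemma field_map_structure:
  assumes Y: "field_map Y"
  shows "vacuum_module_structure scM rhoM vac scW rhoW Y"
proof -
  interpret Y: mode_field_map scM "mode rhoM" kap scW "mode rhoW" vac Y by (rule Y)
  interpret P: mode_field_pair scM "mode rhoM" kap scW "mode rhoW" vac YM Y ..
  have "vertex_algebra_module scM YM vac scW Y"
  proof (rule vertex_algebra_moduleI)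
    show "vertex_algebra scM YM vac" by (rule vertex_algebra_M)
    show "jacobi_identity scW YM Y" by (rule P.jacobi)
    show "\<exists>N. \<forall>n\<ge>N. Y a n w = 0" for a w using W.is_field_bound[OF Y.Y_is_field] by blast
    show "Vector_Spaces.linear scW scW (Y a n)" for a n by (rule W.is_field_linear) simp
  qed (auto intro!: linearI B.vector_space_axioms W.vector_space_axioms simp: Y.Y_add Y.Y_scale Y.Y_vac W.identity_field_def)
  then show ?thesis
    by (simp add: vacuum_module_structure_def Y.Y_act Y.Y_vac W.nprod_identity)
qed

text \<open>For \<open>p = 0\<close> the right-hand side of the Jacobi identity has the single term
  \<open>i = 0\<close>, which exhibits the field of \<open>h(n) v\<close> as an n-th product. Hence
  a module structure is determined by the fields of the currents.\<close>

lemma structure_field_map: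
  assumes "vacuum_module_structure scM rhoM vac scW rhoW Y"
  shows "field_map Y"
proof (rule field_mapI)
  interpret S: vertex_algebra_module scM YM vac scW Y
    using assms by (simp add: vacuum_module_structure_def)
  have modes: "Y (mode rhoM a (- 1) vac) = mode rhoW a" for a
    using assms by (auto simp: vacuum_module_structure_def)
  show "Y (u + v) q w = Y u q w + Y v q w" for u v q w
    using linear_addD[OF S.YW_linear_left] .
  show Y_scale: "Y (scM c v) q w = scW c (Y v q w)" for c v q w
    using linear_scaleD[OF S.YW_linear_left] .
  show "Y vac = W.identity_field"
    by (simp add: fun_eq_iff S.YW_vacuum W.identity_field_def)
  show "Y (mode rhoM h n v) = W.nprod h n (Y v)" for h n v
  proof (intro ext)
    fix q w
    have act: "YM (mode rhoM h (- 1) vac) = mode rhoM h"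
      by (simp add: YM.Y_act YM.Y_vac M.nprod_identity)
    have "W.nprod h n (Y v) q w = Sum_any (\<lambda>i::nat. scW ((- 1) ^ i * (of_int n gchoose i))
          (Y (mode rhoM h (- 1) vac) (0 + n - int i) (Y v (q + int i) w)
            - scW ((- 1) powi n) (Y v (q + n - int i) (Y (mode rhoM h (- 1) vac) (0 + int i) w))))"
      by (simp add: W.nprod_def signed_choose_def sign_power_def modes)
    also have "\<dots> = Sum_any (\<lambda>i::nat. scW (of_int 0 gchoose i) (Y (YM (mode rhoM h (- 1) vac) (n + int i) v) (0 + q - int i) w))"
      using S.YW_jacobi unfolding jacobi_identity_def by blast
    also have "\<dots> = (\<Sum>i<1. scW (of_int 0 gchoose i) (Y (YM (mode rhoM h (- 1) vac) (n + int i) v) (0 + q - int i) w))"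
      by (rule Sum_any_lessThan) (simp add: gbinomial_0_left)
    finally show "Y (mode rhoM h n v) q w = W.nprod h n (Y v) q w" by (simp add: act)
  qed
qed

theorem module_structure:
  "\<exists>!Y. vacuum_module_structure scM rhoM vac scW rhoW Y"
  "vacuum_module_structure scM rhoM vac scW rhoW Y \<Longrightarrow> has_field_product_formula rhoM vac scW rhoW Y"
  using field_map_exists field_map_structure structure_field_map field_map_unique field_map_product_formula
  by metis+

end

text \<open>The grading is bounded below and \<open>a(n)\<close> lowers the degree by
  \<open>n\<close>, so on a given \<open>w\<close> one bound on \<open>n\<close> works for all
  currents \<open>a\<close> at once.\<close>

lemma restricted_graded_level_module:
  assumes "affine_lie scaleH form d u" and "restricted_graded_module scaleH form l scW rhoW W"
  shows "level_module scaleH form d u l scW rhoW"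
proof -
  interpret affine_lie scaleH form d u l by (rule assms)
  interpret level_module_base scaleH form d u l scW rhoW
    by unfold_locales (use assms(2) in \<open>simp add: restricted_graded_module_def\<close>)
  have level1: "rhoW (0, 1) w = scW l w" for w
    using assms(2) by (simp add: restricted_graded_module_def)
  show ?thesis
  proof
    show "rhoW (0, c) w = scW (l * c) w" for c w
    proof -
      have "affine_scale scaleH c (0, 1) = (0, c)"
        using affine_scale_single[of c 0 0 1] by simp
      then show ?thesis using rho_scale_left[of c "(0, 1)" w] by (simp add: level1 mult.commute)
    qed
    show "\<exists>N. \<forall>n\<ge>N. \<forall>a. mode rhoW a n w = 0" for w
    proof -
      obtain f where f: "\<And>n. f n \<in> W n" "finite {n. f n \<noteq> 0}" "w = Sum_any f"
        using assms(2) unfolding restricted_graded_module_def by metis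
      obtain N0 where N0: "\<And>n. n < int N0 \<Longrightarrow> W n = {0}"
        using assms(2) unfolding restricted_graded_module_def by blast
      have deg: "mode rhoW a n v \<in> W (m - n)" if "v \<in> W m" for a n m v
        using assms(2) that unfolding restricted_graded_module_def by blast
      have w: "w = (\<Sum>n\<in>{n. f n \<noteq> 0}. f n)" using f(3) by (simp add: Sum_any.expand_set)
      \<comment> \<open>All components of \<open>w\<close> have degree at most \<open>N - 1\<close>,
        so \<open>a(n)\<close> with \<open>n >= N\<close> maps them to negative degrees, where
        \<open>W\<close> is 0 because \<open>N0\<close> is a natural number.\<close>
      define N where "N = Max (insert 0 {n. f n \<noteq> 0}) + 1"
      have "mode rhoW a n w = 0" if "n \<ge> N" for a n
      proof -
        have "mode rhoW a n (f m) = 0" if m: "m \<in> {n. f n \<noteq> 0}" for m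
        proof -
          have "m \<le> Max (insert 0 {n. f n \<noteq> 0})" using f(2) m by (intro Max_ge) auto
          then have "m - n < int N0" using \<open>n \<ge> N\<close> by (simp add: N_def)
          then show ?thesis using deg[OF f(1), of a n m] N0 by auto
        qed
        then show ?thesis by (subst w) (simp add: mode_def rho_sum)
      qed
      then show ?thesis by blast
    qed
  qed
qed

section \<open>The polynomial model and the PBW basis\<close>

text \<open>A monomial in the variables \<open>x\<^bsub>i,j,n\<^esub>\<close>, standing for \<open>(u\<^sup>(\<^sup>i\<^sup>)t\<^sup>j)(-n)\<close>, is a multiset of
  indices, and a function on multisets is a formal, possibly infinite, combination of monomials.\<close>

type_synonym idx = "nat \<times> nat \<times> nat"

definition var_mult :: "idx \<Rightarrow> (idx multiset \<Rightarrow> complex) \<Rightarrow> idx multiset \<Rightarrow> complex" where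
  "var_mult x f S = (if x \<in># S then f (S - {#x#}) else 0)"

definition var_diff :: "idx \<Rightarrow> (idx multiset \<Rightarrow> complex) \<Rightarrow> idx multiset \<Rightarrow> complex" where
  "var_diff x f S = of_nat (count S x + 1) * f (add_mset x S)"

lemma var_mult_commute: "var_mult x (var_mult y f) = var_mult y (var_mult x f)"
proof (cases "x = y")
  case False
  then show ?thesis
    by (auto simp: var_mult_def fun_eq_iff add_mset_commute in_diff_count)
qed simp

lemma var_diff_commute: "var_diff x (var_diff y f) = var_diff y (var_diff x f)"
  by (cases "x = y") (auto simp: var_diff_def fun_eq_iff add_mset_commute)

lemma var_diff_mult: "var_diff x (var_mult y f) S = var_mult y (var_diff x f) S + (if x = y then f S else 0)"
proof (cases "x = y")
  case True
  show ?thesis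
  proof (cases "y \<in># S")
    case True
    then obtain T where "S = add_mset y T" by (metis multi_member_split)
    then show ?thesis using \<open>x = y\<close> by (simp add: var_diff_def var_mult_def algebra_simps)
  next
    case False
    moreover from False have "count S y = 0" by (simp add: not_in_iff)
    ultimately show ?thesis using True by (simp add: var_diff_def var_mult_def)
  qed
next
  case False
  show ?thesis
  proof (cases "y \<in># S")
    case True
    then obtain T where "S = add_mset y T" by (metis multi_member_split)
    then show ?thesis using False by (simp add: var_diff_def var_mult_def add_mset_commute[of x y])
  qed (use False in \<open>simp add: var_diff_def var_mult_def\<close>)
qed

text \<open>The Heisenberg representation: creation modes multiply by a variable, the others
  differentiate. The zero mode falls into the second branch and is 0 through the factor
  \<open>n\<close>.\<close>

definition elem_mode :: "complex \<Rightarrow> nat \<Rightarrow> nat \<Rightarrow> int \<Rightarrow> (idx multiset \<Rightarrow> complex) \<Rightarrow> idx multiset \<Rightarrow> complex" where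
  "elem_mode l i j n f S = (if n < 0 then var_mult (i, j, nat (- n)) f S
     else of_int n * l * var_diff (i, j, nat n) f S)"

lemma elem_mode_add: "elem_mode l i j n (\<lambda>S. f S + g S) S = elem_mode l i j n f S + elem_mode l i j n g S"
  by (simp add: elem_mode_def var_mult_def var_diff_def algebra_simps)

lemma elem_mode_scale: "elem_mode l i j n (\<lambda>S. c * f S) S = c * elem_mode l i j n f S"
  by (simp add: elem_mode_def var_mult_def var_diff_def)

lemma elem_mode_zero: "elem_mode l i j n (\<lambda>S. 0) S = 0"
  by (simp add: elem_mode_def var_mult_def var_diff_def)

lemma elem_mode_sum: "elem_mode l i j n (\<lambda>S. \<Sum>k\<in>I. f k S) S = (\<Sum>k\<in>I. elem_mode l i j n (f k) S)"
  by (induction I rule: infinite_finite_induct) (simp_all add: elem_mode_zero elem_mode_add)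

lemma elem_mode_commute:
  "elem_mode l i j m (elem_mode l i' j' n f) S = elem_mode l i' j' n (elem_mode l i j m f) S
     + (if m + n = 0 \<and> i = i' \<and> j = j' then of_int m * l * f S else 0)"
proof -
  have e: "elem_mode l i j m f = (if m < 0 then var_mult (i, j, nat (- m)) f else (\<lambda>S. of_int m * l * var_diff (i, j, nat m) f S))" for i j m f
    by (auto simp: elem_mode_def fun_eq_iff)
  have m: "var_mult x (\<lambda>S. c * f S) S = c * var_mult x f S" and d: "var_diff x (\<lambda>S. c * f S) S = c * var_diff x f S" for x c f S
    by (simp_all add: var_mult_def var_diff_def)
  consider "m < 0" "n < 0" | "m \<ge> 0" "n \<ge> 0" | "m < 0" "n \<ge> 0" | "m \<ge> 0" "n < 0" by linarith
  then show ?thesis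
  proof cases
    case 1
    then show ?thesis unfolding e by (simp add: var_mult_commute[of "(i, j, _)"])
  next
    case 2
    then show ?thesis unfolding e by (auto simp: d var_diff_commute[of "(i, j, _)"])
  next
    case 3
    have "(i', j', nat n) = (i, j, nat (- m)) \<longleftrightarrow> m + n = 0 \<and> i = i' \<and> j = j'" using 3 by auto
    moreover have "of_int n = (- of_int m :: complex)" if "m + n = 0"
      using that by (simp add: eq_neg_iff_add_eq_0 add.commute flip: of_int_add)
    ultimately show ?thesis using 3 unfolding e
      by (simp add: m var_diff_mult distrib_left)
  next
    case 4
    have "(i, j, nat m) = (i', j', nat (- n)) \<longleftrightarrow> m + n = 0 \<and> i = i' \<and> j = j'" using 4 by auto
    then show ?thesis using 4 unfolding e
      by (simp add: m var_diff_mult distrib_left)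
  qed
qed

section \<open>The Fock representation of the currents\<close>

context affine_lie
begin

definition fock_mode :: "'h poly \<Rightarrow> int \<Rightarrow> (idx multiset \<Rightarrow> complex) \<Rightarrow> idx multiset \<Rightarrow> complex" where
  "fock_mode a n f S = (\<Sum>j\<le>degree a. \<Sum>i=1..d. form (u i) (coeff a j) * elem_mode l i j n f S)"

lemma fock_mode_atMost:
  assumes "degree a \<le> k"
  shows "fock_mode a n f S = (\<Sum>j\<le>k. \<Sum>i=1..d. form (u i) (coeff a j) * elem_mode l i j n f S)"
  unfolding fock_mode_def using assms by (intro sum.mono_neutral_left) (auto simp: coeff_eq_0)

lemma fock_mode_add: "fock_mode a n (\<lambda>S. f S + g S) S = fock_mode a n f S + fock_mode a n g S"
  by (simp add: fock_mode_def elem_mode_add distrib_left sum.distrib)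

lemma fock_mode_scale: "fock_mode a n (\<lambda>S. c * f S) S = c * fock_mode a n f S"
  by (simp add: fock_mode_def elem_mode_scale sum_distrib_left mult_ac)

lemma fock_mode_add_left: "fock_mode (a + b) n f S = fock_mode a n f S + fock_mode b n f S"
proof -
  let ?k = "max (degree a) (degree b)"
  have "degree (a + b) \<le> ?k" by (simp add: degree_add_le_max)
  then show ?thesis
    by (simp add: fock_mode_atMost[of _ ?k] form_add_right distrib_right sum.distrib)
qed

lemma fock_mode_scale_left: "fock_mode (map_poly (scaleH c) a) n f S = c * fock_mode a n f S"
proof -
  have "degree (map_poly (scaleH c) a) \<le> degree a" by (rule degree_le) (simp add: coeff_eq_0)
  then show ?thesis
    by (simp add: fock_mode_atMost[of _ "degree a"] form_scale_right sum_distrib_left mult_ac)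
qed

text \<open>In the orthonormal basis the contractions are diagonal, and \<open>parseval\<close> sums
  them up to the form on currents.\<close>

lemma fock_mode_commute:
  "fock_mode a m (fock_mode b n f) S = fock_mode b n (fock_mode a m f) S
     + (if m + n = 0 then of_int m * kap a b * f S else 0)"
proof -
  let ?k = "max (degree a) (degree b)"
  let ?I = "{..?k} \<times> {1..d}"
  have e: "fock_mode c n f S = (\<Sum>(j, i)\<in>?I. form (u i) (coeff c j) * elem_mode l i j n f S)"
    if "degree c \<le> ?k" for c n f S
    using fock_mode_atMost[OF that] by (simp add: sum.cartesian_product)
  have e': "fock_mode c n f = (\<lambda>S. \<Sum>(j, i)\<in>?I. form (u i) (coeff c j) * elem_mode l i j n f S)"
    if "degree c \<le> ?k" for c n f
    using e[OF that] by (intro ext)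
  have two: "fock_mode c m (fock_mode c' n f) S = (\<Sum>(j, i)\<in>?I. \<Sum>(j', i')\<in>?I.
      form (u i) (coeff c j) * form (u i') (coeff c' j') * elem_mode l i j m (elem_mode l i' j' n f) S)"
    if "degree c \<le> ?k" "degree c' \<le> ?k" for c c' m n
    unfolding e[OF that(1)] e'[OF that(2)]
    by (simp add: case_prod_unfold elem_mode_sum elem_mode_scale sum_distrib_left mult_ac)
  have "fock_mode a m (fock_mode b n f) S = (\<Sum>(j, i)\<in>?I. \<Sum>(j', i')\<in>?I.
      form (u i) (coeff a j) * form (u i') (coeff b j') * elem_mode l i' j' n (elem_mode l i j m f) S)
    + (\<Sum>(j, i)\<in>?I. \<Sum>(j', i')\<in>?I. if j' = j \<and> i' = i then
        (if m + n = 0 then of_int m * l * f S * (form (u i) (coeff a j) * form (u i) (coeff b j)) else 0) else 0)"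
    unfolding two[OF max.cobounded1 max.cobounded2] case_prod_unfold sum.distrib[symmetric]
    by (intro sum.cong refl) (subst elem_mode_commute, auto simp: algebra_simps)
  also have "(\<Sum>(j, i)\<in>?I. \<Sum>(j', i')\<in>?I. if j' = j \<and> i' = i then
        (if m + n = 0 then of_int m * l * f S * (form (u i) (coeff a j) * form (u i) (coeff b j)) else 0) else 0)
     = (\<Sum>(j, i)\<in>?I. if m + n = 0 then of_int m * l * f S * (form (u i) (coeff a j) * form (u i) (coeff b j)) else 0)"
  proof (intro sum.cong refl, clarify)
    fix j i assume "j \<le> ?k" "i \<in> {1..d}"
    let ?v = "if m + n = 0 then of_int m * l * f S * (form (u i) (coeff a j) * form (u i) (coeff b j)) else 0"
    have "(\<Sum>(j', i')\<in>?I. if j' = j \<and> i' = i then ?v else 0) = (\<Sum>x\<in>?I. if x = (j, i) then ?v else 0)"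
      by (intro sum.cong refl) (simp add: case_prod_unfold prod_eq_iff)
    also have "\<dots> = ?v" using \<open>j \<le> ?k\<close> \<open>i \<in> {1..d}\<close> by (subst sum.delta) auto
    finally show "(\<Sum>(j', i')\<in>?I. if j' = j \<and> i' = i then ?v else 0) = ?v" .
  qed
  also have "\<dots> = (if m + n = 0 then of_int m * kap a b * f S else 0)"
    unfolding sum.cartesian_product[symmetric] kap_def
      current_form_atMost[OF max.cobounded1[of "degree a" "degree b"]] parseval[of "coeff a _"]
    by (simp add: sum_distrib_left sum_distrib_right mult_ac)
  also have "(\<Sum>(j, i)\<in>?I. \<Sum>(j', i')\<in>?I.
      form (u i) (coeff a j) * form (u i') (coeff b j') * elem_mode l i' j' n (elem_mode l i j m f) S)
     = fock_mode b n (fock_mode a m f) S"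
    unfolding two[OF max.cobounded2 max.cobounded1] case_prod_unfold
    by (subst sum.swap) (simp add: mult_ac)
  finally show ?thesis .
qed

definition valid_idx :: "idx set" where
  "valid_idx = {(i, j, n). i \<in> {1..d} \<and> n \<ge> 1}"

end

context level_module_base
begin

lemma mode_monom_add: "mode rho (monom (x + y) j) n w = mode rho (monom x j) n w + mode rho (monom y j) n w"
  by (simp add: mode_add_left flip: add_monom)

lemma mode_monom_scale: "mode rho (monom (scaleH c x) j) n w = sc c (mode rho (monom x j) n w)"
  by (simp add: map_poly_monom flip: mode_scale_left)

lemma mode_monom_sum: "mode rho (monom (\<Sum>i\<in>I. f i) j) n w = (\<Sum>i\<in>I. mode rho (monom (f i) j) n w)"
  by (induction I rule: infinite_finite_induct) (simp_all add: mode_monom_add)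

lemma mode_expansion:
  "mode rho a n w = (\<Sum>j\<le>degree a. \<Sum>i=1..d. sc (form (u i) (coeff a j)) (mode rho (monom (u i) j) n w))"
proof -
  have "mode rho a n w = mode rho (\<Sum>j\<le>degree a. monom (coeff a j) j) n w"
    by (simp add: poly_as_sum_of_monoms)
  also have "\<dots> = (\<Sum>j\<le>degree a. mode rho (monom (\<Sum>i=1..d. scaleH (form (u i) (coeff a j)) (u i)) j) n w)"
    by (simp only: mode_sum_left orthonormal_expansion[symmetric])
  finally show ?thesis by (simp add: mode_monom_sum mode_monom_scale)
qed

end

context vacuum_setup
begin

text \<open>The coefficients of a vector with respect to the PBW monomials, defined as the homomorphism from
  \<open>M(l)\<close> to the polynomial model before the PBW theorem is available.\<close>

definition fock_coeff :: "'m \<Rightarrow> idx multiset \<Rightarrow> complex" where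
  "fock_coeff = (SOME T. (\<forall>v w S. T (v + w) S = T v S + T w S) \<and> (\<forall>c v S. T (scM c v) S = c * T v S) \<and>
     T vac = (\<lambda>S. if S = {#} then 1 else 0) \<and> (\<forall>a n v. T (mode rhoM a n v) = fock_mode a n (T v)))"

lemma fock_coeff_exists: "\<exists>T. (\<forall>v w S. T (v + w) S = T v S + T w S) \<and> (\<forall>c v S. T (scM c v) S = c * T v S) \<and>
     T vac = (\<lambda>S. if S = {#} then 1 else 0) \<and> (\<forall>a n v. T (mode rhoM a n v) = fock_mode a n (T v))"
proof -
  let ?sF = "\<lambda>c (f :: idx multiset \<Rightarrow> complex) S. c * f S" and ?e = "\<lambda>S :: idx multiset. if S = {#} then 1 else 0 :: complex"
  interpret F: vector_space ?sF
    by unfold_locales (auto simp: fun_eq_iff algebra_simps)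
  note simps = plus_fun_def zero_fun_def
  interpret T: vacuum_target scaleH form d u l scM rhoM vac ?sF fock_mode UNIV ?e
  proof
    show "F.subspace UNIV" by (rule F.subspaceI) auto
    show "fock_mode a m (fock_mode b n f) = fock_mode b n (fock_mode a m f) + (if m + n = 0 then ?sF (of_int m * kap a b) f else 0)"
      for a m b n f
      by (auto simp: simps fun_eq_iff fock_mode_commute[of a m b n])
    show "fock_mode a (int k) ?e = 0" for a k
      by (simp add: fun_eq_iff fock_mode_def elem_mode_def var_diff_def)
  qed (auto simp: simps fun_eq_iff fock_mode_add fock_mode_scale fock_mode_add_left fock_mode_scale_left)
  obtain T where "\<forall>v w. T (v + w) = T v + T w" "\<forall>c v. T (scM c v) = ?sF c (T v)"
    "T vac = ?e" "\<forall>a n v. T (mode rhoM a n v) = fock_mode a n (T v)"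
    using T.universal_property by blast
  then show ?thesis by (intro exI[of _ T]) simp
qed

lemmas fock_coeff_props = someI_ex[OF fock_coeff_exists, folded fock_coeff_def]

lemma fock_coeff_add: "fock_coeff (v + w) S = fock_coeff v S + fock_coeff w S"
  and fock_coeff_scale: "fock_coeff (scM c v) S = c * fock_coeff v S"
  and fock_coeff_vac: "fock_coeff vac S = (if S = {#} then 1 else 0)"
  and fock_coeff_mode: "fock_coeff (mode rhoM a n v) S = fock_mode a n (fock_coeff v) S"
  using fock_coeff_props by auto

lemma fock_coeff_zero [simp]: "fock_coeff 0 S = 0"
  using fock_coeff_scale[of 0 0 S] by simp

lemma fock_coeff_sum: "fock_coeff (\<Sum>i\<in>I. f i) S = (\<Sum>i\<in>I. fock_coeff (f i) S)"
  by (induction I rule: infinite_finite_induct) (simp_all add: fock_coeff_add)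

lemma fock_coeff_mode_monom:
  assumes "i \<in> {1..d}"
  shows "fock_coeff (mode rhoM (monom (u i) j) n v) S = elem_mode l i j n (fock_coeff v) S"
proof -
  have "fock_coeff (mode rhoM (monom (u i) j) n v) S =
     (\<Sum>j'\<le>j. \<Sum>i'=1..d. form (u i') (coeff (monom (u i) j) j') * elem_mode l i' j' n (fock_coeff v) S)"
    unfolding fock_coeff_mode by (rule fock_mode_atMost) (rule degree_monom_le)
  also have "\<dots> = (\<Sum>j'\<le>j. if j' = j then elem_mode l i j n (fock_coeff v) S else 0)"
  proof (intro sum.cong refl)
    fix j'
    have "(\<Sum>i'=1..d. form (u i') (u i) * elem_mode l i' j n (fock_coeff v) S) = (\<Sum>i'=1..d. if i' = i then elem_mode l i j n (fock_coeff v) S else 0)"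
      by (intro sum.cong refl) (use assms H.u_orthonormal in auto)
    then show "(\<Sum>i'=1..d. form (u i') (coeff (monom (u i) j) j') * elem_mode l i' j' n (fock_coeff v) S) = (if j' = j then elem_mode l i j n (fock_coeff v) S else 0)"
      using assms by simp
  qed
  finally show ?thesis by simp
qed

section \<open>PBW words and coordinates\<close>

abbreviation pbw_word :: "idx list \<Rightarrow> 'm" where
  "pbw_word xs \<equiv> foldr (\<lambda>(i, j, n). mode rhoM (monom (u i) j) (- int n)) xs vac"

lemma fock_coeff_pbw_word: "set xs \<subseteq> valid_idx \<Longrightarrow> fock_coeff (pbw_word xs) S = (if S = mset xs then 1 else 0)"
proof (induction xs arbitrary: S)
  case Nil
  show ?case by (simp add: fock_coeff_vac)
next
  case (Cons x xs)
  obtain i j n where x: "x = (i, j, n)" by (cases x)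
  have v: "i \<in> {1..d}" "n \<ge> 1" using Cons.prems by (auto simp: x valid_idx_def)
  have "fock_coeff (pbw_word (x # xs)) S = var_mult x (fock_coeff (pbw_word xs)) S"
    using v by (simp add: x fock_coeff_mode_monom elem_mode_def)
  also have "\<dots> = (if S = mset (x # xs) then 1 else 0)"
    using Cons by (auto simp: var_mult_def) (metis insert_DiffM)
  finally show ?case .
qed

text \<open>Two creation modes have a negative total, so no central term arises and they
  commute.\<close>

lemma pbw_word_cong:
  assumes "mset xs = mset ys"
  shows "pbw_word xs = pbw_word ys"
proof -
  let ?f = "\<lambda>(i, j, n). mode rhoM (monom (u i) j) (- int n)"
  have "mode rhoM a (- int m) (mode rhoM b (- int n) v) = mode rhoM b (- int n) (mode rhoM a (- int m) v)" for a b m n v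
    by (subst M.act_commute) auto
  then have "?f x (?f y v) = ?f y (?f x v)" for x y v
    by (cases x, cases y) simp
  then have "fold ?f (rev xs) = fold ?f (rev ys)"
    using assms by (intro fold_multiset_equiv) (auto simp: fun_eq_iff)
  then show ?thesis by (simp add: foldr_conv_fold)
qed

abbreviation "Bas \<equiv> pbw_basis d u rhoM vac"

lemma pbw_basis_eq: "Bas = {pbw_word xs | xs. set xs \<subseteq> valid_idx}"
  unfolding pbw_basis_def valid_idx_def by (auto simp: subset_iff; blast)

lemma Bas_E:
  assumes "b \<in> Bas"
  obtains xs where "b = pbw_word xs" "set xs \<subseteq> valid_idx"
  using assms unfolding pbw_basis_eq by auto

lemma fock_coeff_distinguishes: "b \<in> Bas \<Longrightarrow> set xs \<subseteq> valid_idx \<Longrightarrow> fock_coeff b (mset xs) = (if b = pbw_word xs then 1 else 0)"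
proof -
  assume "b \<in> Bas" "set xs \<subseteq> valid_idx"
  then obtain ys where ys: "b = pbw_word ys" "set ys \<subseteq> valid_idx" by (rule_tac Bas_E)
  have "mset xs = mset ys \<longleftrightarrow> b = pbw_word xs"
    using pbw_word_cong[of xs ys] fock_coeff_pbw_word[OF \<open>set xs \<subseteq> valid_idx\<close>, of "mset ys"] fock_coeff_pbw_word[OF ys(2), of "mset ys"]
    by (auto simp: ys(1) split: if_splits)
  then show ?thesis using fock_coeff_pbw_word[OF ys(2), of "mset xs"] by (simp add: ys(1))
qed

text \<open>The coefficient at \<open>mset xs\<close> is a functional with value 1 on the word of
  \<open>xs\<close> and 0 on every other basis vector, so it reads off one coefficient of a linear
  relation.\<close>

lemma pbw_independent: "B.independent Bas"
  unfolding B.independent_explicit_module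
proof (intro allI impI)
  fix t c v
  assume t: "finite t" "t \<subseteq> Bas" "(\<Sum>v\<in>t. scM (c v) v) = 0" "v \<in> t"
  then obtain xs where xs: "v = pbw_word xs" "set xs \<subseteq> valid_idx" using Bas_E by blast
  have "0 = fock_coeff (\<Sum>v\<in>t. scM (c v) v) (mset xs)" by (simp add: t)
  also have "\<dots> = (\<Sum>w\<in>t. if w = v then c v else 0)"
    unfolding fock_coeff_sum fock_coeff_scale by (intro sum.cong refl) (use t fock_coeff_distinguishes xs in auto)
  also have "\<dots> = c v" using t by simp
  finally show "c v = 0" by simp
qed

lemma pbw_span: "v \<in> B.span Bas"
proof (induction v rule: creation_induct)
  case 1
  have "vac = pbw_word []" by simp
  then show ?case unfolding pbw_basis_eq by (intro B.span_base) (auto intro!: exI[of _ "[]"])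
next
  case (2 a r v)
  have w: "mode rhoM (monom (u i) j) (- int r) w \<in> B.span Bas" if i: "i \<in> {1..d}" and w: "w \<in> Bas" for i j w
  proof -
    obtain xs where xs: "w = pbw_word xs" "set xs \<subseteq> valid_idx" using w by (rule Bas_E)
    have "mode rhoM (monom (u i) j) (- int r) w = pbw_word ((i, j, r) # xs)" by (simp add: xs)
    moreover have "set ((i, j, r) # xs) \<subseteq> valid_idx" using xs 2 i by (auto simp: valid_idx_def)
    ultimately show ?thesis unfolding pbw_basis_eq by (intro B.span_base) blast
  qed
  have "mode rhoM (monom (u i) j) (- int r) v \<in> B.span Bas" if "i \<in> {1..d}" for i j
    using 2(2)
  proof (induction rule: B.span_induct_alt)
    case base
    show ?case using B.span_zero by simp
  next
    case (step e x y)
    then show ?case using w[OF that, of x j] by (simp add: M.act_add M.act_scale B.span_add B.span_scale)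
  qed
  then show ?case by (subst B.mode_expansion) (intro B.span_sum B.span_scale, auto)
qed (auto intro: B.span_add B.span_scale)

abbreviation "crd \<equiv> pbw_coord d u scM rhoM vac"

lemma crd_add: "crd (v + w) b = crd v b + crd w b"
  and crd_scale: "crd (scM c v) b = c * crd v b"
  and crd_outside: "b \<notin> Bas \<Longrightarrow> crd v b = 0"
  and crd_finite: "finite {b. crd v b \<noteq> 0}"
  and crd_expansion: "(\<Sum>b | crd v b \<noteq> 0. scM (crd v b) b) = v"
  and crd_basis: "b' \<in> Bas \<Longrightarrow> crd b' b = (if b = b' then 1 else 0)"
proof -
  show "crd (v + w) b = crd v b + crd w b"
    by (simp add: pbw_coord_def B.representation_add[OF pbw_independent pbw_span pbw_span])
  show "crd (scM c v) b = c * crd v b"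
    by (simp add: pbw_coord_def B.representation_scale[OF pbw_independent pbw_span])
  show "b \<notin> Bas \<Longrightarrow> crd v b = 0"
    using B.representation_ne_zero by (auto simp: pbw_coord_def)
  show "finite {b. crd v b \<noteq> 0}"
    by (simp add: pbw_coord_def B.finite_representation)
  show "(\<Sum>b | crd v b \<noteq> 0. scM (crd v b) b) = v"
    unfolding pbw_coord_def by (rule B.sum_nonzero_representation_eq[OF pbw_independent pbw_span])
  show "b' \<in> Bas \<Longrightarrow> crd b' b = (if b = b' then 1 else 0)"
    by (simp add: pbw_coord_def B.representation_basis[OF pbw_independent])
qed

lemma crd_zero [simp]: "crd 0 b = 0"
  using crd_scale[of 0 0 b] by simp

lemma crd_sum: "crd (\<Sum>i\<in>I. f i) b = (\<Sum>i\<in>I. crd (f i) b)"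
  by (induction I rule: infinite_finite_induct) (simp_all add: crd_add)

lemma crd_minus: "crd (- v) b = - crd v b"
  using crd_scale[of "-1" v b] by simp

lemma crd_diff: "crd (v - w) b = crd v b - crd w b"
  using crd_add[of v "- w"] by (simp add: crd_minus)

lemma fock_coeff_expansion: "fock_coeff v S = (\<Sum>b | crd v b \<noteq> 0. crd v b * fock_coeff b S)"
proof -
  have "fock_coeff (\<Sum>b | crd v b \<noteq> 0. scM (crd v b) b) S = (\<Sum>b | crd v b \<noteq> 0. crd v b * fock_coeff b S)"
    by (simp only: fock_coeff_sum fock_coeff_scale)
  then show ?thesis unfolding crd_expansion .
qed

text \<open>Links the coordinates of the theorem, which come from the basis, to the coefficients in
  the polynomial model, where the action of a mode is an explicit formula.\<close>

lemma crd_eq_C: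
  assumes "set xs \<subseteq> valid_idx"
  shows "crd v (pbw_word xs) = fock_coeff v (mset xs)"
proof -
  have "fock_coeff v (mset xs) = (\<Sum>b | crd v b \<noteq> 0. crd v b * fock_coeff b (mset xs))"
    by (rule fock_coeff_expansion)
  also have "\<dots> = (\<Sum>b | crd v b \<noteq> 0. if b = pbw_word xs then crd v (pbw_word xs) else 0)"
  proof (intro sum.cong refl)
    fix b
    show "crd v b * fock_coeff b (mset xs) = (if b = pbw_word xs then crd v (pbw_word xs) else 0)"
      by (cases "b \<in> Bas") (auto simp: fock_coeff_distinguishes assms crd_outside)
  qed
  also have "\<dots> = crd v (pbw_word xs)" using crd_finite by (simp add: sum.delta)
  finally show ?thesis by simp
qed

lemma crd_eqI: "(\<And>b. b \<in> Bas \<Longrightarrow> crd v b = crd w b) \<Longrightarrow> v = w"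
proof -
  assume "\<And>b. b \<in> Bas \<Longrightarrow> crd v b = crd w b"
  then have "crd v = crd w" using crd_outside by (metis ext)
  have "v = (\<Sum>b | crd v b \<noteq> 0. scM (crd v b) b)" by (rule crd_expansion[symmetric])
  also have "\<dots> = w" unfolding \<open>crd v = crd w\<close> by (rule crd_expansion)
  finally show ?thesis .
qed

lemma crd_inject: "crd v = crd w \<Longrightarrow> v = w"
  using crd_eqI by metis

lemma fock_coeff_eqI: "(\<And>S. fock_coeff v S = fock_coeff w S) \<Longrightarrow> v = w"
  by (rule crd_eqI) (metis Bas_E crd_eq_C)

lemma fock_coeff_valid: "fock_coeff v S \<noteq> 0 \<Longrightarrow> set_mset S \<subseteq> valid_idx"
proof -
  assume "fock_coeff v S \<noteq> 0"
  have "fock_coeff v S = (\<Sum>b | crd v b \<noteq> 0. crd v b * fock_coeff b S)"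
    by (rule fock_coeff_expansion)
  with \<open>fock_coeff v S \<noteq> 0\<close> have "(\<Sum>b | crd v b \<noteq> 0. crd v b * fock_coeff b S) \<noteq> 0" by simp
  then obtain b where "crd v b * fock_coeff b S \<noteq> 0" by (rule sum.not_neutral_contains_not_neutral)
  then have "crd v b \<noteq> 0" "fock_coeff b S \<noteq> 0" by auto
  then obtain xs where "b = pbw_word xs" "set xs \<subseteq> valid_idx" using crd_outside Bas_E by metis
  then show ?thesis using fock_coeff_pbw_word \<open>fock_coeff b S \<noteq> 0\<close> by (metis set_mset_mset)
qed

lemma fock_coeff_finite: "finite {S. fock_coeff v S \<noteq> 0}"
proof -
  have "\<exists>S0. b = b \<and> (\<forall>S. fock_coeff b S \<noteq> 0 \<longrightarrow> S = S0)" if "b \<in> Bas" for b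
    using Bas_E[OF that] fock_coeff_pbw_word by metis
  then obtain S0 where S0: "\<And>b S. b \<in> Bas \<Longrightarrow> fock_coeff b S \<noteq> 0 \<Longrightarrow> S = S0 b" by metis
  have "{S. fock_coeff v S \<noteq> 0} \<subseteq> S0 ` {b. crd v b \<noteq> 0}"
  proof
    fix S assume "S \<in> {S. fock_coeff v S \<noteq> 0}"
    moreover have "fock_coeff v S = (\<Sum>b | crd v b \<noteq> 0. crd v b * fock_coeff b S)"
      by (rule fock_coeff_expansion)
    ultimately have "(\<Sum>b | crd v b \<noteq> 0. crd v b * fock_coeff b S) \<noteq> 0" by simp
    then obtain b where "crd v b * fock_coeff b S \<noteq> 0" by (rule sum.not_neutral_contains_not_neutral)
    then have "crd v b \<noteq> 0" "fock_coeff b S \<noteq> 0" by auto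
    then show "S \<in> S0 ` {b. crd v b \<noteq> 0}" using S0 crd_outside by blast
  qed
  then show ?thesis using crd_finite finite_surj by blast
qed

text \<open>The monomial \<open>b\<close> involves finitely many variables, and a creation mode with
  a power \<open>t^j\<close> beyond all of them produces only monomials that contain a different
  variable. This removes the creation part from all tails in \<open>j\<close>.\<close>

lemma crd_creation_bound: "\<exists>J. \<forall>j\<ge>J. \<forall>i\<in>{1..d}. \<forall>n\<ge>1. \<forall>v. crd (mode rhoM (monom (u i) j) (- int n) v) b = 0"
proof (cases "b \<in> Bas")
  case True
  then obtain xs where xs: "b = pbw_word xs" "set xs \<subseteq> valid_idx" by (rule Bas_E)
  define J where "J = Suc (Max (insert 0 ((\<lambda>(i, j, n). j) ` set xs)))"
  have "crd (mode rhoM (monom (u i) j) (- int n) v) b = 0" if "j \<ge> J" "i \<in> {1..d}" "n \<ge> 1" for i j n v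
  proof -
    have "(i, j, n) \<notin> set xs"
    proof
      assume "(i, j, n) \<in> set xs"
      then have "j \<le> Max (insert 0 ((\<lambda>(i, j, n). j) ` set xs))" by (intro Max_ge) force+
      then show False using that by (simp add: J_def)
    qed
    then show ?thesis
      using that by (simp add: xs crd_eq_C fock_coeff_mode_monom elem_mode_def var_mult_def)
  qed
  then show ?thesis by blast
qed (use crd_outside in blast)

text \<open>The vector is built from finitely many currents, and \<open>x t^j\<close> is orthogonal
  to each of them once \<open>j\<close> exceeds their degrees.\<close>

lemma annihilation_bound: "\<exists>J. \<forall>j\<ge>J. \<forall>x n. mode rhoM (monom x j) (int n) v = 0"
proof (induction v rule: creation_induct)
  case 1
  then show ?case by (simp add: mode_vac)
next
  case (2 a r v)
  then obtain J where J: "\<And>j x n. j \<ge> J \<Longrightarrow> mode rhoM (monom x j) (int n) v = 0" by blast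
  have "mode rhoM (monom x j) (int n) (mode rhoM a (- int r) v) = 0" if "j \<ge> max J (Suc (degree a))" for j x n
  proof -
    have "current_form form (monom x j) a = (\<Sum>i\<le>j. form (coeff (monom x j) i) (coeff a i))"
      by (rule current_form_atMost) (rule degree_monom_le)
    also have "\<dots> = 0"
      by (intro sum.neutral) (use that in \<open>auto simp: coeff_eq_0\<close>)
    finally show ?thesis using J that by (subst M.act_commute) (simp add: kap_def)
  qed
  then show ?case by blast
next
  case (3 v w)
  then obtain J J' where "\<And>j x n. j \<ge> J \<Longrightarrow> mode rhoM (monom x j) (int n) v = 0"
    "\<And>j x n. j \<ge> J' \<Longrightarrow> mode rhoM (monom x j) (int n) w = 0" by blast
  then have "\<forall>j\<ge>max J J'. \<forall>x n. mode rhoM (monom x j) (int n) (v + w) = 0" by (simp add: M.act_add)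
  then show ?case by blast
next
  case (4 c v)
  then show ?case by (auto simp: M.act_scale)
qed

text \<open>A zero mode commutes with all modes, as the central term carries the factor 0, and it
  kills the vacuum.\<close>

lemma mode_zero_M: "mode rhoM a 0 v = 0"
proof (induction v rule: vac_induct)
  case 1
  then show ?case using mode_vac[of a 0] by simp
next
  case (2 b n v)
  then show ?case by (subst M.act_commute) simp
qed (simp_all add: M.act_add M.act_scale)

end

section \<open>The modules \<open>W(\<lambda>, c, l)\<close>\<close>

locale twisted_setup = vacuum_setup scaleH form d u l scM rhoM vac
  for scaleH :: "complex \<Rightarrow> 'h::ab_group_add \<Rightarrow> 'h" and form d u l scM rhoM and vac :: "'m::ab_group_add" +
  fixes lam :: "'h \<Rightarrow> complex" and c :: complex
  assumes lam_linear: "Vector_Spaces.linear scaleH (*) lam"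
begin

abbreviation rhoT where "rhoT \<equiv> twisted_action scM rhoM lam c"

abbreviation chi :: "'h poly \<Rightarrow> complex" where "chi \<equiv> evaluation_character lam c"

lemma lam_add: "lam (x + y) = lam x + lam y" and lam_scale: "lam (scaleH t x) = t * lam x"
  using linear_addD[OF lam_linear] linear_scaleD[OF lam_linear] by auto

lemma lam_zero [simp]: "lam 0 = 0"
  using lam_scale[of 0 0] by simp

lemma chi_add: "chi (a + b) = chi a + chi b"
proof -
  have "map_poly lam (a + b) = map_poly lam a + map_poly lam b"
    by (rule poly_eqI) (simp add: coeff_map_poly lam_add)
  then show ?thesis by (simp add: evaluation_character_def)
qed

lemma chi_scale: "chi (map_poly (scaleH t) a) = t * chi a"
proof -
  have "map_poly lam (map_poly (scaleH t) a) = smult t (map_poly lam a)"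
    by (rule poly_eqI) (simp add: coeff_map_poly lam_scale)
  then show ?thesis by (simp add: evaluation_character_def)
qed

lemma chi_zero [simp]: "chi 0 = 0"
  by (simp add: evaluation_character_def)

lemma chi_monom: "chi (monom x j) = lam x * c ^ j"
  by (simp add: evaluation_character_def map_poly_monom poly_monom)

text \<open>Zero modes vanish on M(l), so removing them in \<open>twisted_action\<close> changes
  nothing, and the twisted action is \<open>rhoM\<close> plus a scalar character.\<close>

lemma twisted_eq: "rhoT x w = rhoM x w + scM (chi (Poly_Mapping.lookup (fst x) 0)) w"
proof -
  have "x = (fst x - Poly_Mapping.single 0 (Poly_Mapping.lookup (fst x) 0), snd x)
      + (Poly_Mapping.single 0 (Poly_Mapping.lookup (fst x) 0), 0)"
    by (simp add: prod_eq_iff)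
  then have "rhoM x w = rhoM (fst x - Poly_Mapping.single 0 (Poly_Mapping.lookup (fst x) 0), snd x) w
      + mode rhoM (Poly_Mapping.lookup (fst x) 0) 0 w"
    unfolding mode_def by (metis B.rho_add_left)
  then show ?thesis by (simp add: twisted_action_def mode_zero_M)
qed

lemma mode_twisted: "mode rhoT a n w = (if n = 0 then scM (chi a) w else mode rhoM a n w)"
proof (cases "n = 0")
  case True
  then show ?thesis using mode_zero_M[of a w] by (simp add: mode_def twisted_eq)
next
  case False
  then show ?thesis by (simp add: mode_def twisted_eq lookup_single)
qed

text \<open>Adding a character that vanishes on brackets preserves the module axioms. This one does:
  brackets are central, so they have no zero-mode component.\<close>

lemma twisted_lie_module: "lie_module (affine_scale scaleH) (affine_bracket form) scM rhoT"
  unfolding lie_module_def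
proof (intro conjI allI)
  show "Vector_Spaces.linear scM scM (rhoT x)" for x
    by (intro linearI B.vector_space_axioms)
      (simp_all add: twisted_eq B.rho_add B.rho_scale B.scale_right_distrib mult.commute add_ac)
  have sc: "Poly_Mapping.lookup (fst (affine_scale scaleH t x)) 0 = map_poly (scaleH t) (Poly_Mapping.lookup (fst x) 0)" for t x
    by (simp add: affine_scale_def Poly_Mapping.map.rep_eq when_def)
  show "Vector_Spaces.linear (affine_scale scaleH) scM (\<lambda>x. rhoT x w)" for w
    by (intro linearI B.vector_space_axioms B.affine_vector_space)
      (simp_all add: twisted_eq B.rho_add_left B.rho_scale_left lookup_add chi_add chi_scale sc
        B.scale_left_distrib B.scale_right_distrib add_ac)
  show "rhoT (affine_bracket form x y) w = rhoT x (rhoT y w) - rhoT y (rhoT x w)" for x y w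
  proof -
    have "rhoT (affine_bracket form x y) w = rhoM x (rhoM y w) - rhoM y (rhoM x w)"
      unfolding twisted_eq B.rho_bracket by (simp add: affine_bracket_def)
    then show ?thesis
      by (simp add: twisted_eq B.rho_add B.rho_scale B.scale_right_distrib mult.commute)
  qed
qed

lemma twisted_level: "rhoT (0, t) w = scM (l * t) w"
  by (simp add: twisted_eq level_M)

sublocale TB: level_module_base scaleH form d u l scM rhoT
  by unfold_locales (rule twisted_lie_module)

sublocale T: level_module scaleH form d u l scM rhoT
proof
  show "\<exists>N. \<forall>n\<ge>N. \<forall>a. mode rhoT a n w = 0" for w
  proof -
    obtain N where "\<And>n a. n \<ge> N \<Longrightarrow> mode rhoM a n w = 0" using M.smooth by blast
    then have "\<forall>n\<ge>max N 1. \<forall>a. mode rhoT a n w = 0" by (auto simp: mode_twisted)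
    then show ?thesis by blast
  qed
qed (rule twisted_level)

sublocale R: vacuum_rep scaleH form d u l scM rhoM vac scM rhoT ..

section \<open>The grading by weight and irreducibility\<close>

definition weight :: "idx multiset \<Rightarrow> int" where
  "weight S = int (\<Sum>(i, j, n)\<in>#S. n)"

lemma weight_add: "weight (add_mset (i, j, n) S) = weight S + int n"
  by (simp add: weight_def)

lemma weight_nonneg: "weight S \<ge> 0"
  unfolding weight_def by (rule of_nat_0_le_iff)

definition grade :: "int \<Rightarrow> 'm set" where
  "grade n = {v. \<forall>S. fock_coeff v S \<noteq> 0 \<longrightarrow> weight S = n}"

lemma C_Sum_any:
  assumes "\<And>n. f n \<in> grade n" "finite {n. f n \<noteq> 0}"
  shows "fock_coeff (Sum_any f) S = fock_coeff (f (weight S)) S"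
proof -
  have "fock_coeff (Sum_any f) S = (\<Sum>n | f n \<noteq> 0. fock_coeff (f n) S)" by (simp add: Sum_any.expand_set fock_coeff_sum)
  also have "\<dots> = (\<Sum>n | f n \<noteq> 0. if n = weight S then fock_coeff (f (weight S)) S else 0)"
    by (intro sum.cong refl) (use assms(1) in \<open>auto simp: grade_def\<close>)
  also have "\<dots> = fock_coeff (f (weight S)) S" using assms(2) by simp
  finally show ?thesis .
qed

lemma grade_decomposition: "\<exists>!f. (\<forall>n. f n \<in> grade n) \<and> finite {n. f n \<noteq> 0} \<and> v = Sum_any f"
proof -
  have "\<exists>g. \<forall>S. fock_coeff b S \<noteq> 0 \<longrightarrow> weight S = g" if "b \<in> Bas" for b
    using Bas_E[OF that] fock_coeff_pbw_word by metis
  \<comment> \<open>A basis vector is a single monomial and so has a single weight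
    \<open>g b\<close>; the components of \<open>v\<close> collect its basis vectors by
    weight.\<close>
  then obtain g where g: "\<And>b S. b \<in> Bas \<Longrightarrow> fock_coeff b S \<noteq> 0 \<Longrightarrow> weight S = g b" by metis
  define f where "f n = (\<Sum>b | crd v b \<noteq> 0. if g b = n then scM (crd v b) b else 0)" for n
  have Cf: "fock_coeff (f n) S = (if weight S = n then fock_coeff v S else 0)" for n S
  proof -
    have "fock_coeff (f n) S = (\<Sum>b | crd v b \<noteq> 0. if weight S = n then crd v b * fock_coeff b S else 0)"
      unfolding f_def fock_coeff_sum
    proof (intro sum.cong refl)
      fix b assume "b \<in> {b. crd v b \<noteq> 0}"
      then have "b \<in> Bas" using crd_outside by blast
      then show "fock_coeff (if g b = n then scM (crd v b) b else 0) S = (if weight S = n then crd v b * fock_coeff b S else 0)"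
        using g[of b S] by (auto simp: fock_coeff_scale)
    qed
    then show ?thesis by (simp add: fock_coeff_expansion[of v S])
  qed
  have fin: "finite {n. f n \<noteq> 0}"
  proof (rule finite_subset)
    show "{n. f n \<noteq> 0} \<subseteq> weight ` {S. fock_coeff v S \<noteq> 0}"
    proof
      fix n assume "n \<in> {n. f n \<noteq> 0}"
      then obtain S where "fock_coeff (f n) S \<noteq> 0" using fock_coeff_eqI[of "f n" 0] by auto
      then have "fock_coeff v S \<noteq> 0" "n = weight S" by (auto simp: Cf split: if_splits)
      then show "n \<in> weight ` {S. fock_coeff v S \<noteq> 0}" by blast
    qed
  qed (intro finite_imageI fock_coeff_finite)
  have fg: "f n \<in> grade n" for n by (auto simp: grade_def Cf split: if_splits)
  show ?thesis
  proof (rule ex1I[of _ f])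
    show "(\<forall>n. f n \<in> grade n) \<and> finite {n. f n \<noteq> 0} \<and> v = Sum_any f"
      using fin fg by (auto intro!: fock_coeff_eqI simp: C_Sum_any[OF fg fin] Cf)
    fix f' assume f': "(\<forall>n. f' n \<in> grade n) \<and> finite {n. f' n \<noteq> 0} \<and> v = Sum_any f'"
    have "fock_coeff (f' n) S = fock_coeff (f n) S" for n S
    proof (cases "weight S = n")
      case True
      then show ?thesis using C_Sum_any[of f' S] f' by (simp add: Cf)
    next
      case False
      then have "fock_coeff (f' n) S = 0" using f' by (auto simp: grade_def)
      then show ?thesis using False by (simp add: Cf)
    qed
    then show "f' = f" by (intro ext fock_coeff_eqI)
  qed
qed

lemma mode_grade:
  assumes v: "v \<in> grade m"
  shows "mode rhoT a n v \<in> grade (m - n)"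
proof (cases "n = 0")
  case True
  then show ?thesis using v by (auto simp: mode_twisted grade_def fock_coeff_scale)
next
  case False
  have "weight S = m - n" if "fock_coeff (mode rhoM a n v) S \<noteq> 0" for S
  proof -
    have "(\<Sum>j\<le>degree a. \<Sum>i=1..d. form (u i) (coeff a j) * elem_mode l i j n (fock_coeff v) S) \<noteq> 0"
      using that by (simp add: fock_coeff_mode fock_mode_def)
    then obtain j where "(\<Sum>i=1..d. form (u i) (coeff a j) * elem_mode l i j n (fock_coeff v) S) \<noteq> 0"
      by (rule sum.not_neutral_contains_not_neutral)
    then obtain i where "form (u i) (coeff a j) * elem_mode l i j n (fock_coeff v) S \<noteq> 0"
      by (rule sum.not_neutral_contains_not_neutral)
    then have e: "elem_mode l i j n (fock_coeff v) S \<noteq> 0" by auto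
    show ?thesis
    proof (cases "n < 0")
      case True
      then have "(i, j, nat (- n)) \<in># S" "fock_coeff v (S - {#(i, j, nat (- n))#}) \<noteq> 0"
        using e by (auto simp: elem_mode_def var_mult_def split: if_splits)
      moreover from this obtain T where "S = add_mset (i, j, nat (- n)) T" by (metis multi_member_split)
      ultimately show ?thesis using v True by (auto simp: grade_def weight_add)
    next
      case F: False
      then have "fock_coeff v (add_mset (i, j, nat n) S) \<noteq> 0"
        using e by (auto simp: elem_mode_def var_diff_def)
      then have "weight (add_mset (i, j, nat n) S) = m" using v by (auto simp: grade_def)
      then show ?thesis using F by (simp add: weight_add)
    qed
  qed
  then show ?thesis using False by (simp add: mode_twisted grade_def)
qed

lemma twisted_restricted_graded: "restricted_graded_module scaleH form l scM rhoT grade"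
  unfolding restricted_graded_module_def
proof (intro conjI allI ballI impI)
  show "B.subspace (grade n)" for n
    by (rule B.subspaceI) (auto simp: grade_def fock_coeff_add fock_coeff_scale, metis add.right_neutral)
  show "rhoT (0, 1) w = scM l w" for w by (simp add: twisted_level)
  show "finite {i. mode rhoT (monom x i) n w \<noteq> 0}" if "1 \<le> n" for w n x
  proof -
    obtain J where J: "\<And>j x n. j \<ge> J \<Longrightarrow> mode rhoM (monom x j) (int n) w = 0"
      using annihilation_bound[of w] by blast
    have "{i. mode rhoT (monom x i) n w \<noteq> 0} \<subseteq> {..<J}"
      using J[of _ x "nat n"] that by (auto simp: mode_twisted not_le[symmetric])
    then show ?thesis by (rule finite_subset) simp
  qed
  have "grade n = {0}" if "n < 0" for n
  proof -
    have "v = 0" if "v \<in> grade n" for v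
    proof (rule fock_coeff_eqI)
      show "fock_coeff v S = fock_coeff 0 S" for S using that \<open>n < 0\<close> weight_nonneg[of S] by (auto simp: grade_def)
    qed
    then show ?thesis by (auto simp: grade_def)
  qed
  then show "\<exists>N::nat. \<forall>n<int N. grade n = {0}" by (intro exI[of _ 0]) simp
qed (use twisted_lie_module grade_decomposition mode_grade in auto)

text \<open>In a nonzero submodule take a vector and one of its monomials \<open>T0\<close> with the
  most factors. The annihilation modes belonging to the factors of \<open>T0\<close> turn the vector
  into a nonzero multiple of the vacuum, which generates everything.\<close>

lemma twisted_irreducible:
  assumes l: "l \<noteq> 0" and Y: "vacuum_module_structure scM rhoM vac scM rhoT YW"
  shows "irreducible_module scM YW"
  unfolding irreducible_module_def
proof (intro conjI allI impI)
  have "vac \<noteq> 0"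
  proof
    assume "vac = 0"
    then have "fock_coeff vac {#} = fock_coeff 0 {#}" by (rule arg_cong[where f = "\<lambda>v. fock_coeff v {#}"])
    then show False unfolding fock_coeff_vac fock_coeff_zero by simp
  qed
  then show "(UNIV :: 'm set) \<noteq> {0}" by blast
  fix S assume S: "B.subspace S \<and> (\<forall>a n. \<forall>w\<in>S. YW a n w \<in> S)"
  have modes: "mode rhoM a n w \<in> S" if "w \<in> S" for a n w
  proof (cases "n = 0")
    case True
    then show ?thesis using S B.subspace_0 by (simp add: mode_zero_M)
  next
    case False
    have "YW (mode rhoM a (- 1) vac) n = mode rhoT a n"
      using Y by (simp add: vacuum_module_structure_def)
    then have "mode rhoT a n w \<in> S" using S that by metis
    then show ?thesis using False by (simp add: mode_twisted)
  qed
  show "S = {0} \<or> S = UNIV"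
  proof (cases "S = {0}")
    case False
    then obtain w where w: "w \<in> S" "w \<noteq> 0" using S B.subspace_0 by blast
    then obtain S1 where "fock_coeff w S1 \<noteq> 0" using fock_coeff_eqI[of w 0] by auto
    have ne: "{S. fock_coeff w S \<noteq> 0} \<noteq> {}" using \<open>fock_coeff w S1 \<noteq> 0\<close> by blast
    have "\<exists>T\<in>{S. fock_coeff w S \<noteq> 0}. \<forall>S\<in>{S. fock_coeff w S \<noteq> 0}. size S \<le> size T"
    proof -
      let ?m = "Max (size ` {S. fock_coeff w S \<noteq> 0})"
      have "?m \<in> size ` {S. fock_coeff w S \<noteq> 0}" using ne fock_coeff_finite by (intro Max_in) auto
      then obtain T where "T \<in> {S. fock_coeff w S \<noteq> 0}" "?m = size T" by blast
      then show ?thesis using fock_coeff_finite by (metis (no_types, lifting) Max_ge finite_imageI imageI)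
    qed
    then obtain T0 where T0: "fock_coeff w T0 \<noteq> 0" "\<And>S. fock_coeff w S \<noteq> 0 \<Longrightarrow> size S \<le> size T0" by blast
    \<comment> \<open>The scalar \<open>k\<close> is a product of factors \<open>n l\<close> and of
      multiplicities, hence nonzero, but it depends on \<open>S'\<close>; only the vanishing of
      coefficients is tracked exactly.\<close>
    have "\<exists>w'\<in>S. \<forall>S'. \<exists>k. k \<noteq> 0 \<and> fock_coeff w' S' = k * fock_coeff w (S' + T)" if "set_mset T \<subseteq> valid_idx" for T
      using that
    proof (induction T)
      case empty
      show ?case using w(1) by (intro bexI[of _ w]) (auto intro!: exI[of _ 1])
    next
      case (add x T)
      obtain i j n where x: "x = (i, j, n)" by (cases x)
      have v: "i \<in> {1..d}" "n \<ge> 1" using add.prems by (auto simp: x valid_idx_def)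
      from add obtain w' where w': "w' \<in> S" "\<And>S'. \<exists>k. k \<noteq> 0 \<and> fock_coeff w' S' = k * fock_coeff w (S' + T)" by auto
      show ?case
      proof (intro bexI[of _ "mode rhoM (monom (u i) j) (int n) w'"] allI)
        fix S'
        obtain k where k: "k \<noteq> 0" "fock_coeff w' (add_mset x S') = k * fock_coeff w (add_mset x S' + T)" using w'(2) by blast
        have "fock_coeff (mode rhoM (monom (u i) j) (int n) w') S' = of_nat n * l * (of_nat (count S' x + 1) * fock_coeff w' (add_mset x S'))"
          using v by (simp add: fock_coeff_mode_monom elem_mode_def var_diff_def x)
        also have "\<dots> = (of_nat n * l * of_nat (count S' x + 1) * k) * fock_coeff w (S' + add_mset x T)"
          by (simp add: k)
        finally have "fock_coeff (mode rhoM (monom (u i) j) (int n) w') S' = (of_nat n * l * of_nat (count S' x + 1) * k) * fock_coeff w (S' + add_mset x T)" .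
        moreover have "of_nat n * l * of_nat (count S' x + 1) * k \<noteq> 0"
          using l v k by (simp del: of_nat_Suc of_nat_add)
        ultimately show "\<exists>k. k \<noteq> 0 \<and> fock_coeff (mode rhoM (monom (u i) j) (int n) w') S' = k * fock_coeff w (S' + add_mset x T)"
          by blast
      qed (rule modes[OF w'(1)])
    qed
    from this[OF fock_coeff_valid[OF T0(1)]] obtain w' where
      w': "w' \<in> S" "\<And>S'. \<exists>k. k \<noteq> 0 \<and> fock_coeff w' S' = k * fock_coeff w (S' + T0)" by blast
    have nz: "fock_coeff w' {#} \<noteq> 0" using w'(2)[of "{#}"] T0(1) by auto
    \<comment> \<open>Any other monomial of \<open>w'\<close> would come from a monomial of
      \<open>w\<close> with more factors than \<open>T0\<close>.\<close>
    have "w' = scM (fock_coeff w' {#}) vac"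
    proof (rule fock_coeff_eqI)
      fix S'
      show "fock_coeff w' S' = fock_coeff (scM (fock_coeff w' {#}) vac) S'"
      proof (cases "S' = {#}")
        case False
        then have "fock_coeff w (S' + T0) = 0" using T0(2)[of "S' + T0"] by auto
        then show ?thesis using w'(2)[of S'] False by (auto simp: fock_coeff_scale fock_coeff_vac)
      qed (simp add: fock_coeff_scale fock_coeff_vac)
    qed
    then have "scM (1 / fock_coeff w' {#}) w' = vac" using nz by (metis B.scale_one B.scale_scale nonzero_divide_eq_eq)
    then have vac: "vac \<in> S" using S w'(1) B.subspace_scale by metis
    have "v \<in> S" for v
      by (induction v rule: vac_induct) (use vac modes S in \<open>auto intro: B.subspace_add B.subspace_scale\<close>)
    then show ?thesis by blast
  qed simp
qed

end

section \<open>Truncated Virasoro operators\<close>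

context mode_module
begin

lemma quadratic_mode_finite: "finite {m. normal_ordered act [(a, n - m), (a, m)] w \<noteq> 0}"
proof -
  have "finite ((\<lambda>ms. ms ! 1) ` {ms. length ms = length [a, a] \<and> sum_list ms = n \<and> normal_ordered act (zip [a, a] ms) w \<noteq> 0})"
    by (intro finite_imageI normal_ordered_finite)
  moreover have "{m. normal_ordered act [(a, n - m), (a, m)] w \<noteq> 0} \<subseteq>
     (\<lambda>ms. ms ! 1) ` {ms. length ms = length [a, a] \<and> sum_list ms = n \<and> normal_ordered act (zip [a, a] ms) w \<noteq> 0}"
  proof
    fix m assume "m \<in> {m. normal_ordered act [(a, n - m), (a, m)] w \<noteq> 0}"
    then show "m \<in> (\<lambda>ms. ms ! 1) ` {ms. length ms = length [a, a] \<and> sum_list ms = n \<and> normal_ordered act (zip [a, a] ms) w \<noteq> 0}"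
      by (intro image_eqI[of _ _ "[n - m, m]"]) auto
  qed
  ultimately show ?thesis by (rule rev_finite_subset)
qed

text \<open>The shift by 1 is the usual convention that the operator \<open>L(n)\<close> is the mode
  \<open>n + 1\<close> of the conformal vector.\<close>

lemma field_product_quadratic: "field_product sc act [(a, 1), (a, 1)] (n + 1) w = quadratic_mode act a n w"
proof -
  let ?f = "\<lambda>m. [n - m, m]"
  have pt: "product_term [(a, 1), (a, 1)] (n + 1) (?f m) w = normal_ordered act [(a, n - m), (a, m)] w" for m
    by (simp add: product_term_def)
  have eq: "{ms. product_term [(a, 1), (a, 1)] (n + 1) ms w \<noteq> 0} = ?f ` {m. normal_ordered act [(a, n - m), (a, m)] w \<noteq> 0}"
  proof (intro equalityI subsetI)
    fix ms assume ms: "ms \<in> {ms. product_term [(a, 1), (a, 1)] (n + 1) ms w \<noteq> 0}"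
    then have "length ms = 2" "sum_list ms = n" by (auto simp: product_term_def split: if_splits)
    then obtain x y where "ms = [x, y]" "x + y = n" by (auto simp: length_Suc_conv numeral_2_eq_2)
    then have "ms = ?f y" by auto
    then show "ms \<in> ?f ` {m. normal_ordered act [(a, n - m), (a, m)] w \<noteq> 0}" using ms pt by auto
  qed (use pt in auto)
  have "field_product sc act [(a, 1), (a, 1)] (n + 1) w =
      (\<Sum>m | normal_ordered act [(a, n - m), (a, m)] w \<noteq> 0. product_term [(a, 1), (a, 1)] (n + 1) (?f m) w)"
    unfolding field_product_eq Sum_any.expand_set eq by (subst sum.reindex) (auto simp: inj_on_def)
  then show ?thesis unfolding pt quadratic_mode_def Sum_any.expand_set .
qed

text \<open>As \<open>n >= - 1\<close>, one of the modes \<open>n - m\<close> and \<open>m\<close>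
  is positive and kills \<open>w\<close>, except for the pairs \<open>(0, 0)\<close>,
  \<open>(-1, 0)\<close> and \<open>(0, -1)\<close>. The last two give equal contributions, whence
  the factor 2.\<close>

lemma quadratic_mode_tail:
  assumes an: "\<And>n. n \<ge> 1 \<Longrightarrow> act a n w = 0" and z: "\<And>v. act a 0 v = sc x v" and n: "n \<ge> - 1"
  shows "quadratic_mode act a n w = (if n = 0 then sc (x * x) w else if n = - 1 then sc (2 * x) (act a (- 1) w) else 0)"
proof -
  have no: "normal_ordered act [(a, n - m), (a, m)] w =
     (if n = 0 \<and> m = 0 then sc (x * x) w else if n = - 1 \<and> (m = 0 \<or> m = - 1) then sc x (act a (- 1) w) else 0)" for m
  proof -
    consider "m \<ge> 1" | "m = 0" | "m < 0" by linarith
    then show ?thesis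
    proof cases
      case 1
      then have am: "act a m w = 0" using an by simp
      show ?thesis
      proof (cases "n - m < 0")
        case True
        then show ?thesis using 1 am by (simp add: normal_ordered_Cons_neg normal_ordered_Cons_nonneg)
      next
        case False
        then have "act a m (act a (n - m) w) = act a (n - m) (act a m w)"
          using 1 by (subst act_commute) auto
        then show ?thesis using 1 am False by (simp add: normal_ordered_Cons_nonneg)
      qed
    next
      case 2
      show ?thesis
      proof (cases "n < 0")
        case True
        then have "n = - 1" using n by simp
        then show ?thesis using 2 by (simp add: normal_ordered_Cons_neg normal_ordered_Cons_nonneg z act_scale)
      next
        case False
        then show ?thesis using 2 an[of n] by (auto simp: normal_ordered_Cons_nonneg z act_scale)
      qed
    next
      case 3
      show ?thesis
      proof (cases "n - m = 0")
        case True
        then have "n = - 1" "m = - 1" using n 3 by auto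
        then show ?thesis by (simp add: normal_ordered_Cons_neg normal_ordered_Cons_nonneg z act_scale)
      next
        case False
        then have "act a (n - m) w = 0" using an[of "n - m"] n 3 by simp
        moreover have "\<not> (n = - 1 \<and> m = - 1)" using False by auto
        ultimately show ?thesis using 3 n by (auto simp: normal_ordered_Cons_neg normal_ordered_Cons_nonneg)
      qed
    qed
  qed
  have "quadratic_mode act a n w = (\<Sum>m\<in>{0, - 1}. normal_ordered act [(a, n - m), (a, m)] w)"
    unfolding quadratic_mode_def by (rule Sum_any.expand_superset) (auto simp: no)
  then show ?thesis by (auto simp: no) (simp only: mult_2 scale_left_distrib)
qed

end

section \<open>The truncated conformal vector and its modes\<close>

locale vacuum_field = vacuum_rep scaleH form d u l scM rhoM vac scW rhoW
  for scaleH :: "complex \<Rightarrow> 'h::ab_group_add \<Rightarrow> 'h" and form d u l scM rhoM and vac :: "'m::ab_group_add"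
    and scW :: "complex \<Rightarrow> 'w::ab_group_add \<Rightarrow> 'w" and rhoW +
  fixes YW :: "'m \<Rightarrow> int \<Rightarrow> 'w \<Rightarrow> 'w"
  assumes field_map: "field_map YW" and level_nonzero: "l \<noteq> 0"
begin

sublocale YW: mode_field_map scM "mode rhoM" kap scW "mode rhoW" vac YW
  by (rule field_map)

sublocale P: mode_field_pair scM "mode rhoM" kap scW "mode rhoW" vac YM YW ..

text \<open>The Jacobi identity for \<open>r = 0\<close>, where the left-hand side has only the term
  \<open>i = 0\<close>.\<close>

lemma commutator_formula:
  "YW a p (YW b q w) - YW b q (YW a p w) =
     Sum_any (\<lambda>i::nat. scW (of_int p gchoose i) (YW (YM a (int i) b) (p + q - int i) w))"
proof -
  have "W.borcherds (YW a) (YW b) p q 0 w = YW a p (YW b q w) - YW b q (YW a p w)"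
  proof -
    have "W.borcherds (YW a) (YW b) p q 0 w = (\<Sum>i<1. scW (signed_choose 0 i)
       (YW a (p + 0 - int i) (YW b (q + int i) w) - scW (sign_power 0) (YW b (q + 0 - int i) (YW a (p + int i) w))))"
      unfolding W.borcherds_def by (rule Sum_any_lessThan) (simp add: signed_choose_def gbinomial_0_left)
    then show ?thesis by (simp add: sign_power_def)
  qed
  then show ?thesis using P.borcherds_identity[of a b p q 0 w] by (simp add: P.borcherds_right_def)
qed

text \<open>The translation property: the field of \<open>v(-2) 1\<close> is the derivative of the
  field of \<open>v\<close>. It is the Jacobi identity for \<open>v\<close> and the vacuum with
  \<open>p = 0\<close> and \<open>r = - 2\<close>.\<close>

lemma YW_translation: "YW (YM v (- 2) vac) k w = - scW (of_int k) (YW v (k - 1) w)"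
proof -
  have "P.borcherds_right v vac 0 k (- 2) w = (\<Sum>i<1. scW (of_int 0 gchoose i) (YW (YM v (- 2 + int i) vac) (0 + k - int i) w))"
    unfolding P.borcherds_right_def by (rule Sum_any_lessThan) (simp add: gbinomial_0_left)
  then have R: "P.borcherds_right v vac 0 k (- 2) w = YW (YM v (- 2) vac) k w" by simp
  have "\<forall>\<^sub>F K in sequentially. (\<forall>i\<ge>K. YW v (0 + int i) w = 0) \<and> K > nat (- 1 - k) \<and> K > nat (k - 1)"
    by (intro eventually_conj W.is_field_eventually) (simp_all add: eventually_gt_at_top)
  from eventually_happens'[OF sequentially_bot this] obtain K where
    K: "\<And>i. i \<ge> K \<Longrightarrow> YW v (int i) w = 0" "K > nat (- 1 - k)" "K > nat (k - 1)" by auto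
  define x where "x = YW v (k - 1) w"
  have sb2: "signed_choose (- 2) s = of_nat (s + 1)" for s
  proof -
    have "signed_choose (- 2) s = of_nat (s + 1) gchoose s"
      unfolding signed_choose_def gbinomial_signed_upper by simp
    also have "\<dots> = of_nat (s + 1)"
      using gbinomial_of_nat_symmetric[of s "s + 1", where 'a = complex] by simp
    finally show ?thesis .
  qed
  have Yv: "YW vac m z = (if m = - 1 then z else 0)" for m z
    by (simp add: YW.Y_vac W.identity_field_def)
  have "W.borcherds (YW v) (YW vac) 0 k (- 2) w =
      (\<Sum>s<K. scW (signed_choose (- 2) s) (YW v (0 + - 2 - int s) (YW vac (k + int s) w)))
     - (\<Sum>s<K. scW (sign_power (- 2) * signed_choose (- 2) s) (YW vac (k + - 2 - int s) (YW v (0 + int s) w)))"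
  proof (rule W.borcherds_lessThan)
    show "YW vac (k + int i) w = 0" if "i \<ge> K" for i
    proof -
      have "k + int i \<noteq> - 1" using that K(2) by linarith
      then show ?thesis by (simp add: Yv)
    qed
  qed (use K in simp_all)
  also have "(\<Sum>s<K. scW (signed_choose (- 2) s) (YW v (0 + - 2 - int s) (YW vac (k + int s) w)))
     = (\<Sum>s\<in>(if k < 0 then {nat (- 1 - k)} else {}). scW (- of_int k) x)"
  proof (rule sum.mono_neutral_cong_right)
    show "\<forall>s\<in>{..<K} - (if k < 0 then {nat (- 1 - k)} else {}). scW (signed_choose (- 2) s) (YW v (0 + - 2 - int s) (YW vac (k + int s) w)) = 0"
    proof
      fix s assume "s \<in> {..<K} - (if k < 0 then {nat (- 1 - k)} else {})"
      then have "k + int s \<noteq> - 1" by (auto split: if_splits)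
      then show "scW (signed_choose (- 2) s) (YW v (0 + - 2 - int s) (YW vac (k + int s) w)) = 0" by (simp add: Yv)
    qed
    fix s assume "s \<in> (if k < 0 then {nat (- 1 - k)} else {})"
    then have s: "int s = - 1 - k" by (auto split: if_splits)
    have "(of_nat (s + 1) :: complex) = of_int (int s + 1)" by simp
    also have "\<dots> = - of_int k" by (simp add: s)
    finally show "scW (signed_choose (- 2) s) (YW v (0 + - 2 - int s) (YW vac (k + int s) w)) = scW (- of_int k) x"
      by (simp add: Yv sb2 s x_def del: of_nat_add)
  qed (use K in auto)
  also have "(\<Sum>s<K. scW (sign_power (- 2) * signed_choose (- 2) s) (YW vac (k + - 2 - int s) (YW v (0 + int s) w)))
     = (\<Sum>s\<in>(if k > 0 then {nat (k - 1)} else {}). scW (of_int k) x)"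
  proof (rule sum.mono_neutral_cong_right)
    show "\<forall>s\<in>{..<K} - (if k > 0 then {nat (k - 1)} else {}). scW (sign_power (- 2) * signed_choose (- 2) s) (YW vac (k + - 2 - int s) (YW v (0 + int s) w)) = 0"
    proof
      fix s assume "s \<in> {..<K} - (if k > 0 then {nat (k - 1)} else {})"
      then have "k + - 2 - int s \<noteq> - 1" by (auto split: if_splits)
      then show "scW (sign_power (- 2) * signed_choose (- 2) s) (YW vac (k + - 2 - int s) (YW v (0 + int s) w)) = 0" by (simp add: Yv)
    qed
    fix s assume "s \<in> (if k > 0 then {nat (k - 1)} else {})"
    then have s: "int s = k - 1" by (auto split: if_splits)
    have "(of_nat (s + 1) :: complex) = of_int (int s + 1)" by simp
    also have "\<dots> = of_int k" by (simp add: s)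
    finally show "scW (sign_power (- 2) * signed_choose (- 2) s) (YW vac (k + - 2 - int s) (YW v (0 + int s) w)) = scW (of_int k) x"
      by (simp add: Yv sb2 s x_def sign_power_def del: of_nat_add)
  qed (use K in auto)
  finally have "W.borcherds (YW v) (YW vac) 0 k (- 2) w = - scW (of_int k) x"
    by auto
  then show ?thesis using P.borcherds_identity[of v vac 0 k "- 2" w] R by (simp add: x_def)
qed

abbreviation gen :: "nat \<Rightarrow> nat \<Rightarrow> 'h poly" where "gen i j \<equiv> monom (u i) j"

lemma kap_gen:
  assumes "i \<in> {1..d}" "i' \<in> {1..d}"
  shows "kap (gen i j) (gen i' j') = (if i = i' \<and> j = j' then l else 0)"
proof -
  have "current_form form (gen i j) (gen i' j') = (\<Sum>k\<le>j. form (coeff (gen i j) k) (coeff (gen i' j') k))"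
    by (rule current_form_atMost) (rule degree_monom_le)
  also have "\<dots> = (\<Sum>k\<le>j. if k = j then (if i = i' \<and> j = j' then 1 else 0) else 0)"
    by (intro sum.cong refl) (use assms H.u_orthonormal in auto)
  finally show ?thesis by (simp add: kap_def)
qed

text \<open>The conformal vector restricted to the powers \<open>t\<^sup>j\<close> with \<open>j < J\<close>; the full sum over \<open>j\<close> is not in
  \<open>M(l)\<close>.\<close>

definition omega :: "nat \<Rightarrow> 'm" where
  "omega J = scM (1 / (2 * l)) (\<Sum>i=1..d. \<Sum>j<J. mode rhoM (gen i j) (- 1) (mode rhoM (gen i j) (- 1) vac))"

definition LJ :: "nat \<Rightarrow> int \<Rightarrow> 'w \<Rightarrow> 'w" where
  "LJ J n w = YW (omega J) (n + 1) w"

lemma LJ_quadratic: "LJ J n w = scW (1 / (2 * l)) (\<Sum>i=1..d. \<Sum>j<J. quadratic_mode (mode rhoW) (gen i j) n w)"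
proof -
  have "YW (mode rhoM a (- 1) (mode rhoM a (- 1) vac)) (n + 1) w = quadratic_mode (mode rhoW) a n w" for a
  proof -
    have "(\<forall>(a, r)\<in>set xs. r \<ge> 1) \<longrightarrow> YW (creation_word xs) n w = field_product scW (mode rhoW) xs n w" for xs n w
      using field_map_product_formula[OF field_map] unfolding has_field_product_formula_def by blast
    from this[of "[(a, 1), (a, 1)]" "n + 1" w] show ?thesis
      unfolding W.field_product_quadratic by simp
  qed
  then show ?thesis unfolding LJ_def omega_def YW.Y_scale YW.Y_sum by (simp only:)
qed

lemma LJ_add: "LJ J n (v + w) = LJ J n v + LJ J n w"
  and LJ_scale: "LJ J n (scW t w) = scW t (LJ J n w)"
  by (simp_all add: LJ_def W.is_field_add W.is_field_scale)

text \<open>A mode contracts with each of the two equal factors, giving \<open>2 l\<close>, which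
  the normalisation of \<open>omega\<close> cancels. So a generator with \<open>j < J\<close> is
  primary of weight 1 for \<open>omega J\<close>.\<close>

lemma mode_omega:
  assumes i: "i \<in> {1..d}"
  shows "mode rhoM (gen i j) (int t) (omega J) = (if t = 1 \<and> j < J then mode rhoM (gen i j) (- 1) vac else 0)"
proof -
  let ?a = "gen i j" and ?v = "mode rhoM (gen i j) (- 1) vac"
  have "mode rhoM ?a (int t) (mode rhoM (gen i' j') (- 1) (mode rhoM (gen i' j') (- 1) vac)) =
     (if t = 1 \<and> i' = i \<and> j' = j then scM (2 * l) ?v else 0)" if "i' \<in> {1..d}" for i' j'
  proof -
    let ?b = "gen i' j'"
    have c: "mode rhoM ?a (int t) (mode rhoM ?b (- 1) w) = mode rhoM ?b (- 1) (mode rhoM ?a (int t) w)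
        + (if t = 1 \<and> i' = i \<and> j' = j then scM l w else 0)" for w
      using kap_gen[OF i that, of j j'] by (subst M.act_commute) auto
    have "scM l ?v + scM l ?v = scM (2 * l) ?v"
      by (simp only: mult_2 B.scale_left_distrib)
    then show ?thesis by (simp add: c mode_vac M.act_add M.act_scale)
  qed
  then have "mode rhoM ?a (int t) (omega J) = scM (1 / (2 * l)) (\<Sum>i'=1..d. \<Sum>j'<J. if t = 1 \<and> i' = i \<and> j' = j then scM (2 * l) ?v else 0)"
    by (simp add: omega_def M.act_scale B.is_field_sum)
  also have "(\<Sum>i'=1..d. \<Sum>j'<J. if t = 1 \<and> i' = i \<and> j' = j then scM (2 * l) ?v else 0) =
     (\<Sum>i'=1..d. if i' = i then (\<Sum>j'<J. if j' = j then (if t = 1 then scM (2 * l) ?v else 0) else 0) else 0)"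
    by (intro sum.cong refl) auto
  also have "\<dots> = (if t = 1 \<and> j < J then scM (2 * l) ?v else 0)" using i by simp
  finally show ?thesis using level_nonzero by simp
qed

lemma YW_generator: "YW (mode rhoM a (- 1) vac) = mode rhoW a"
  by (simp add: YW.Y_act YW.Y_vac W.nprod_identity)

text \<open>By \<open>mode_omega\<close> only \<open>t = 1\<close> contributes to the commutator
  formula. For \<open>j >= J\<close> the modes commute with \<open>LJ\<close>, so the truncated
  operators keep vectors that such modes kill.\<close>

lemma mode_LJ_commutator:
  assumes "i \<in> {1..d}"
  shows "mode rhoW (gen i j) k (LJ J n w) = LJ J n (mode rhoW (gen i j) k w) +
     (if j < J then scW (of_int k) (mode rhoW (gen i j) (n + k) w) else 0)"
proof -
  have "mode rhoW (gen i j) k (YW (omega J) (n + 1) w) - YW (omega J) (n + 1) (mode rhoW (gen i j) k w) =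
     (\<Sum>t<2. scW (of_int k gchoose t) (YW (mode rhoM (gen i j) (int t) (omega J)) (k + (n + 1) - int t) w))"
    by (rule YW.Y_commutator) (use mode_omega[OF assms] in auto)
  also have "\<dots> = (if j < J then scW (of_int k) (mode rhoW (gen i j) (n + k) w) else 0)"
    by (simp add: numeral_2_eq_2 mode_omega[OF assms, of j 0, simplified] mode_omega[OF assms, of j 1, simplified] YW_generator add.commute)
  finally show ?thesis by (simp add: LJ_def algebra_simps)
qed

end

text \<open>The products of \<open>omega J\<close> with itself are elements of M(l), so they are
  computed once with \<open>W\<close> equal to M(l); \<open>LJ_virasoro\<close> then transfers them
  to every \<open>W\<close>.\<close>

locale vacuum_field_self = vacuum_setup scaleH form d u l scM rhoM vac
  for scaleH :: "complex \<Rightarrow> 'h::ab_group_add \<Rightarrow> 'h" and form d u l scM rhoM and vac :: "'m::ab_group_add" +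
  assumes level_nonzero: "l \<noteq> 0"
begin

sublocale S: vacuum_field scaleH form d u l scM rhoM vac scM rhoM YM
  by unfold_locales (use YM_field_map level_nonzero in auto)

text \<open>The product with index \<open>t\<close> is the operator \<open>LJ J (t - 1)\<close>,
  which kills the vacuum for \<open>t >= 0\<close> and turns \<open>a(-1)\<close> into
  \<open>a(t - 2)\<close> when commuted with it. Applied to each \<open>a(-1) a(-1) 1\<close> in
  \<open>omega J\<close> this gives all five values.\<close>

lemma omega_products:
  "YM (S.omega J) 0 (S.omega J) = YM (S.omega J) (- 2) vac"
  "YM (S.omega J) 1 (S.omega J) = scM 2 (S.omega J)"
  "YM (S.omega J) 2 (S.omega J) = 0"
  "\<exists>t. YM (S.omega J) 3 (S.omega J) = scM t vac"
  "k \<ge> 4 \<Longrightarrow> YM (S.omega J) (int k) (S.omega J) = 0"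
proof -
  let ?I = "{1..d}"
  have base: "YM (S.omega J) (int t) (mode rhoM (S.gen i j) (- 1) (mode rhoM (S.gen i j) (- 1) vac)) =
      mode rhoM (S.gen i j) (- 1) (mode rhoM (S.gen i j) (int t - 2) vac)
      + mode rhoM (S.gen i j) (int t - 2) (mode rhoM (S.gen i j) (- 1) vac)"
    if "i \<in> ?I" "j < J" for i j t
  proof -
    have c: "YM (S.omega J) (int t) (mode rhoM (S.gen i j) (- 1) w) =
        mode rhoM (S.gen i j) (- 1) (YM (S.omega J) (int t) w) + mode rhoM (S.gen i j) (int t - 2) w" for w
      using S.mode_LJ_commutator[OF that(1), of j "- 1" J "int t - 1" w] that(2) by (simp add: S.LJ_def)
    have "YM (S.omega J) (int t) vac = 0" using YM_creation by simp
    then show ?thesis by (simp add: c M.act_add)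
  qed
  have om: "YM (S.omega J) (int t) (S.omega J) = scM (1 / (2 * l)) (\<Sum>i\<in>?I. \<Sum>j<J.
      mode rhoM (S.gen i j) (- 1) (mode rhoM (S.gen i j) (int t - 2) vac)
      + mode rhoM (S.gen i j) (int t - 2) (mode rhoM (S.gen i j) (- 1) vac))" for t
  proof -
    have "YM (S.omega J) (int t) (S.omega J) = scM (1 / (2 * l)) (\<Sum>i\<in>?I. \<Sum>j<J.
      YM (S.omega J) (int t) (mode rhoM (S.gen i j) (- 1) (mode rhoM (S.gen i j) (- 1) vac)))"
      by (subst (2) S.omega_def) (simp add: B.is_field_scale B.is_field_sum)
    also have "(\<Sum>i\<in>?I. \<Sum>j<J. YM (S.omega J) (int t) (mode rhoM (S.gen i j) (- 1) (mode rhoM (S.gen i j) (- 1) vac)))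
      = (\<Sum>i\<in>?I. \<Sum>j<J. mode rhoM (S.gen i j) (- 1) (mode rhoM (S.gen i j) (int t - 2) vac)
      + mode rhoM (S.gen i j) (int t - 2) (mode rhoM (S.gen i j) (- 1) vac))"
      by (intro sum.cong refl base) auto
    finally show ?thesis .
  qed
  have v0: "mode rhoM a 0 w = 0" for a w by (rule mode_zero_M)
  have vp: "mode rhoM a (1 + int n) vac = 0" for a n using mode_vac[of a "Suc n"] by simp
  have ann: "mode rhoM (S.gen i j) (int n) (mode rhoM (S.gen i j) (- 1) vac) = (if n = 1 then scM l vac else 0)"
    if "i \<in> ?I" for i j n
    using S.kap_gen[OF that that, of j j] by (subst M.act_commute) (auto simp: mode_vac)
  show "YM (S.omega J) 1 (S.omega J) = scM 2 (S.omega J)"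
  proof -
    have dbl: "v + v = scM 2 v" for v
      using B.scale_left_distrib[of 1 1 v] by simp
    show ?thesis
      using om[of 1] by (simp add: S.omega_def dbl B.scale_sum_right mult.commute)
  qed
  show "YM (S.omega J) 2 (S.omega J) = 0"
    using om[of 2] by (simp add: v0)
  show "\<exists>t. YM (S.omega J) 3 (S.omega J) = scM t vac"
  proof
    have "YM (S.omega J) 3 (S.omega J) = scM (1 / (2 * l)) (\<Sum>i\<in>?I. \<Sum>j<J. scM l vac)"
      using om[of 3] mode_vac[of _ 1] ann[of _ _ 1] by simp
    \<comment> \<open>The scalar is half the central charge, \<open>d J / 2\<close>.\<close>
    also have "\<dots> = scM (1 / (2 * l) * (of_nat d * (of_nat J * l))) vac"
      by (simp add: B.sum_constant_scale)
    finally show "YM (S.omega J) 3 (S.omega J) = scM (1 / (2 * l) * (of_nat d * (of_nat J * l))) vac" .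
  qed
  show "YM (S.omega J) (int k) (S.omega J) = 0" if k: "k \<ge> 4" for k
  proof -
    have e: "int k - 2 = int (k - 2)" using k by simp
    have z1: "mode rhoM a (int k - 2) vac = 0" for a
      unfolding e by (rule mode_vac)
    have z2: "mode rhoM (S.gen i j) (int k - 2) (mode rhoM (S.gen i j) (- 1) vac) = 0" if "i \<in> ?I" for i j
      unfolding e by (subst ann[OF that]) (use k in auto)
    show ?thesis unfolding om by (simp add: z1 z2)
  qed
  show "YM (S.omega J) 0 (S.omega J) = YM (S.omega J) (- 2) vac"
  proof -
    \<comment> \<open>The derivative of \<open>a(-1) a(-1) 1\<close>, read off the n-th product: its
      terms with \<open>i >= 2\<close>, and all terms of its second half, contain a nonnegative mode
      on the vacuum.\<close>
    have "YM (mode rhoM a (- 1) (mode rhoM a (- 1) vac)) (- 2) vac =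
      mode rhoM a (- 1) (mode rhoM a (- 2) vac) + mode rhoM a (- 2) (mode rhoM a (- 1) vac)" for a
    proof -
      have z: "mode rhoM a (int i) vac = 0" for i by (rule mode_vac)
      have z': "mode rhoM a (int i - 2) vac = 0" if "i \<ge> 2" for i
      proof -
        have "int i - 2 = int (i - 2)" using that by simp
        then show ?thesis by (simp only: z)
      qed
      have sb1: "signed_choose (- 1) 1 = 1" by (simp add: signed_choose_def)
      have "M.nprod a (- 1) (mode rhoM a) (- 2) vac =
        (\<Sum>i<2. scM (signed_choose (- 1) i) (mode rhoM a (- 1 - int i) (mode rhoM a (- 2 + int i) vac)))"
        by (subst M.nprod_lessThan[where K = 2])
          (auto simp: z z' z[of 0, simplified] z[of 1, simplified])
      then show ?thesis
        by (simp add: YM.Y_act YM.Y_vac M.nprod_identity numeral_2_eq_2 sb1[unfolded One_nat_def])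
    qed
    then have "YM (S.omega J) (- 2) vac = scM (1 / (2 * l)) (\<Sum>i\<in>?I. \<Sum>j<J.
      mode rhoM (S.gen i j) (- 1) (mode rhoM (S.gen i j) (- 2) vac)
      + mode rhoM (S.gen i j) (- 2) (mode rhoM (S.gen i j) (- 1) vac))"
      by (simp add: S.omega_def YM.Y_scale YM.Y_sum)
    then show ?thesis using om[of 0] by simp
  qed
qed

end

context vacuum_field
begin

sublocale V: vacuum_field_self
  by unfold_locales (rule level_nonzero)

lemma LJ_virasoro:
  assumes "m \<ge> - 1" "n \<ge> - 1"
  shows "LJ J m (LJ J n w) - LJ J n (LJ J m w) = scW (of_int (m - n)) (LJ J (m + n) w)"
proof -
  note om = V.omega_products[where J = J]
  obtain t where t: "YM (omega J) 3 (omega J) = scM t vac" using om(4) by blast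
  have "LJ J m (LJ J n w) - LJ J n (LJ J m w) =
    Sum_any (\<lambda>i::nat. scW (of_int (m + 1) gchoose i) (YW (YM (omega J) (int i) (omega J)) (m + 1 + (n + 1) - int i) w))"
    unfolding LJ_def by (rule commutator_formula)
  also have "\<dots> = (\<Sum>i<4. scW (of_int (m + 1) gchoose i) (YW (YM (omega J) (int i) (omega J)) (m + 1 + (n + 1) - int i) w))"
    by (rule Sum_any_lessThan) (simp add: om(5))
  also have "\<dots> = YW (YM (omega J) 0 (omega J)) (m + n + 2) w
     + scW (of_int (m + 1)) (YW (YM (omega J) 1 (omega J)) (m + n + 1) w)
     + scW (of_int (m + 1) gchoose 2) (YW (YM (omega J) 2 (omega J)) (m + n) w)
     + scW (of_int (m + 1) gchoose 3) (YW (YM (omega J) 3 (omega J)) (m + n - 1) w)"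
    by (simp add: eval_nat_numeral algebra_simps)
  \<comment> \<open>The vacuum field has the only mode -1, so \<open>m + n = 0\<close>; with
    \<open>m, n >= - 1\<close> this leaves \<open>m + 1\<close> in \<open>{0, 1, 2}\<close>, and the
    binomial coefficient over 3 vanishes.\<close>
  also have "scW (of_int (m + 1) gchoose 3) (YW (YM (omega J) 3 (omega J)) (m + n - 1) w) = 0"
  proof (cases "m + n = 0")
    case True
    then have "m = - 1 \<or> m = 0 \<or> m = 1" using assms by auto
    then have "(of_int (m + 1) :: complex) gchoose 3 = of_nat (nat (m + 1)) gchoose 3" by auto
    also have "\<dots> = 0" using True assms by (intro gbinomial_nat_eq_0) linarith
    finally show ?thesis by simp
  next
    case False
    then show ?thesis by (simp add: t YW.Y_scale YW.Y_vac W.identity_field_def)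
  qed
  also have "YW (YM (omega J) 0 (omega J)) (m + n + 2) w = - scW (of_int (m + n + 2)) (YW (omega J) (m + n + 1) w)"
    unfolding om(1) YW_translation by (simp add: algebra_simps)
  also have "YW (YM (omega J) 1 (omega J)) (m + n + 1) w = scW 2 (YW (omega J) (m + n + 1) w)"
    unfolding om(2) YW.Y_scale ..
  also have "YW (YM (omega J) 2 (omega J)) (m + n) w = 0" unfolding om(3) by simp
  finally have "LJ J m (LJ J n w) - LJ J n (LJ J m w) =
     - scW (of_int (m + n + 2)) (YW (omega J) (m + n + 1) w) + scW (of_int (m + 1)) (scW 2 (YW (omega J) (m + n + 1) w))"
    by simp
  also have "\<dots> = scW (- of_int (m + n + 2) + of_int (m + 1) * 2) (YW (omega J) (m + n + 1) w)"
    by (simp only: W.scale_left_distrib W.scale_minus_left W.scale_scale)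
  also have "- of_int (m + n + 2) + of_int (m + 1) * 2 = (of_int (m - n) :: complex)" by simp
  finally show ?thesis by (simp add: LJ_def)
qed

end

section \<open>Limits of the truncated operators\<close>

lemma has_sum_sum_finite:
  fixes f :: "'i \<Rightarrow> 'x \<Rightarrow> complex"
  assumes "\<And>i. i \<in> I \<Longrightarrow> (f i has_sum s i) A"
  shows "((\<lambda>x. \<Sum>i\<in>I. f i x) has_sum (\<Sum>i\<in>I. s i)) A"
  using assms by (induction I rule: infinite_finite_induct) (simp_all add: has_sum_add has_sum_0)

section \<open>Absolute convergence over the PBW basis\<close>

context vacuum_setup
begin

definition functional :: "('m \<Rightarrow> complex) \<Rightarrow> bool" where
  "functional tau \<longleftrightarrow> (\<forall>v w. tau (v + w) = tau v + tau w) \<and> (\<forall>t v. tau (scM t v) = t * tau v)"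

lemma functional_add: "functional tau \<Longrightarrow> tau (v + w) = tau v + tau w"
  and functional_scale: "functional tau \<Longrightarrow> tau (scM t v) = t * tau v"
  by (simp_all add: functional_def)

lemma functional_zero: "functional tau \<Longrightarrow> tau 0 = 0"
  using functional_scale[of tau 0 0] by simp

lemma functional_sum: "functional tau \<Longrightarrow> tau (\<Sum>i\<in>I. f i) = (\<Sum>i\<in>I. tau (f i))"
  by (induction I rule: infinite_finite_induct) (simp_all add: functional_add functional_zero)

text \<open>The absolute sum behind \<open>\<Sum>\<^sub>b v\<^sub>b \<tau>(b)\<close>; it justifies exchanging this sum with the one over \<open>j\<close>.\<close>

definition seminorm :: "('m \<Rightarrow> complex) \<Rightarrow> 'm \<Rightarrow> real" where
  "seminorm tau v = (\<Sum>b | crd v b \<noteq> 0. norm (crd v b * tau b))"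

lemma seminorm_superset:
  assumes "finite K" "{b. crd v b \<noteq> 0} \<subseteq> K"
  shows "seminorm tau v = (\<Sum>b\<in>K. norm (crd v b * tau b))"
  unfolding seminorm_def using assms by (intro sum.mono_neutral_left) auto

lemma seminorm_nonneg: "seminorm tau v \<ge> 0"
  by (simp add: seminorm_def sum_nonneg)

lemma seminorm_triangle: "seminorm tau (v + w) \<le> seminorm tau v + seminorm tau w"
proof -
  let ?K = "{b. crd v b \<noteq> 0} \<union> {b. crd w b \<noteq> 0}"
  have K: "finite ?K" using crd_finite by blast
  have s: "{b. crd (v + w) b \<noteq> 0} \<subseteq> ?K" by (auto simp: crd_add)
  have "seminorm tau (v + w) = (\<Sum>b\<in>?K. norm (crd v b * tau b + crd w b * tau b))"
    by (simp only: seminorm_superset[OF K s] crd_add distrib_right)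
  also have "\<dots> \<le> (\<Sum>b\<in>?K. norm (crd v b * tau b) + norm (crd w b * tau b))"
    by (intro sum_mono norm_triangle_ineq)
  finally show ?thesis
    by (simp only: sum.distrib seminorm_superset[OF K Un_upper1] seminorm_superset[OF K Un_upper2])
qed

lemma seminorm_scale: "seminorm tau (scM t v) = norm t * seminorm tau v"
proof -
  have s: "{b. crd (scM t v) b \<noteq> 0} \<subseteq> {b. crd v b \<noteq> 0}" by (auto simp: crd_scale)
  show ?thesis
    unfolding seminorm_superset[OF crd_finite s]
    by (simp add: seminorm_def crd_scale norm_mult sum_distrib_left mult.assoc)
qed

lemma seminorm_sum: "seminorm tau (\<Sum>i\<in>I. f i) \<le> (\<Sum>i\<in>I. seminorm tau (f i))"
proof (induction I rule: infinite_finite_induct)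
  case (insert x I)
  then show ?case using seminorm_triangle[of tau "f x" "\<Sum>i\<in>I. f i"] by simp
qed (simp_all add: seminorm_def)

lemma seminorm_basis: "b \<in> Bas \<Longrightarrow> seminorm tau b = norm (tau b)"
proof -
  assume b: "b \<in> Bas"
  then have "{b'. crd b b' \<noteq> 0} = {b}" by (auto simp: crd_basis)
  then show ?thesis by (simp add: seminorm_def crd_basis[OF b])
qed

lemma functional_has_sum:
  assumes "functional tau"
  shows "((\<lambda>b. crd v b * tau b) has_sum tau v) Bas"
proof -
  have "tau v = (\<Sum>b | crd v b \<noteq> 0. crd v b * tau b)"
    by (subst crd_expansion[of v, symmetric]) (simp only: functional_sum[OF assms] functional_scale[OF assms])
  moreover have "((\<lambda>b. crd v b * tau b) has_sum (\<Sum>b | crd v b \<noteq> 0. crd v b * tau b)) {b. crd v b \<noteq> 0}"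
    by (rule has_sum_finite) (rule crd_finite)
  moreover have "((\<lambda>b. crd v b * tau b) has_sum tau v) Bas \<longleftrightarrow> ((\<lambda>b. crd v b * tau b) has_sum tau v) {b. crd v b \<noteq> 0}"
    by (rule has_sum_cong_neutral) (use crd_outside in auto)
  ultimately show ?thesis by simp
qed

text \<open>Fubini for the double series in \<open>j\<close> and \<open>b\<close>. For each
  \<open>j\<close> the sum over \<open>b\<close> is finite and \<open>seminorm\<close> is its
  absolute version, so the hypothesis \<open>G\<close> is exactly absolute summability of the double
  series.\<close>

lemma functional_series:
  assumes tau: "functional tau" and G: "summable (\<lambda>j. seminorm tau (t j))"
    and S: "\<And>b. b \<in> Bas \<Longrightarrow> summable (\<lambda>j. crd (t j) b)"
  shows "((\<lambda>b. (suminf (\<lambda>j. crd (t j) b)) * tau b) has_sum (suminf (\<lambda>j. tau (t j)))) Bas"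
    and "summable (\<lambda>j. tau (t j))"
proof -
  let ?f = "\<lambda>(j, b). crd (t j) b * tau b"
  have inner: "(\<lambda>b. norm (crd (t j) b * tau b)) summable_on Bas"
     and inf: "infsum (\<lambda>b. norm (crd (t j) b * tau b)) Bas = seminorm tau (t j)" for j
  proof -
    have 1: "((\<lambda>b. norm (crd (t j) b * tau b)) has_sum seminorm tau (t j)) {b. crd (t j) b \<noteq> 0}"
      unfolding seminorm_def by (rule has_sum_finite) (rule crd_finite)
    have "((\<lambda>b. norm (crd (t j) b * tau b)) has_sum seminorm tau (t j)) Bas"
      by (subst has_sum_cong_neutral[where T = "{b. crd (t j) b \<noteq> 0}"]) (use 1 crd_outside in auto)
    then show "(\<lambda>b. norm (crd (t j) b * tau b)) summable_on Bas"
      "infsum (\<lambda>b. norm (crd (t j) b * tau b)) Bas = seminorm tau (t j)"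
      by (auto simp: summable_on_def infsumI)
  qed
  have "(\<lambda>x. norm (?f x)) summable_on (UNIV \<times> Bas)"
    unfolding Infinite_Sum.abs_summable_on_Sigma_iff
  proof (intro conjI ballI)
    show "(\<lambda>b. norm (?f (j, b))) summable_on Bas" for j using inner[of j] by simp
    have "(\<lambda>j. seminorm tau (t j)) summable_on UNIV"
      using G seminorm_nonneg by (rule summable_nonneg_imp_summable_on)
    then show "(\<lambda>j. norm (infsum (\<lambda>b. norm (?f (j, b))) Bas)) summable_on UNIV"
      by (simp add: inf abs_of_nonneg[OF seminorm_nonneg])
  qed
  then have sm: "?f summable_on (UNIV \<times> Bas)" by (rule Infinite_Sum.abs_summable_summable)
  define s where "s = infsum ?f (UNIV \<times> Bas)"
  have s: "(?f has_sum s) (UNIV \<times> Bas)" unfolding s_def using sm by (rule has_sum_infsum)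
  have "((\<lambda>j. tau (t j)) has_sum s) UNIV"
    by (rule has_sum_SigmaD[OF s]) (simp add: functional_has_sum[OF tau])
  then have sums: "(\<lambda>j. tau (t j)) sums s" by (rule has_sum_imp_sums)
  then show "summable (\<lambda>j. tau (t j))" by (rule sums_summable)
  have swap: "((\<lambda>(b, j). crd (t j) b * tau b) has_sum s) (Bas \<times> UNIV)"
  proof -
    have "(?f has_sum s) (prod.swap ` (Bas \<times> UNIV))"
      using s by (simp add: product_swap)
    then show ?thesis
      by (subst (asm) has_sum_reindex) (auto simp: o_def case_prod_unfold)
  qed
  have "((\<lambda>b. (suminf (\<lambda>j. crd (t j) b)) * tau b) has_sum s) Bas"
  proof (rule has_sum_SigmaD[OF swap])
    fix b assume b: "b \<in> Bas"
    have "(\<lambda>j. (\<lambda>(b, j). crd (t j) b * tau b) (b, j)) summable_on UNIV"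
    proof -
      have "(\<lambda>(b, j). crd (t j) b * tau b) summable_on Sigma Bas (\<lambda>_. UNIV)"
        using swap by (auto simp: summable_on_def)
      from summable_on_SigmaD1[OF this b] show ?thesis by simp
    qed
    then have h: "((\<lambda>j. crd (t j) b * tau b) has_sum infsum (\<lambda>j. crd (t j) b * tau b) UNIV) UNIV"
      by simp
    have "(\<lambda>j. crd (t j) b * tau b) sums ((suminf (\<lambda>j. crd (t j) b)) * tau b)"
      using summable_sums[OF S[OF b]] by (rule sums_mult2)
    with has_sum_imp_sums[OF h] have "infsum (\<lambda>j. crd (t j) b * tau b) UNIV = (suminf (\<lambda>j. crd (t j) b)) * tau b"
      using sums_unique2 by blast
    then show "((\<lambda>j. (\<lambda>(b, j). crd (t j) b * tau b) (b, j)) has_sum (suminf (\<lambda>j. crd (t j) b)) * tau b) UNIV"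
      using h by simp
  qed
  then show "((\<lambda>b. (suminf (\<lambda>j. crd (t j) b)) * tau b) has_sum (suminf (\<lambda>j. tau (t j)))) Bas"
    using sums by (simp add: sums_iff)
qed

end

section \<open>Convergence on the twisted module\<close>

locale twisted_field = twisted_setup scaleH form d u l scM rhoM vac lam c
  for scaleH :: "complex \<Rightarrow> 'h::ab_group_add \<Rightarrow> 'h" and form d u l scM rhoM and vac :: "'m::ab_group_add" and lam c +
  fixes YW :: "'m \<Rightarrow> int \<Rightarrow> 'm \<Rightarrow> 'm"
  assumes field_map: "R.field_map YW" and level_nonzero: "l \<noteq> 0" and c_less: "norm c < 1"
begin

sublocale F: vacuum_field scaleH form d u l scM rhoM vac scM rhoT YW
  by (intro vacuum_field.intro vacuum_field_axioms.intro R.vacuum_rep_axioms field_map level_nonzero)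

abbreviation act where "act \<equiv> mode rhoT"
abbreviation gen where "gen \<equiv> F.gen"
abbreviation LJ where "LJ \<equiv> F.LJ"

definition chig :: "nat \<Rightarrow> nat \<Rightarrow> complex" where
  "chig i j = lam (u i) * c ^ j"

abbreviation Q :: "nat \<Rightarrow> int \<Rightarrow> 'm \<Rightarrow> nat \<Rightarrow> 'm" where
  "Q i n w j \<equiv> quadratic_mode (mode rhoT) (gen i j) n w"

abbreviation L :: "int \<Rightarrow> 'm \<Rightarrow> 'm \<Rightarrow> complex" where
  "L \<equiv> L_formal d u l crd rhoT"

lemma act_zero_mode: "act (gen i j) 0 v = scM (chig i j) v"
  by (simp add: mode_twisted chi_monom chig_def)

lemma act_nonzero: "n \<noteq> 0 \<Longrightarrow> act a n v = mode rhoM a n v"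
  by (simp add: mode_twisted)

lemma chig_summable: "summable (\<lambda>j. norm (chig i j))"
proof -
  have "summable (\<lambda>j. norm (lam (u i)) * norm c ^ j)"
    using c_less by (intro summable_mult summable_geometric) simp
  then show ?thesis by (simp add: chig_def norm_mult norm_power)
qed

lemma chig_square_summable: "summable (\<lambda>j. norm (chig i j * chig i j))"
proof (rule summable_comparison_test_ev[OF _ summable_mult[OF chig_summable, of "norm (lam (u i))"]])
  have "norm (chig i j) \<le> norm (lam (u i))" for j
    using c_less by (simp add: chig_def norm_mult norm_power power_le_one mult_left_le)
  then show "\<forall>\<^sub>F j in sequentially. norm (norm (chig i j * chig i j)) \<le> norm (lam (u i)) * norm (chig i j)"
    by (intro always_eventually allI) (simp add: norm_mult mult_right_mono)
qed

lemma act_bound: "\<exists>J. \<forall>j\<ge>J. \<forall>i. \<forall>n\<ge>1. act (gen i j) n w = 0"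
proof -
  obtain J where J: "\<And>j x n. j \<ge> J \<Longrightarrow> mode rhoM (monom x j) (int n) w = 0"
    using annihilation_bound[of w] by blast
  have "act (gen i j) n w = 0" if "j \<ge> J" "n \<ge> 1" for i j n
    using J[OF that(1), of "u i" "nat n"] that(2) by (simp add: act_nonzero)
  then show ?thesis by blast
qed

lemma Q_tail:
  assumes "\<And>n. n \<ge> 1 \<Longrightarrow> act (gen i j) n w = 0" "n \<ge> - 1"
  shows "Q i n w j = (if n = 0 then scM (chig i j * chig i j) w
    else if n = - 1 then scM (2 * chig i j) (act (gen i j) (- 1) w) else 0)"
  by (rule T.quadratic_mode_tail) (use assms act_zero_mode in auto)

lemma crd_creation_eventually:
  assumes "i \<in> {1..d}" "n < 0"
  shows "\<forall>\<^sub>F j in sequentially. crd (act (gen i j) n (v j)) b = 0"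
proof -
  obtain J where J: "\<And>j i n v. j \<ge> J \<Longrightarrow> i \<in> {1..d} \<Longrightarrow> n \<ge> 1 \<Longrightarrow> crd (mode rhoM (monom (u i) j) (- int n) v) b = 0"
    using crd_creation_bound[of b] by blast
  have "crd (act (gen i j) n (v j)) b = 0" if "j \<ge> J" for j
    using J[OF that assms(1), of "nat (- n)"] assms(2) by (simp add: act_nonzero)
  then show ?thesis unfolding eventually_sequentially by blast
qed

text \<open>For large \<open>j\<close> only terms with a zero mode remain. For \<open>n = 0\<close>
  they form a geometric series in \<open>c^2\<close>; for \<open>n = - 1\<close> they contain a
  creation mode that the coordinate \<open>b\<close> does not see.\<close>

lemma Q_summable:
  assumes i: "i \<in> {1..d}" and n: "n \<ge> - 1"
  shows "summable (\<lambda>j. crd (Q i n w j) b)"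
proof -
  obtain J where J: "\<And>j i n. j \<ge> J \<Longrightarrow> n \<ge> 1 \<Longrightarrow> act (gen i j) n w = 0" using act_bound[of w] by blast
  have "\<forall>\<^sub>F j in sequentially. crd (Q i n w j) b = (if n = 0 then chig i j * chig i j * crd w b else 0)"
    using crd_creation_eventually[OF i, of "- 1" "\<lambda>_. w" b, simplified] eventually_ge_at_top[of J]
    by eventually_elim (subst Q_tail[OF J n], auto simp: crd_scale)
  then have "summable (\<lambda>j. crd (Q i n w j) b) = summable (\<lambda>j. if n = 0 then chig i j * chig i j * crd w b else 0)"
    by (rule summable_cong)
  moreover have "summable (\<lambda>j. chig i j * chig i j * crd w b)"
    by (intro summable_mult2 summable_norm_cancel[OF chig_square_summable])
  ultimately show ?thesis by (cases "n = 0") simp_all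
qed

lemma L_converges_twisted: "n \<ge> - 1 \<Longrightarrow> L_converges d u Bas crd rhoT n w"
  unfolding L_converges_def using T.quadratic_mode_finite Q_summable by blast

lemma crd_LJ: "crd (LJ J n w) b = 1 / (2 * l) * (\<Sum>i=1..d. \<Sum>j<J. crd (Q i n w j) b)"
  by (simp add: F.LJ_quadratic crd_scale crd_sum)

lemma L_tendsto: "n \<ge> - 1 \<Longrightarrow> (\<lambda>J. crd (LJ J n w) b) \<longlonglongrightarrow> L n w b"
  unfolding crd_LJ L_formal_def
  by (intro tendsto_intros summable_LIMSEQ Q_summable)

lemma L_functional: "n \<ge> - 1 \<Longrightarrow> functional (\<lambda>w. L n w b)"
proof -
  assume n: "n \<ge> - 1"
  have "L n (v + w) b = L n v b + L n w b" for v w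
  proof (rule LIMSEQ_unique[OF L_tendsto[OF n]])
    show "(\<lambda>J. crd (LJ J n (v + w)) b) \<longlonglongrightarrow> L n v b + L n w b"
      unfolding F.LJ_add crd_add by (intro tendsto_add L_tendsto n)
  qed
  moreover have "L n (scM t v) b = t * L n v b" for t v
  proof (rule LIMSEQ_unique[OF L_tendsto[OF n]])
    show "(\<lambda>J. crd (LJ J n (scM t v)) b) \<longlonglongrightarrow> t * L n v b"
      unfolding F.LJ_scale crd_scale by (intro tendsto_mult tendsto_const L_tendsto n)
  qed
  ultimately show ?thesis by (simp add: functional_def)
qed

text \<open>Beyond \<open>J\<close> the summands are given by \<open>Q_tail\<close>: the error of
  truncation is a scalar series for \<open>n = 0\<close> and a formal series of creation operators
  for \<open>n = - 1\<close>.\<close>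

lemma L_split:
  assumes n: "n \<ge> - 1" and J: "\<And>i j n. j \<ge> J \<Longrightarrow> n \<ge> 1 \<Longrightarrow> act (gen i j) n w = 0"
  shows "L n w b = crd (LJ J n w) b + 1 / (2 * l) * (\<Sum>i=1..d.
      if n = 0 then (suminf (\<lambda>j. chig i (j + J) * chig i (j + J))) * crd w b
      else if n = - 1 then (suminf (\<lambda>j. 2 * chig i (j + J) * crd (act (gen i (j + J)) (- 1) w) b)) else 0)"
proof -
  have "(suminf (\<lambda>j. crd (Q i n w j) b)) = (\<Sum>j<J. crd (Q i n w j) b) +
     (if n = 0 then (suminf (\<lambda>j. chig i (j + J) * chig i (j + J))) * crd w b
      else if n = - 1 then (suminf (\<lambda>j. 2 * chig i (j + J) * crd (act (gen i (j + J)) (- 1) w) b)) else 0)"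
    if i: "i \<in> {1..d}" for i
  proof -
    have t: "crd (Q i n w (j + J)) b = (if n = 0 then chig i (j + J) * chig i (j + J) * crd w b
      else if n = - 1 then 2 * chig i (j + J) * crd (act (gen i (j + J)) (- 1) w) b else 0)" for j
      by (subst Q_tail[OF J n]) (auto simp: crd_scale)
    have s: "summable (\<lambda>j. chig i (j + J) * chig i (j + J))"
      using summable_norm_cancel[OF chig_square_summable] by (rule summable_ignore_initial_segment)
    have "(suminf (\<lambda>j. crd (Q i n w j) b)) = (suminf (\<lambda>j. crd (Q i n w (j + J)) b)) + (\<Sum>j<J. crd (Q i n w j) b)"
      by (rule suminf_split_initial_segment) (rule Q_summable[OF i n])
    then show ?thesis by (auto simp: t suminf_mult2[OF s])
  qed
  then show ?thesis
    unfolding L_formal_def crd_LJ by (simp add: sum.distrib distrib_left)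
qed

text \<open>For \<open>n >= 0\<close> the tail is at most a scalar multiple of \<open>w\<close>. For
  \<open>n = - 1\<close> it is an infinite formal combination, unless all scalars in it are
  0.\<close>

lemma L_vector_exists:
  assumes n: "n \<ge> - 1" and "n \<ge> 0 \<or> c = 0 \<or> (\<forall>h. lam h = 0)"
  shows "\<exists>v. crd v = L n w"
proof -
  obtain J0 where J0: "\<And>j i n. j \<ge> J0 \<Longrightarrow> n \<ge> 1 \<Longrightarrow> act (gen i j) n w = 0" using act_bound[of w] by blast
  \<comment> \<open>The bound \<open>J >= 1\<close> keeps \<open>c^0 = 1\<close> out of the tail, so
    that for \<open>c = 0\<close> all scalars in the tail vanish.\<close>
  define J where "J = max J0 1"
  define t where "t = 1 / (2 * l) * (\<Sum>i=1..d. if n = 0 then (suminf (\<lambda>j. chig i (j + J) * chig i (j + J))) else 0)"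
  have z: "chig i (j + J) = 0" if "n = - 1" for i j
    using assms that by (auto simp: chig_def J_def)
  have "L n w b = crd (LJ J n w + scM t w) b" for b
  proof -
    have "(\<Sum>i=1..d. if n = 0 then suminf (\<lambda>j. chig i (j + J) * chig i (j + J)) * crd w b
        else if n = - 1 then suminf (\<lambda>j. 2 * chig i (j + J) * crd (act (gen i (j + J)) (- 1) w) b) else 0)
      = (\<Sum>i=1..d. if n = 0 then suminf (\<lambda>j. chig i (j + J) * chig i (j + J)) else 0) * crd w b"
      unfolding sum_distrib_right by (intro sum.cong refl) (auto simp: z)
    then show ?thesis
      using L_split[OF n J0, of J b] by (simp add: J_def crd_add crd_scale t_def)
  qed
  then show ?thesis by (metis ext)
qed

text \<open>The common source of both kinds of products in the theorem: \<open>tau\<close> is a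
  coordinate of \<open>L m\<close> or of a vertex operator. The hypothesis on \<open>tau\<close>
  controls the creation terms in the tail for \<open>n = - 1\<close>; for \<open>n = 0\<close> the
  tail is a multiple of \<open>w\<close>, and the series of squares suffices. Then
  \<open>functional_series\<close> applies to each \<open>i\<close>.\<close>

lemma extension_limit:
  assumes tau: "functional tau" and n: "n \<ge> - 1"
    and S: "\<And>i w. i \<in> {1..d} \<Longrightarrow> summable (\<lambda>j. norm (chig i j * tau (act (gen i j) (- 1) w)))"
  obtains s where "((\<lambda>b. L n w b * tau b) has_sum s) Bas" "(\<lambda>J. tau (LJ J n w)) \<longlonglongrightarrow> s"
proof -
  obtain J where J: "\<And>j i n. j \<ge> J \<Longrightarrow> n \<ge> 1 \<Longrightarrow> act (gen i j) n w = 0" using act_bound[of w] by blast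
  have G: "summable (\<lambda>j. seminorm tau (Q i n w j))" if i: "i \<in> {1..d}" for i
  proof -
    define K where "K = {b. crd w b \<noteq> 0}"
    define B1 where "B1 j = (if n = 0 then norm (chig i j * chig i j) * seminorm tau w else 0)" for j
    define B2 where "B2 j = (if n = - 1 then 2 * (\<Sum>b\<in>K. norm (crd w b) * norm (chig i j * tau (act (gen i j) (- 1) b))) else 0)" for j
    \<comment> \<open>Creation modes map the PBW basis into itself, so on the image of a basis
      vector the seminorm is a single absolute value of \<open>tau\<close>.\<close>
    have creation: "act (gen i j) (- 1) b \<in> Bas" if b: "b \<in> Bas" for j b
    proof -
      obtain xs where xs: "b = pbw_word xs" "set xs \<subseteq> valid_idx" using b by (rule Bas_E)
      have "act (gen i j) (- 1) b = pbw_word ((i, j, 1) # xs)" by (simp add: xs act_nonzero)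
      moreover have "set ((i, j, 1) # xs) \<subseteq> valid_idx" using xs i by (auto simp: valid_idx_def)
      ultimately show ?thesis unfolding pbw_basis_eq by blast
    qed
    have cr: "seminorm tau (act (gen i j) (- 1) w) \<le> (\<Sum>b\<in>K. norm (crd w b) * norm (tau (act (gen i j) (- 1) b)))" for j
    proof -
      have "act (gen i j) (- 1) w = (\<Sum>b\<in>K. scM (crd w b) (act (gen i j) (- 1) b))"
        using arg_cong[OF crd_expansion[of w], of "act (gen i j) (- 1)"]
        by (simp add: K_def B.is_field_sum T.act_scale)
      then have "seminorm tau (act (gen i j) (- 1) w) \<le> (\<Sum>b\<in>K. seminorm tau (scM (crd w b) (act (gen i j) (- 1) b)))"
        using seminorm_sum by simp
      also have "\<dots> = (\<Sum>b\<in>K. norm (crd w b) * norm (tau (act (gen i j) (- 1) b)))"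
      proof (intro sum.cong refl)
        fix b assume "b \<in> K"
        then have "b \<in> Bas" unfolding K_def using crd_outside by blast
        from seminorm_basis[OF creation[OF this]] show "seminorm tau (scM (crd w b) (act (gen i j) (- 1) b)) =
            norm (crd w b) * norm (tau (act (gen i j) (- 1) b))"
          by (simp add: seminorm_scale)
      qed
      finally show ?thesis .
    qed
    have "norm (seminorm tau (Q i n w j)) \<le> B1 j + B2 j" if "j \<ge> J" for j
    proof -
      have m: "2 * norm (chig i j) * seminorm tau (act (gen i j) (- 1) w) \<le>
         2 * (\<Sum>b\<in>K. norm (crd w b) * norm (chig i j * tau (act (gen i j) (- 1) b)))"
        using mult_left_mono[OF cr, of "2 * norm (chig i j)" j]
        by (simp add: sum_distrib_left norm_mult mult_ac)
      show ?thesis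
        using m by (subst Q_tail[OF J[OF that] n])
          (auto simp: B1_def B2_def seminorm_scale norm_mult abs_of_nonneg[OF seminorm_nonneg] seminorm_def[of tau 0])
    qed
    then have ev: "\<forall>\<^sub>F j in sequentially. norm (seminorm tau (Q i n w j)) \<le> B1 j + B2 j"
      unfolding eventually_sequentially by blast
    have "summable B1" unfolding B1_def by (cases "n = 0") (simp_all add: summable_mult2 chig_square_summable)
    moreover have "summable B2" unfolding B2_def
      by (cases "n = - 1") (simp_all add: summable_mult summable_sum S[OF i])
    ultimately show ?thesis using summable_comparison_test_ev[OF ev summable_add] by blast
  qed
  define s where "s = 1 / (2 * l) * (\<Sum>i=1..d. suminf (\<lambda>j. tau (Q i n w j)))"
  have "((\<lambda>b. 1 / (2 * l) * (\<Sum>i=1..d. (suminf (\<lambda>j. crd (Q i n w j) b)) * tau b)) has_sum s) Bas"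
    unfolding s_def
  proof (rule has_sum_cmult_right, rule has_sum_sum_finite)
    fix i assume i: "i \<in> {1..d}"
    show "((\<lambda>b. suminf (\<lambda>j. crd (Q i n w j) b) * tau b) has_sum suminf (\<lambda>j. tau (Q i n w j))) Bas"
      by (rule functional_series(1)[OF tau G[OF i]]) (rule Q_summable[OF i n])
  qed
  then have "((\<lambda>b. L n w b * tau b) has_sum s) Bas"
    by (simp add: L_formal_def sum_distrib_right)
  moreover have "(\<lambda>J. tau (LJ J n w)) \<longlonglongrightarrow> s"
    unfolding F.LJ_quadratic s_def functional_scale[OF tau] functional_sum[OF tau]
  proof (rule tendsto_mult[OF tendsto_const tendsto_sum])
    fix i assume i: "i \<in> {1..d}"
    show "(\<lambda>J. \<Sum>j<J. tau (Q i n w j)) \<longlonglongrightarrow> suminf (\<lambda>j. tau (Q i n w j))"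
      by (rule summable_LIMSEQ, rule functional_series(2)[OF tau G[OF i]]) (rule Q_summable[OF i n])
  qed
  ultimately show ?thesis by (rule that)
qed

text \<open>For large \<open>j\<close> the creation mode commutes with the field of
  \<open>A\<close>, because the nonnegative modes of \<open>u t^j\<close> kill \<open>A\<close>. It
  then stands in front, and the coordinate \<open>b\<close> does not see it: the series is
  eventually 0.\<close>

lemma YW_summable:
  assumes i: "i \<in> {1..d}"
  shows "summable (\<lambda>j. norm (chig i j * crd (YW A k (act (gen i j) (- 1) w)) b))"
proof -
  obtain J where J: "\<And>j x n. j \<ge> J \<Longrightarrow> mode rhoM (monom x j) (int n) A = 0"
    using annihilation_bound[of A] by blast
  have c: "YW A k (act (gen i j) (- 1) w) = act (gen i j) (- 1) (YW A k w)" if "j \<ge> J" for j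
    using F.YW.Y_commutator[of 0 "gen i j" A "- 1" k w] J[OF that] by simp
  have "\<forall>\<^sub>F j in sequentially. norm (chig i j * crd (YW A k (act (gen i j) (- 1) w)) b) = 0"
    using crd_creation_eventually[OF i, of "- 1" "\<lambda>_. YW A k w" b, simplified] eventually_ge_at_top[of J]
    by eventually_elim (simp add: c)
  then have "summable (\<lambda>j. norm (chig i j * crd (YW A k (act (gen i j) (- 1) w)) b)) \<longleftrightarrow> summable (\<lambda>j. 0 :: real)"
    by (rule summable_cong)
  then show ?thesis by simp
qed

text \<open>Commuting the creation mode to the front, where the coordinate \<open>b\<close> no
  longer sees it for large \<open>j\<close>, leaves the mode \<open>m - 1\<close> on
  \<open>w\<close>. That is again creation for \<open>m < 1\<close>, kills \<open>w\<close> for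
  \<open>m > 1\<close>, and for \<open>m = 1\<close> is a zero mode, which squares the
  scalar.\<close>

lemma L_summable:
  assumes i: "i \<in> {1..d}" and m: "m \<ge> - 1"
  shows "summable (\<lambda>j. norm (chig i j * L m (act (gen i j) (- 1) w) b))"
proof -
  obtain J where J: "\<And>j i n. j \<ge> J \<Longrightarrow> n \<ge> 1 \<Longrightarrow> act (gen i j) n w = 0" using act_bound[of w] by blast
  obtain Jb where Jb: "\<And>j i n v. j \<ge> Jb \<Longrightarrow> i \<in> {1..d} \<Longrightarrow> n \<ge> 1 \<Longrightarrow> crd (mode rhoM (monom (u i) j) (- int n) v) b = 0"
    using crd_creation_bound[of b] by blast
  have cb: "crd (act (gen i j) n v) b = 0" if "j \<ge> Jb" "n < 0" for j n v
    using Jb[OF that(1) i, of "nat (- n)"] that(2) by (simp add: act_nonzero)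
  have "L m (act (gen i j) (- 1) w) b = crd (act (gen i j) (m - 1) w) b" if "j \<ge> Jb" for j
  proof (rule LIMSEQ_unique[OF L_tendsto[OF m]])
    have "crd (LJ J m (act (gen i j) (- 1) w)) b = crd (act (gen i j) (m - 1) w) b" if "J > j" for J
    proof -
      have "LJ J m (act (gen i j) (- 1) w) = act (gen i j) (- 1) (LJ J m w) + act (gen i j) (m - 1) w"
        using F.mode_LJ_commutator[OF i, of j "- 1" J m w] that by (simp add: algebra_simps)
      then show ?thesis using cb[OF \<open>j \<ge> Jb\<close>, of "- 1"] by (simp add: crd_add)
    qed
    then have "\<forall>\<^sub>F J in sequentially. crd (LJ J m (act (gen i j) (- 1) w)) b = crd (act (gen i j) (m - 1) w) b"
      by (rule eventually_mono[OF eventually_gt_at_top[of j]])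
    then show "(\<lambda>J. crd (LJ J m (act (gen i j) (- 1) w)) b) \<longlonglongrightarrow> crd (act (gen i j) (m - 1) w) b"
      by (rule tendsto_eventually)
  qed
  moreover have "norm (chig i j * crd (act (gen i j) (m - 1) w) b) \<le> norm (chig i j * chig i j) * norm (crd w b)" if "j \<ge> max J Jb" for j
  proof -
    consider "m = 1" | "m < 1" | "m > 1" by linarith
    then show ?thesis
    proof cases
      case 1
      then show ?thesis by (simp add: act_zero_mode crd_scale norm_mult)
    next
      case 2
      then show ?thesis using cb[of j "m - 1"] that by simp
    next
      case 3
      then show ?thesis using J[of j "m - 1"] that by simp
    qed
  qed
  ultimately have "\<forall>j\<ge>max J Jb. norm (norm (chig i j * L m (act (gen i j) (- 1) w) b)) \<le> norm (chig i j * chig i j) * norm (crd w b)"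
    by simp
  then have "\<forall>\<^sub>F j in sequentially. norm (norm (chig i j * L m (act (gen i j) (- 1) w) b)) \<le> norm (chig i j * chig i j) * norm (crd w b)"
    unfolding eventually_sequentially by blast
  then show ?thesis by (rule summable_comparison_test_ev) (intro summable_mult2 chig_square_summable)
qed

text \<open>By \<open>extension_limit\<close> the extended product is the limit with only the inner
  factor truncated. Truncating the outer factor at the same \<open>J\<close> changes the coefficient
  at \<open>b\<close> only for \<open>m = 0\<close>, and then by the tail of a convergent series
  times a convergent sequence.\<close>

lemma L_product_limit:
  assumes m: "m \<ge> - 1" and n: "n \<ge> - 1"
  obtains s where "((\<lambda>b'. L n w b' * L m b' b) has_sum s) Bas" "(\<lambda>J. crd (LJ J m (LJ J n w)) b) \<longlonglongrightarrow> s"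
proof -
  obtain s where s: "((\<lambda>b'. L n w b' * L m b' b) has_sum s) Bas" "(\<lambda>J. L m (LJ J n w) b) \<longlonglongrightarrow> s"
    using extension_limit[OF L_functional[OF m] n L_summable[OF _ m]] by blast
  obtain J0 where J0: "\<And>j i n. j \<ge> J0 \<Longrightarrow> n \<ge> 1 \<Longrightarrow> act (gen i j) n w = 0" using act_bound[of w] by blast
  obtain Jb where Jb: "\<And>j i n v. j \<ge> Jb \<Longrightarrow> i \<in> {1..d} \<Longrightarrow> n \<ge> 1 \<Longrightarrow> crd (mode rhoM (monom (u i) j) (- int n) v) b = 0"
    using crd_creation_bound[of b] by blast
  define r where "r J = 1 / (2 * l) * (\<Sum>i=1..d. suminf (\<lambda>j. chig i (j + J) * chig i (j + J)))" for J
  have "L m (LJ J n w) b - (if m = 0 then r J * crd (LJ J n w) b else 0) = crd (LJ J m (LJ J n w)) b" if J: "J \<ge> max J0 Jb" for J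
  proof -
    define v where "v = LJ J n w"
    \<comment> \<open>Modes with \<open>j >= J\<close> commute with \<open>LJ J n\<close>, so their
      positive ones kill \<open>v\<close> as they kill \<open>w\<close>; hence the tail formula
      holds for \<open>v\<close> from the same \<open>J\<close> on, although \<open>v\<close> varies
      with \<open>J\<close>.\<close>
    have "i \<in> {1..d} \<Longrightarrow> j \<ge> J \<Longrightarrow> k \<ge> 1 \<Longrightarrow> act (gen i j) k v = 0" for i j k
      using F.mode_LJ_commutator[of i j k J n w] J0[of j k i] J by (simp add: v_def F.LJ_def)
    then have tail: "Q i m v j = (if m = 0 then scM (chig i j * chig i j) v
      else if m = - 1 then scM (2 * chig i j) (act (gen i j) (- 1) v) else 0)" if "i \<in> {1..d}" "j \<ge> J" for i j
      using that by (intro Q_tail m) auto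
    have cb: "crd (act (gen i j) (- 1) v) b = 0" if "i \<in> {1..d}" "j \<ge> J" for i j
      using Jb[of j i 1 v] that J by (simp add: act_nonzero)
    have "(suminf (\<lambda>j. crd (Q i m v j) b)) = (\<Sum>j<J. crd (Q i m v j) b) +
       (if m = 0 then (suminf (\<lambda>j. chig i (j + J) * chig i (j + J))) * crd v b else 0)" if i: "i \<in> {1..d}" for i
    proof -
      have s: "summable (\<lambda>j. chig i (j + J) * chig i (j + J))"
        using summable_norm_cancel[OF chig_square_summable] by (rule summable_ignore_initial_segment)
      have "(suminf (\<lambda>j. crd (Q i m v j) b)) = (suminf (\<lambda>j. crd (Q i m v (j + J)) b)) + (\<Sum>j<J. crd (Q i m v j) b)"
        by (rule suminf_split_initial_segment) (rule Q_summable[OF i m])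
      also have "(\<lambda>j. crd (Q i m v (j + J)) b) = (\<lambda>j. if m = 0 then chig i (j + J) * chig i (j + J) * crd v b else 0)"
        using i by (intro ext) (simp add: tail cb crd_scale)
      finally show ?thesis by (auto simp: suminf_mult2[OF s])
    qed
    then have "L m v b = crd (LJ J m v) b + (if m = 0 then r J * crd v b else 0)"
      unfolding L_formal_def crd_LJ r_def by (simp add: sum.distrib distrib_left sum_distrib_right mult.assoc)
    then show ?thesis by (simp add: v_def)
  qed
  then have ev: "\<forall>\<^sub>F J in sequentially. L m (LJ J n w) b - (if m = 0 then r J * crd (LJ J n w) b else 0) = crd (LJ J m (LJ J n w)) b"
    unfolding eventually_sequentially by blast
  have "(\<lambda>J. suminf (\<lambda>j. chig i (j + J) * chig i (j + J))) \<longlonglongrightarrow> 0" for i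
  proof -
    have sm: "summable (\<lambda>j. chig i j * chig i j)" by (rule summable_norm_cancel[OF chig_square_summable])
    have "(\<lambda>J. (suminf (\<lambda>j. chig i j * chig i j)) - (\<Sum>j<J. chig i j * chig i j)) \<longlonglongrightarrow>
        (suminf (\<lambda>j. chig i j * chig i j)) - (suminf (\<lambda>j. chig i j * chig i j))"
      by (intro tendsto_diff tendsto_const summable_LIMSEQ sm)
    then show ?thesis by (simp add: suminf_minus_initial_segment[OF sm])
  qed
  then have "r \<longlonglongrightarrow> 1 / (2 * l) * (\<Sum>i=1..d. 0)"
    unfolding r_def by (intro tendsto_mult tendsto_const tendsto_sum)
  then have "(\<lambda>J. r J * crd (LJ J n w) b) \<longlonglongrightarrow> 0 * L n w b"
    by (intro tendsto_mult L_tendsto n) simp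
  then have "(\<lambda>J. L m (LJ J n w) b - (if m = 0 then r J * crd (LJ J n w) b else 0)) \<longlonglongrightarrow> s - 0"
    by (intro tendsto_diff s) (cases "m = 0", auto)
  with ev have "(\<lambda>J. crd (LJ J m (LJ J n w)) b) \<longlonglongrightarrow> s"
    using Lim_transform_eventually by fastforce
  with s(1) show ?thesis by (rule that)
qed

theorem L_virasoro:
  assumes m: "m \<ge> - 1" and n: "n \<ge> - 1"
  shows "extension_defined Bas (L m) (L n w)"
    and "extend_operator Bas (L m) (L n w) b - extend_operator Bas (L n) (L m w) b = of_int (m - n) * L (m + n) w b"
proof -
  show "extension_defined Bas (L m) (L n w)"
    unfolding extension_defined_def
  proof
    fix b
    obtain s where "((\<lambda>b'. L n w b' * L m b' b) has_sum s) Bas" by (rule L_product_limit[OF m n])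
    then show "(\<lambda>b'. L n w b' * L m b' b) summable_on Bas" by (auto simp: summable_on_def)
  qed
  obtain s where s: "((\<lambda>b'. L n w b' * L m b' b) has_sum s) Bas" "(\<lambda>J. crd (LJ J m (LJ J n w)) b) \<longlonglongrightarrow> s"
    by (rule L_product_limit[OF m n])
  obtain s' where s': "((\<lambda>b'. L m w b' * L n b' b) has_sum s') Bas" "(\<lambda>J. crd (LJ J n (LJ J m w)) b) \<longlonglongrightarrow> s'"
    by (rule L_product_limit[OF n m])
  have "(\<lambda>J. crd (LJ J m (LJ J n w)) b - crd (LJ J n (LJ J m w)) b) \<longlonglongrightarrow> s - s'"
    by (intro tendsto_diff s s')
  then have 1: "(\<lambda>J. of_int (m - n) * crd (LJ J (m + n) w) b) \<longlonglongrightarrow> s - s'"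
    by (simp only: F.LJ_virasoro[OF m n] crd_scale flip: crd_diff)
  have 2: "(\<lambda>J. of_int (m - n) * crd (LJ J (m + n) w) b) \<longlonglongrightarrow> of_int (m - n) * L (m + n) w b"
  proof (cases "m + n \<ge> - 1")
    case True
    then show ?thesis by (intro tendsto_mult tendsto_const L_tendsto)
  next
    case False
    \<comment> \<open>What remains is \<open>m = n = - 1\<close>; the factor 0 makes the convergence
      of \<open>L(-2)\<close> immaterial.\<close>
    then have "m - n = 0" using m n by linarith
    then show ?thesis by simp
  qed
  from LIMSEQ_unique[OF 1 2] show "extend_operator Bas (L m) (L n w) b - extend_operator Bas (L n) (L m w) b = of_int (m - n) * L (m + n) w b"
    unfolding extend_operator_def infsumI[OF s(1)] infsumI[OF s'(1)] .
qed

end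

section \<open>The operators on M(l) itself\<close>

context vacuum_field_self
begin

abbreviation LM :: "int \<Rightarrow> 'm \<Rightarrow> 'm \<Rightarrow> complex" where
  "LM \<equiv> L_formal d u l crd rhoM"

text \<open>On M(l) the zero modes vanish, so the tail terms of \<open>quadratic_mode_tail\<close>
  have \<open>x = 0\<close>. Hence the sum over \<open>j\<close> is finite on each vector and
  \<open>L(n)\<close> maps M(l) to itself.\<close>

lemma quadratic_mode_eventually_zero: "\<exists>J. \<forall>j\<ge>J. \<forall>i. \<forall>n\<ge>-1. quadratic_mode (mode rhoM) (monom (u i) j) n v = 0"
proof -
  obtain J where J: "\<And>j x n. j \<ge> J \<Longrightarrow> mode rhoM (monom x j) (int n) v = 0"
    using annihilation_bound[of v] by blast
  have "quadratic_mode (mode rhoM) (monom (u i) j) n v = 0" if "j \<ge> J" "n \<ge> - 1" for i j n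
  proof -
    have "mode rhoM (monom (u i) j) k v = 0" if "k \<ge> 1" for k
      using J[OF \<open>j \<ge> J\<close>, of "u i" "nat k"] that by simp
    then show ?thesis
      by (subst M.quadratic_mode_tail[where x = 0]) (use that in \<open>auto simp: mode_zero_M\<close>)
  qed
  then show ?thesis by blast
qed

lemma L_self_truncated:
  assumes "\<And>j i n. j \<ge> J \<Longrightarrow> n \<ge> - 1 \<Longrightarrow> quadratic_mode (mode rhoM) (monom (u i) j) n v = 0" "n \<ge> - 1"
  shows "crd (S.LJ J n v) = LM n v"
proof
  fix b
  have "suminf (\<lambda>j. crd (quadratic_mode (mode rhoM) (monom (u i) j) n v) b) =
     (\<Sum>j<J. crd (quadratic_mode (mode rhoM) (monom (u i) j) n v) b)" for i
    by (rule suminf_finite) (use assms in auto)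
  then show "crd (S.LJ J n v) b = LM n v b"
    by (simp add: S.LJ_quadratic L_formal_def crd_scale crd_sum)
qed

lemma L_self_converges:
  assumes "n \<ge> - 1"
  shows "L_converges d u Bas crd rhoM n v"
proof -
  obtain J where J: "\<And>j i n. j \<ge> J \<Longrightarrow> n \<ge> - 1 \<Longrightarrow> quadratic_mode (mode rhoM) (monom (u i) j) n v = 0"
    using quadratic_mode_eventually_zero by blast
  have "summable (\<lambda>j. crd (quadratic_mode (mode rhoM) (monom (u i) j) n v) b)" for i b
    by (rule summable_finite[of "{..<J}"]) (use J assms in auto)
  then show ?thesis unfolding L_converges_def using M.quadratic_mode_finite by blast
qed

lemma L_self_exists: "n \<ge> - 1 \<Longrightarrow> \<exists>v'. crd v' = LM n v"
  using quadratic_mode_eventually_zero[of v] L_self_truncated by metis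

lemma L_vector_truncated:
  assumes "\<And>j i n. j \<ge> J \<Longrightarrow> n \<ge> - 1 \<Longrightarrow> quadratic_mode (mode rhoM) (monom (u i) j) n v = 0" "n \<ge> - 1"
  shows "L_vector d u l crd rhoM n v = S.LJ J n v"
  unfolding L_vector_def
proof (rule the_equality)
  show "crd (S.LJ J n v) = LM n v" by (rule L_self_truncated) (use assms in auto)
  then show "v' = S.LJ J n v" if "crd v' = LM n v" for v' using that crd_inject by metis
qed

end

context twisted_field
begin

text \<open>Once \<open>omega J\<close> acts on \<open>A\<close> like the full sum over
  \<open>j\<close>, the right-hand side of the commutator formula no longer depends on
  \<open>J\<close>; only the left-hand side requires a limit, which \<open>L_tendsto\<close> and
  \<open>extension_limit\<close> provide.\<close>

theorem L_YW_commutator: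
  assumes n: "n \<ge> - 1"
  shows "extension_defined Bas (\<lambda>b. crd (YW A k b)) (L n w)"
    and "L n (YW A k w) b - extend_operator Bas (\<lambda>b'. crd (YW A k b')) (L n w) b =
      crd (\<Sum>i=-1..n. scM (of_nat (nat (n + 1) choose nat (i + 1)))
          (YW (L_vector d u l crd rhoM i A) (k + n - i) w)) b"
proof -
  have tau: "functional (\<lambda>v. crd (YW A k v) b)" for b
    by (simp add: functional_def crd_add crd_scale B.is_field_add B.is_field_scale)
  show "extension_defined Bas (\<lambda>b. crd (YW A k b)) (L n w)"
    unfolding extension_defined_def
  proof
    fix b
    obtain s where "((\<lambda>b'. L n w b' * crd (YW A k b') b) has_sum s) Bas"
      by (rule extension_limit[OF tau n YW_summable, of w])
    then show "(\<lambda>b'. L n w b' * crd (YW A k b') b) summable_on Bas" by (auto simp: summable_on_def)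
  qed
  obtain s where s: "((\<lambda>b'. L n w b' * crd (YW A k b') b) has_sum s) Bas"
    "(\<lambda>J. crd (YW A k (LJ J n w)) b) \<longlonglongrightarrow> s"
    by (rule extension_limit[OF tau n YW_summable, of w])
  obtain J0 where J0: "\<And>j i n. j \<ge> J0 \<Longrightarrow> n \<ge> - 1 \<Longrightarrow> quadratic_mode (mode rhoM) (monom (u i) j) n A = 0"
    using F.V.quadratic_mode_eventually_zero[of A] by blast
  let ?N = "nat (n + 1)"
  let ?R = "\<Sum>i=-1..n. scM (of_nat (nat (n + 1) choose nat (i + 1))) (YW (L_vector d u l crd rhoM i A) (k + n - i) w)"
  have "LJ J n (YW A k w) - YW A k (LJ J n w) = ?R" if "J \<ge> J0" for J
  proof -
    have om: "YM (F.omega J) (int t) A = L_vector d u l crd rhoM (int t - 1) A" for t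
    proof -
      have "L_vector d u l crd rhoM (int t - 1) A = F.V.S.LJ J (int t - 1) A"
        by (rule F.V.L_vector_truncated) (use J0 that in auto)
      then show ?thesis by (simp add: F.V.S.LJ_def)
    qed
    have "LJ J n (YW A k w) - YW A k (LJ J n w) =
      Sum_any (\<lambda>t::nat. scM (of_int (n + 1) gchoose t) (YW (YM (F.omega J) (int t) A) (n + 1 + k - int t) w))"
      unfolding F.LJ_def by (rule F.commutator_formula)
    also have "\<dots> = (\<Sum>t<Suc ?N. scM (of_int (n + 1) gchoose t) (YW (YM (F.omega J) (int t) A) (n + 1 + k - int t) w))"
    proof (rule Sum_any_lessThan)
      fix t assume "t \<ge> Suc ?N"
      have "(of_int (n + 1) :: complex) = of_nat ?N" using n by simp
      then have "(of_int (n + 1) gchoose t :: complex) = 0"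
        using \<open>t \<ge> Suc ?N\<close> by (simp only: gbinomial_nat_eq_0[of ?N t])
      then show "scM (of_int (n + 1) gchoose t) (YW (YM (F.omega J) (int t) A) (n + 1 + k - int t) w) = 0"
        by simp
    qed
    also have "\<dots> = (\<Sum>t<Suc ?N. scM (of_nat (?N choose t)) (YW (L_vector d u l crd rhoM (int t - 1) A) (k + n - (int t - 1)) w))"
    proof (intro sum.cong refl)
      fix t
      have "(of_int (n + 1) :: complex) = of_nat ?N" using n by simp
      then have "(of_int (n + 1) gchoose t :: complex) = of_nat (?N choose t)"
        by (simp only: binomial_gbinomial)
      moreover have "n + 1 + k - int t = k + n - (int t - 1)" by simp
      ultimately show "scM (of_int (n + 1) gchoose t) (YW (YM (F.omega J) (int t) A) (n + 1 + k - int t) w) =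
        scM (of_nat (?N choose t)) (YW (L_vector d u l crd rhoM (int t - 1) A) (k + n - (int t - 1)) w)"
        by (simp only: om)
    qed
    \<comment> \<open>The index is \<open>t = i + 1\<close>, since \<open>L(i)\<close> is the mode
      \<open>i + 1\<close> of the conformal vector.\<close>
    also have "\<dots> = ?R"
      by (rule sum.reindex_bij_witness[of _ "\<lambda>i. nat (i + 1)" "\<lambda>t. int t - 1"]) (use n in auto)
    finally show ?thesis .
  qed
  then have "\<forall>\<^sub>F J in sequentially. crd (LJ J n (YW A k w)) b - crd (YW A k (LJ J n w)) b = crd ?R b"
    unfolding eventually_sequentially by (intro exI[of _ J0]) (simp flip: crd_diff)
  then have "(\<lambda>J. crd (LJ J n (YW A k w)) b - crd (YW A k (LJ J n w)) b) \<longlonglongrightarrow> crd ?R b"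
    by (rule tendsto_eventually)
  moreover have "(\<lambda>J. crd (LJ J n (YW A k w)) b - crd (YW A k (LJ J n w)) b) \<longlonglongrightarrow> L n (YW A k w) b - s"
    by (intro tendsto_diff s L_tendsto n)
  ultimately have "crd ?R b = L n (YW A k w) b - s" by (rule LIMSEQ_unique)
  then show "L n (YW A k w) b - extend_operator Bas (\<lambda>b'. crd (YW A k b')) (L n w) b = crd ?R b"
    unfolding extend_operator_def infsumI[OF s(1)] by simp
qed

end

section \<open>Restricted graded modules for the current algebra\<close>

theorem theorem4p3:
  fixes scaleH :: "complex \<Rightarrow> 'h::ab_group_add \<Rightarrow> 'h"
    and form :: "'h \<Rightarrow> 'h \<Rightarrow> complex" and d :: nat and u :: "nat \<Rightarrow> 'h"
    and l :: complex
    and scaleM :: "complex \<Rightarrow> 'm::ab_group_add \<Rightarrow> 'm"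
    and rhoM :: "'h affine \<Rightarrow> 'm \<Rightarrow> 'm" and vac :: 'm
  assumes "form_with_orthonormal_basis scaleH form d u"
    and "vacuum_module scaleH form l scaleM rhoM vac"
  defines "B \<equiv> pbw_basis d u rhoM vac"
    and "coord \<equiv> pbw_coord d u scaleM rhoM vac"
  shows
    "(\<forall>(scaleW :: complex \<Rightarrow> 'w::ab_group_add \<Rightarrow> 'w) rhoW W.
        restricted_graded_module scaleH form l scaleW rhoW W \<longrightarrow>
          (\<exists>!YW. vacuum_module_structure scaleM rhoM vac scaleW rhoW YW) \<and>
          (\<forall>YW. vacuum_module_structure scaleM rhoM vac scaleW rhoW YW \<longrightarrow>
             has_field_product_formula rhoM vac scaleW rhoW YW))
     \<and>
     (l \<noteq> 0 \<longrightarrow>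
        (\<forall>n\<ge>-1. \<forall>A. L_converges d u B coord rhoM n A \<and>
           (\<exists>v. coord v = L_formal d u l coord rhoM n A)) \<and>
        (\<forall>lam c. Vector_Spaces.linear scaleH (*) lam \<and> norm c < 1 \<longrightarrow>
          (let rho = twisted_action scaleM rhoM lam c;
               L = L_formal d u l coord rho;
               L\<^sub>M = L_vector d u l coord rhoM
           in
            (\<exists>W. restricted_graded_module scaleH form l scaleM rho W) \<and>
            (\<exists>!YW. vacuum_module_structure scaleM rhoM vac scaleM rho YW) \<and>
            (\<forall>YW. vacuum_module_structure scaleM rhoM vac scaleM rho YW \<longrightarrow>
              irreducible_module scaleM YW \<and>
              (\<forall>n\<ge>-1. \<forall>w. L_converges d u B coord rho n w) \<and>
              (\<forall>n\<ge>-1. n \<ge> 0 \<or> c = 0 \<or> (\<forall>h. lam h = 0) \<longrightarrow> (\<forall>w. \<exists>v. coord v = L n w)) \<and>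
              (\<forall>m\<ge>-1. \<forall>n\<ge>-1. \<forall>w.
                 extension_defined B (L m) (L n w) \<and>
                 extension_defined B (L n) (L m w) \<and>
                 (\<forall>b\<in>B. extend_operator B (L m) (L n w) b - extend_operator B (L n) (L m w) b =
                    of_int (m - n) * L (m + n) w b)) \<and>
              (\<forall>A. \<forall>n\<ge>-1. \<forall>k w.
                 extension_defined B (\<lambda>b. coord (YW A k b)) (L n w) \<and>
                 (\<forall>b\<in>B. L n (YW A k w) b - extend_operator B (\<lambda>b'. coord (YW A k b')) (L n w) b =
                    coord (\<Sum>i=-1..n. scaleM (of_nat (nat (n + 1) choose nat (i + 1)))
                                       (YW (L\<^sub>M i A) (k + n - i) w)) b))))))"
proof -
  interpret affine_lie scaleH form d u l
    by (intro affine_lie.intro assms)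
  interpret V: vacuum_setup scaleH form d u l scaleM rhoM vac
    by unfold_locales (rule assms)
  have part1: "(\<exists>!YW. vacuum_module_structure scaleM rhoM vac scaleW rhoW YW) \<and>
      (\<forall>YW. vacuum_module_structure scaleM rhoM vac scaleW rhoW YW \<longrightarrow>
         has_field_product_formula rhoM vac scaleW rhoW YW)"
    if "restricted_graded_module scaleH form l scaleW rhoW W"
    for scaleW :: "complex \<Rightarrow> 'w \<Rightarrow> 'w" and rhoW W
  proof -
    interpret W: level_module scaleH form d u l scaleW rhoW
      by (rule restricted_graded_level_module[OF affine_lie_axioms that])
    interpret R: vacuum_rep scaleH form d u l scaleM rhoM vac scaleW rhoW ..
    show ?thesis using R.module_structure by blast
  qed
  have part2: "(\<forall>n\<ge>-1. \<forall>A. L_converges d u B coord rhoM n A \<and> (\<exists>v. coord v = L_formal d u l coord rhoM n A))"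
    if "l \<noteq> 0"
  proof -
    interpret S: vacuum_field_self scaleH form d u l scaleM rhoM vac
      by unfold_locales (rule that)
    show ?thesis unfolding B_def coord_def using S.L_self_converges S.L_self_exists by blast
  qed
  have part3: "let rho = twisted_action scaleM rhoM lam c;
               L = L_formal d u l coord rho;
               L\<^sub>M = L_vector d u l coord rhoM
           in
            (\<exists>W. restricted_graded_module scaleH form l scaleM rho W) \<and>
            (\<exists>!YW. vacuum_module_structure scaleM rhoM vac scaleM rho YW) \<and>
            (\<forall>YW. vacuum_module_structure scaleM rhoM vac scaleM rho YW \<longrightarrow>
              irreducible_module scaleM YW \<and>
              (\<forall>n\<ge>-1. \<forall>w. L_converges d u B coord rho n w) \<and>
              (\<forall>n\<ge>-1. n \<ge> 0 \<or> c = 0 \<or> (\<forall>h. lam h = 0) \<longrightarrow> (\<forall>w. \<exists>v. coord v = L n w)) \<and>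
              (\<forall>m\<ge>-1. \<forall>n\<ge>-1. \<forall>w.
                 extension_defined B (L m) (L n w) \<and>
                 extension_defined B (L n) (L m w) \<and>
                 (\<forall>b\<in>B. extend_operator B (L m) (L n w) b - extend_operator B (L n) (L m w) b =
                    of_int (m - n) * L (m + n) w b)) \<and>
              (\<forall>A. \<forall>n\<ge>-1. \<forall>k w.
                 extension_defined B (\<lambda>b. coord (YW A k b)) (L n w) \<and>
                 (\<forall>b\<in>B. L n (YW A k w) b - extend_operator B (\<lambda>b'. coord (YW A k b')) (L n w) b =
                    coord (\<Sum>i=-1..n. scaleM (of_nat (nat (n + 1) choose nat (i + 1)))
                                       (YW (L\<^sub>M i A) (k + n - i) w)) b)))"
    if l: "l \<noteq> 0" and lam: "Vector_Spaces.linear scaleH (*) lam" and c: "norm c < 1" for lam c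
  proof -
    interpret T: twisted_setup scaleH form d u l scaleM rhoM vac lam c
      by (intro twisted_setup.intro twisted_setup_axioms.intro V.vacuum_setup_axioms lam)
    have field: "twisted_field scaleH form d u l scaleM rhoM vac lam c YW"
      if "vacuum_module_structure scaleM rhoM vac scaleM (twisted_action scaleM rhoM lam c) YW" for YW
      by (intro twisted_field.intro twisted_field_axioms.intro T.twisted_setup_axioms
          T.R.structure_field_map that l c)
    show ?thesis
      unfolding Let_def B_def coord_def
    proof (intro conjI allI impI ballI)
      let ?rho = "twisted_action scaleM rhoM lam c"
      show "\<exists>W. restricted_graded_module scaleH form l scaleM ?rho W"
        using T.twisted_restricted_graded by blast
      show "\<exists>!YW. vacuum_module_structure scaleM rhoM vac scaleM ?rho YW"
        by (rule T.R.module_structure(1))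
      fix YW assume Y: "vacuum_module_structure scaleM rhoM vac scaleM ?rho YW"
      interpret F: twisted_field scaleH form d u l scaleM rhoM vac lam c YW by (rule field[OF Y])
      show "irreducible_module scaleM YW" by (rule T.twisted_irreducible[OF l Y])
      show "L_converges d u V.Bas V.crd ?rho n w" if "- 1 \<le> n" for n w
        by (rule F.L_converges_twisted[OF that])
      show "\<exists>v. V.crd v = F.L n w" if "- 1 \<le> n" "0 \<le> n \<or> c = 0 \<or> (\<forall>h. lam h = 0)" for n w
        by (rule F.L_vector_exists[OF that])
      fix n k :: int and A w b assume n: "- 1 \<le> n"
      show "extension_defined V.Bas (\<lambda>b. V.crd (YW A k b)) (F.L n w)"
        by (rule F.L_YW_commutator(1)[OF n])
      show "F.L n (YW A k w) b - extend_operator V.Bas (\<lambda>b'. V.crd (YW A k b')) (F.L n w) b =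
        V.crd (\<Sum>i=-1..n. scaleM (of_nat (nat (n + 1) choose nat (i + 1)))
          (YW (L_vector d u l V.crd rhoM i A) (k + n - i) w)) b"
        by (rule F.L_YW_commutator(2)[OF n])
      fix m :: int assume m: "- 1 \<le> m"
      show "extension_defined V.Bas (F.L m) (F.L n w)" "extension_defined V.Bas (F.L n) (F.L m w)"
        by (intro F.L_virasoro(1) m n)+
      show "extend_operator V.Bas (F.L m) (F.L n w) b - extend_operator V.Bas (F.L n) (F.L m w) b =
          of_int (m - n) * F.L (m + n) w b"
        by (rule F.L_virasoro(2)[OF m n])
    qed
  qed
  show ?thesis using part1 part2 part3 by blast
qed

end
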